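(* Let $m,n\ge1$ be integers, let $A$ be a real $m\times n$ matrix, and let $\psi:(0,\infty)\to(0,\infty)$ be non-increasing and dyadically regular (i.e. there exist $\varrho\in(0,1)$ and an integer $k_0\ge0$ with $\psi(2^{k+1})\le\varrho\,\psi(2^k)$ for all $k\ge k_0$). Then for $\mathcal L^m$-almost every $\mathbf b\in\mathbb T^m$, \[ \mathfrak c_{A,\psi}(\mathbf b)= \begin{cases} 0 & \text{if } \sum_{k} M_A(\psi(2^k),2^k)=\infty,\\ +\infty & \text{if } \sum_{k} M_A(\psi(2^k),2^k)<\infty. \end{cases} \]
   Context: Norms $|\cdot|$ are supremum norms; $\mathbb T^m=\mathbb R^m/\mathbb Z^m$; $|\mathbf x|_{\mathbb Z^m}:=\min_{\mathbf p\in\mathbb Z^m}|\mathbf x-\mathbf p|$; $\mathcal L^m$ is normalized Lebesgue measure on $\mathbb T^m$. The sums are over integers $k\ge0$. The inhomogeneous $\psi$-Lagrange constant of $\mathbf b\in\mathbb T^m$ with respect to $A$ is \[ \mathfrak c_{A,\psi}(\mathbf b):=\liminf_{|\mathbf q|\to\infty,\ \mathbf q\in\mathbb Z^n}\frac{|A\mathbf q-\mathbf b|_{\mathbb Z^m}}{\psi(|\mathbf q|)}\in[0,+\infty]. \] For $r,T>0$, \[ N_A(r,T):=\#\{(\mathbf p,\mathbf q)\in\mathbb Z^m\times\mathbb Z^n: |A\mathbf q-\mathbf p|\le r,\ |\mathbf q|\le T\},\qquad M_A(r,T):=\frac{r^mT^n}{N_A(r,T)}. \] *)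

theory Defs
  imports "HOL-Analysis.Analysis"
begin

definition vec_of_int :: "int ^ 'n \<Rightarrow> real ^ 'n::finite" where
  "vec_of_int p = (\<chi> i. of_int (p $ i))"

lemma vec_of_int_nth [simp]: "vec_of_int p $ i = of_int (p $ i)"
  by (simp add: vec_of_int_def)

lemma vec_of_int_0 [simp]: "vec_of_int 0 = 0"
  by (simp add: vec_eq_iff)

lemma vec_of_int_add: "vec_of_int (p + q) = vec_of_int p + vec_of_int q"
  by (simp add: vec_eq_iff)

lemma vec_of_int_minus: "vec_of_int (- p) = - vec_of_int p"
  by (simp add: vec_eq_iff)


text \<open>The sup-norm distance to the integer lattice. The infimum is attained, see below.\<close>

definition dist_int :: "real ^ 'm::finite \<Rightarrow> real" where
  "dist_int x = (INF p. infnorm (x - vec_of_int p))"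

lemma dist_int_attained: "\<exists>p. is_arg_min (\<lambda>p. infnorm (x - vec_of_int p)) (\<lambda>_. True) p
    \<and> dist_int x = infnorm (x - vec_of_int p)"
proof -
  define r :: "int ^ 'a" where "r = (\<chi> i. round (x $ i))"
  have le: "infnorm (x - vec_of_int r) \<le> infnorm (x - vec_of_int p)" for p
  proof -
    have "\<bar>(x - vec_of_int r) $ i\<bar> \<le> infnorm (x - vec_of_int p)" for i
      using round_diff_minimal[of "x $ i" "p $ i"] component_le_infnorm_cart[of "x - vec_of_int p" i]
      by (simp add: r_def)
    then show ?thesis
      unfolding infnorm_cart[of "x - vec_of_int r"] by (intro cSup_least) auto
  qed
  have "dist_int x = infnorm (x - vec_of_int r)"
    unfolding dist_int_def by (rule cInf_eq_minimum) (use le in auto)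
  then show ?thesis
    using le by (auto simp: is_arg_min_linorder)
qed

lemma dist_int_diff_vec_of_int: "dist_int (x - vec_of_int p) = dist_int x"
proof -
  have "range (\<lambda>q. infnorm (x - vec_of_int p - vec_of_int q)) = range (\<lambda>q. infnorm (x - vec_of_int q))"
  proof (intro equalityI subsetI)
    fix y assume "y \<in> range (\<lambda>q. infnorm (x - vec_of_int p - vec_of_int q))"
    then obtain q where "y = infnorm (x - vec_of_int (p + q))"
      by (auto simp: vec_of_int_add diff_diff_eq)
    then show "y \<in> range (\<lambda>q. infnorm (x - vec_of_int q))" by blast
  next
    fix y assume "y \<in> range (\<lambda>q. infnorm (x - vec_of_int q))"
    then obtain q where "y = infnorm (x - vec_of_int q)" by blast
    then have "y = infnorm (x - vec_of_int p - vec_of_int (q + - p))"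
      by (simp only: vec_of_int_add vec_of_int_minus) simp
    then show "y \<in> range (\<lambda>q. infnorm (x - vec_of_int p - vec_of_int q))" by blast
  qed
  then show ?thesis by (simp add: dist_int_def)
qed


text \<open>The type parameter is the index type: \<open>'m torus\<close> is the torus of dimension \<open>CARD('m)\<close>.\<close>

quotient_type (overloaded) 'm torus = "real ^ 'm::finite" / "\<lambda>x y. \<exists>p. x - y = vec_of_int p"
  morphisms torus_rep torus_of
proof (rule equivpI)
  show "reflp (\<lambda>x y :: real ^ 'm. \<exists>p. x - y = vec_of_int p)"
    by (auto intro!: reflpI exI[of _ 0])
  show "symp (\<lambda>x y :: real ^ 'm. \<exists>p. x - y = vec_of_int p)"
  proof (rule sympI)
    fix x y :: "real ^ 'm" assume "\<exists>p. x - y = vec_of_int p"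
    then obtain p where "x - y = vec_of_int p" ..
    then have "y - x = vec_of_int (- p)" by (simp add: vec_of_int_minus algebra_simps)
    then show "\<exists>p. y - x = vec_of_int p" ..
  qed
  show "transp (\<lambda>x y :: real ^ 'm. \<exists>p. x - y = vec_of_int p)"
  proof (rule transpI)
    fix x y z :: "real ^ 'm"
    assume "\<exists>p. x - y = vec_of_int p" "\<exists>p. y - z = vec_of_int p"
    then obtain p q where "x - y = vec_of_int p" "y - z = vec_of_int q" by blast
    then have "x - z = vec_of_int (p + q)" by (simp add: vec_of_int_add algebra_simps)
    then show "\<exists>p. x - z = vec_of_int p" ..
  qed
qed

definition unit_cube :: "(real ^ 'm::finite) set" where
  "unit_cube = {x. \<forall>i. 0 \<le> x $ i \<and> x $ i < 1}"

text \<open>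
  Normalized Lebesgue measure on the torus: a set of cosets is measurable iff its preimage in
  \<^typ>\<open>real ^ 'm\<close> is Lebesgue measurable, and it is measured on the fundamental domain
  \<^const>\<open>unit_cube\<close>.
\<close>

definition torus_measure :: "'m::finite torus measure" where
  "torus_measure = distr (lebesgue_on unit_cube) (sigma UNIV {S. torus_of -` S \<in> sets lebesgue}) torus_of"

lemma space_torus_measure [simp]: "space torus_measure = UNIV"
  by (simp add: torus_measure_def space_measure_of_conv)

lemma sets_torus_measure: "S \<in> sets torus_measure \<longleftrightarrow> torus_of -` S \<in> sets lebesgue"
  for S :: "'m::finite torus set"
proof -
  have "torus_of -` (UNIV - S) \<in> sets lebesgue" if "torus_of -` S \<in> sets lebesgue" for S :: "'m torus set"
    using sets.compl_sets[OF that] by (simp add: vimage_Diff)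
  moreover have "torus_of -` (\<Union>i. B i) \<in> sets lebesgue"
    if "range B \<subseteq> {S. torus_of -` S \<in> sets lebesgue}" for B :: "nat \<Rightarrow> 'm torus set"
    unfolding vimage_UN by (rule sets.countable_UN) (use that in auto)
  ultimately have "sigma_algebra UNIV {S :: 'm torus set. torus_of -` S \<in> sets lebesgue}"
    by (auto simp: sigma_algebra_iff2)
  then show ?thesis
    by (simp add: torus_measure_def sigma_algebra.sigma_sets_eq)
qed

lemma unit_cube_lebesgue: "(unit_cube :: (real ^ 'm::finite) set) \<in> sets lebesgue"
proof -
  have "unit_cube = (\<Inter>i. {x :: real ^ 'm. 0 \<le> x $ i} \<inter> {x. x $ i < 1})"
    by (auto simp: unit_cube_def)
  also have "\<dots> \<in> sets borel"
    by (intro sets.countable_INT'' sets.Int) auto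
  finally show ?thesis by simp
qed

lemma torus_of_measurable:
  "torus_of \<in> measurable (lebesgue_on unit_cube) (sigma UNIV {S. torus_of -` S \<in> sets lebesgue})"
  by (rule measurable_measure_of) (auto simp: sets_restrict_space)

lemma emeasure_torus_measure:
  assumes "S \<in> sets torus_measure"
  shows "emeasure torus_measure S = emeasure lebesgue (torus_of -` S \<inter> unit_cube)"
proof -
  have "emeasure torus_measure S
      = emeasure (lebesgue_on unit_cube) (torus_of -` S \<inter> space (lebesgue_on unit_cube))"
    unfolding torus_measure_def
    by (rule emeasure_distr[OF torus_of_measurable]) (use assms in \<open>simp add: torus_measure_def\<close>)
  also have "\<dots> = emeasure lebesgue (torus_of -` S \<inter> unit_cube)"
    by (simp add: emeasure_restrict_space unit_cube_lebesgue)
  finally show ?thesis .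
qed

lemma emeasure_torus_measure_UNIV: "emeasure (torus_measure :: 'm::finite torus measure) UNIV = 1"
proof -
  have sub: "box 0 1 \<subseteq> (unit_cube :: (real ^ 'm) set)" "unit_cube \<subseteq> (cbox 0 1 :: (real ^ 'm) set)"
    by (auto simp: unit_cube_def mem_box_cart less_imp_le)
  have vol: "(\<Prod>b\<in>Basis. (1 - 0 :: real ^ 'm) \<bullet> b) = 1"
    by (intro prod.neutral) (auto simp: Basis_vec_def inner_axis)
  have one: "(0 :: real ^ 'm) \<bullet> b \<le> 1 \<bullet> b" if "b \<in> Basis" for b
    using that by (auto simp: Basis_vec_def inner_axis)
  have "emeasure lebesgue (box 0 1 :: (real ^ 'm) set) = 1"
    using vol one by (simp add: emeasure_lborel_box)
  moreover have "emeasure lebesgue (cbox 0 1 :: (real ^ 'm) set) = 1"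
    using vol one by (simp add: emeasure_lborel_cbox)
  ultimately have "emeasure lebesgue (unit_cube :: (real ^ 'm) set) = 1"
    using emeasure_mono[OF sub(1) unit_cube_lebesgue] emeasure_mono[OF sub(2), of lebesgue]
    by (intro antisym) (auto simp del: emeasure_completion)
  moreover have "(UNIV :: 'm torus set) \<in> sets torus_measure"
    by (simp add: sets_torus_measure)
  ultimately show ?thesis
    by (simp add: emeasure_torus_measure)
qed


text \<open>
  Only the values of \<psi> on the positive reals are relevant. The filter is the one of
  \<open>|q| \<rightarrow> \<infinity>\<close> along the integer lattice, and the values of the quotient lie in \<^typ>\<open>ennreal\<close>,
  that is in \<open>[0, \<infinity>]\<close>.
\<close>

lift_definition lagrange_const ::
  "real ^ 'n::finite ^ 'm::finite \<Rightarrow> (real \<Rightarrow> real) \<Rightarrow> 'm torus \<Rightarrow> ennreal" is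
  "\<lambda>A \<psi> b. Liminf (filtercomap (\<lambda>q. infnorm (vec_of_int q)) at_top)
     (\<lambda>q. ennreal (dist_int (A *v vec_of_int q - b) / \<psi> (infnorm (vec_of_int q))))"
proof -
  fix A :: "real ^ 'n ^ 'm" and \<psi> :: "real \<Rightarrow> real" and b b' :: "real ^ 'm"
  assume "\<exists>p. b - b' = vec_of_int p"
  then obtain p where "b = b' + vec_of_int p" by (metis diff_add_cancel add.commute)
  then have "dist_int (y - b) = dist_int (y - b')" for y
    using dist_int_diff_vec_of_int[of "y - b'" p] by (simp add: diff_diff_eq)
  then show "Liminf (filtercomap (\<lambda>q. infnorm (vec_of_int q)) at_top)
     (\<lambda>q. ennreal (dist_int (A *v vec_of_int q - b) / \<psi> (infnorm (vec_of_int q)))) =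
    Liminf (filtercomap (\<lambda>q. infnorm (vec_of_int q)) at_top)
     (\<lambda>q. ennreal (dist_int (A *v vec_of_int q - b') / \<psi> (infnorm (vec_of_int q))))"
    by simp
qed

definition N_count :: "real ^ 'n::finite ^ 'm::finite \<Rightarrow> real \<Rightarrow> real \<Rightarrow> nat" where
  "N_count A r T = card {(p :: int ^ 'm, q :: int ^ 'n).
     infnorm (A *v vec_of_int q - vec_of_int p) \<le> r \<and> infnorm (vec_of_int q) \<le> T}"

lemma finite_N_count: "finite {(p :: int ^ 'm, q :: int ^ 'n).
     infnorm (A *v vec_of_int q - vec_of_int p) \<le> r \<and> infnorm (vec_of_int q) \<le> T}"
  for A :: "real ^ 'n::finite ^ 'm::finite"
proof -
  have fin: "finite {p :: int ^ 'k. infnorm (y - vec_of_int p) \<le> s}"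
    for y :: "real ^ 'k::finite" and s
  proof -
    have "finite (Pi\<^sub>E UNIV (\<lambda>i. {\<lfloor>y $ i - s\<rfloor>..\<lceil>y $ i + s\<rceil>}))"
      by (intro finite_PiE) auto
    then have "finite (vec_nth -` Pi\<^sub>E UNIV (\<lambda>i. {\<lfloor>y $ i - s\<rfloor>..\<lceil>y $ i + s\<rceil>}) :: (int ^ 'k) set)"
      by (rule finite_vimageI) (simp add: inj_def vec_nth_inject)
    moreover have "p $ i \<in> {\<lfloor>y $ i - s\<rfloor>..\<lceil>y $ i + s\<rceil>}" if "infnorm (y - vec_of_int p) \<le> s" for p i
      using that component_le_infnorm_cart[of "y - vec_of_int p" i] by simp linarith
    ultimately show ?thesis
      by (elim rev_finite_subset) (auto simp: PiE_iff)
  qed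
  have "finite (\<Union>q\<in>{q :: int ^ 'n. infnorm (0 - vec_of_int q) \<le> T}.
      (\<lambda>p. (p, q)) ` {p :: int ^ 'm. infnorm (A *v vec_of_int q - vec_of_int p) \<le> r})"
    by (intro finite_UN_I finite_imageI fin)
  then show ?thesis
    by (elim rev_finite_subset) (auto simp: infnorm_neg)
qed

definition M_ratio :: "real ^ 'n::finite ^ 'm::finite \<Rightarrow> real \<Rightarrow> real \<Rightarrow> real" where
  "M_ratio A r T = r ^ CARD('m) * T ^ CARD('n) / real (N_count A r T)"

definition dyadically_regular :: "(real \<Rightarrow> real) \<Rightarrow> bool" where
  "dyadically_regular \<psi> \<longleftrightarrow>
     (\<exists>\<rho>\<in>{0<..<1}. \<exists>k0::nat. \<forall>k\<ge>k0. \<psi> (2 ^ (k + 1)) \<le> \<rho> * \<psi> (2 ^ k))"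

end

theory Submission
  imports Defs
begin

text \<open>
  The pairs \<open>(A q - p, q)\<close> form a lattice \<open>\<Lambda>\<close> in \<open>\<real>\<^sup>m \<times> \<real>\<^sup>n\<close>, and \<open>M_ratio A r T\<close> is comparable to the
  measure of the union of the balls of radius \<open>r\<close> around the points \<open>A q\<close>, \<open>|q| \<le> T\<close>, of the torus:
  the number \<open>hits A r T b\<close> of such balls containing \<open>b\<close> is at most \<open>N_count A (2 * r) (2 * T)\<close>, and
  if it is positive, then \<open>N_count A r T \<le> hits A (2 * r) (2 * T) b\<close>. The convergence part is
  Markov's inequality and the Borel--Cantelli lemma.

  For divergence put \<open>r k = \<psi> (2 ^ k)\<close>. The second moment method bounds the overlap of stages
  \<open>k \<le> l\<close> by \<open>M k * M l / D k l\<close>, where \<open>D k l\<close> is the ratio at radius \<open>r k\<close> and height \<open>2 ^ l\<close>. If the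
  box of size \<open>(r k, 2 ^ l)\<close> covers modulo \<open>\<Lambda>\<close>, then \<open>D k l\<close> is bounded below and the two stages are
  quasi-independent. If not, a packing argument shows that shrinking the box by \<open>\<theta>\<close> shrinks the
  ratio by a factor of order \<open>\<theta>\<close>, so by dyadic regularity the ratios between stages \<open>k\<close> and \<open>l\<close> decay
  geometrically away from both ends; such pairs contribute only \<open>O(\<Sum> M k)\<close>. Hence infinitely many
  stages are hit with positive probability, and the zero--one law for sets invariant under the
  translations by the points \<open>A q\<close>, which divergence forces to be dense, gives full measure.
\<close>

section \<open>Packing bounds for discrete subgroups\<close>

text \<open>The obstacle is a pair of stages whose box \<open>(r k, 2 ^ l)\<close> does not cover:
  \<open>D k l\<close> may be tiny there, and the overlap can be far larger than
  \<open>M k * M l\<close>. Only the sum over all such pairs is under control. Failure to cover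
  plays the role of a large last successive minimum. Morally one direction of the box has no lattice
  points to lose, so among d = m + n directions only d - 1 reduce the count, and volume divided by
  count keeps a full factor \<theta>. The packing argument gives this without reduction theory.

  One series decides between 0 and \<infinity>, with nothing in between, because multiplying the
  radius by a constant and the height by 2 changes the ratio by bounded factors only; each half can
  therefore be run for all multiples of \<psi> at once.

  The limsup set of hits is not itself invariant, since translating by \<open>A q\<close> raises
  heights. The union of its translates is invariant, and the raised height is paid for by pairing
  the height \<open>2 ^ k\<close> with the radius \<open>\<psi> (2 ^ (k + 1))\<close>.\<close>

lemma mem_cbox_symmetric:
  fixes x k :: "'a::euclidean_space"
  shows "x \<in> cbox (- k) k \<longleftrightarrow> (\<forall>i\<in>Basis. \<bar>x \<bullet> i\<bar> \<le> k \<bullet> i)"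
  by (auto simp: mem_box abs_le_iff)

lemma mem_cbox_centered:
  fixes x c k :: "'a::euclidean_space"
  shows "x \<in> cbox (c - k) (c + k) \<longleftrightarrow> (\<forall>i\<in>Basis. \<bar>(x - c) \<bullet> i\<bar> \<le> k \<bullet> i)"
  by (force simp: mem_box abs_le_iff inner_diff_left inner_add_left)

lemma emeasure_lborel_cbox_centered:
  fixes c k :: "'a::euclidean_space"
  assumes "\<And>i. i \<in> Basis \<Longrightarrow> 0 \<le> k \<bullet> i"
  shows "emeasure lborel (cbox (c - k) (c + k)) = ennreal (2 ^ DIM('a) * (\<Prod>i\<in>Basis. k \<bullet> i))"
proof -
  have "emeasure lborel (cbox (c - k) (c + k)) = (\<Prod>i\<in>Basis. 2 * (k \<bullet> i))"
    using assms by (subst emeasure_lborel_cbox) (auto simp: inner_diff_left inner_add_left intro!: prod.cong arg_cong[where f=ennreal])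
  then show ?thesis by (simp add: prod.distrib)
qed

text \<open>Double counting: the number of small boxes above a point is integrated over space. It is
  at most \<open>N\<close> and vanishes outside \<open>cbox (- K) K\<close>; the factor
  \<open>2 ^ DIM('a)\<close> between half sides and volume cancels.\<close>

lemma box_packing:
  fixes c :: "'j \<Rightarrow> 'a::euclidean_space"
  assumes J: "finite J"
    and \<kappa>: "\<And>i. i \<in> Basis \<Longrightarrow> 0 \<le> \<kappa> \<bullet> i" and K: "\<And>i. i \<in> Basis \<Longrightarrow> 0 \<le> K \<bullet> i"
    and sub: "\<And>j. j \<in> J \<Longrightarrow> cbox (c j - \<kappa>) (c j + \<kappa>) \<subseteq> cbox (- K) K"
    and mult: "\<And>z. card {j \<in> J. z \<in> cbox (c j - \<kappa>) (c j + \<kappa>)} \<le> N"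
  shows "real (card J) * (\<Prod>i\<in>Basis. \<kappa> \<bullet> i) \<le> real N * (\<Prod>i\<in>Basis. K \<bullet> i)"
proof -
  define v where "v k = 2 ^ DIM('a) * (\<Prod>i\<in>Basis. k \<bullet> i)" for k :: 'a
  have pos: "0 \<le> v \<kappa>" "0 \<le> v K" unfolding v_def by (intro mult_nonneg_nonneg prod_nonneg \<kappa> K; simp)+
  have "ennreal (card J * v \<kappa>) = (\<Sum>j\<in>J. emeasure lborel (cbox (c j - \<kappa>) (c j + \<kappa>)))"
    by (simp add: emeasure_lborel_cbox_centered[OF \<kappa>] v_def[symmetric] ennreal_mult' ennreal_of_nat_eq_real_of_nat)
  also have "\<dots> = (\<integral>\<^sup>+z. (\<Sum>j\<in>J. indicator (cbox (c j - \<kappa>) (c j + \<kappa>)) z) \<partial>lborel)"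
    by (simp add: nn_integral_sum)
  also have "\<dots> \<le> (\<integral>\<^sup>+z. of_nat N * indicator (cbox (- K) K) z \<partial>lborel)"
  proof (rule nn_integral_mono)
    fix z
    have "(\<Sum>j\<in>J. indicator (cbox (c j - \<kappa>) (c j + \<kappa>)) z) = (of_nat (card {j \<in> J. z \<in> cbox (c j - \<kappa>) (c j + \<kappa>)}) :: ennreal)"
      using J by (simp add: indicator_def sum.If_cases Int_def)
    also have "\<dots> \<le> of_nat N * indicator (cbox (- K) K) z"
    proof (cases "{j \<in> J. z \<in> cbox (c j - \<kappa>) (c j + \<kappa>)} = {}")
      case False
      then have "z \<in> cbox (- K) K" using sub by auto
      then show ?thesis using mult[of z] by simp
    qed (metis card.empty of_nat_0 zero_le)
    finally show "(\<Sum>j\<in>J. indicator (cbox (c j - \<kappa>) (c j + \<kappa>)) z) \<le> (of_nat N * indicator (cbox (- K) K) z :: ennreal)" .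
  qed
  also have "\<dots> = of_nat N * emeasure lborel (cbox (0 - K) (0 + K))"
    by (subst nn_integral_cmult) auto
  also have "\<dots> = ennreal (N * v K)"
    by (subst emeasure_lborel_cbox_centered[OF K]) (simp_all add: v_def ennreal_mult' ennreal_of_nat_eq_real_of_nat)
  finally have "card J * v \<kappa> \<le> N * v K"
    using pos by (simp add: ennreal_le_iff)
  then show ?thesis by (simp add: v_def algebra_simps)
qed

text \<open>Discreteness enters as finiteness of the intersections with boxes. A box is given by the
  vector of its half sides, so that radius and height of a lattice box can be scaled
  independently.\<close>

locale discrete_subgroup =
  fixes \<Lambda> :: "'a::euclidean_space set"
  assumes zero_mem: "0 \<in> \<Lambda>"
    and diff_mem: "x \<in> \<Lambda> \<Longrightarrow> y \<in> \<Lambda> \<Longrightarrow> x - y \<in> \<Lambda>"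
    and finite_box: "finite (\<Lambda> \<inter> cbox (- k) k)"
begin

definition cnt :: "'a \<Rightarrow> nat" where
  "cnt k = card (\<Lambda> \<inter> cbox (- k) k)"

definition covers :: "'a \<Rightarrow> bool" where
  "covers k \<longleftrightarrow> (\<forall>z. \<exists>\<nu>\<in>\<Lambda>. z - \<nu> \<in> cbox (- k) k)"

lemma cnt_mono:
  assumes "\<And>i. i \<in> Basis \<Longrightarrow> k \<bullet> i \<le> k' \<bullet> i"
  shows "cnt k \<le> cnt k'"
  unfolding cnt_def using assms
  by (intro card_mono finite_box) (force simp: mem_cbox_symmetric)

lemma cnt_pos: "(\<And>i. i \<in> Basis \<Longrightarrow> 0 \<le> k \<bullet> i) \<Longrightarrow> 0 < cnt k"
  unfolding cnt_def using finite_box zero_mem by (auto simp: card_gt_0_iff mem_cbox_symmetric)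

lemma card_translates_le_cnt:
  assumes "finite S"
    and "\<And>x y. x \<in> S \<Longrightarrow> y \<in> S \<Longrightarrow> x - y \<in> \<Lambda> \<inter> cbox (- k) k"
  shows "card S \<le> cnt k"
proof (cases "S = {}")
  case False
  then obtain x0 where "x0 \<in> S" by auto
  then show ?thesis unfolding cnt_def using assms
    by (intro card_inj_on_le[of "\<lambda>x. x - x0"] finite_box) (auto simp: inj_on_def)
qed simp

text \<open>Boxes of half size \<open>k / 2\<close> around the lattice points of the box
  \<open>k'\<close> stay inside \<open>k' + k / 2\<close>, and two of them share a point only if
  their centres differ by an element counted by \<open>cnt k\<close>.\<close>

lemma cnt_packing:
  assumes k: "\<And>i. i \<in> Basis \<Longrightarrow> 0 < k \<bullet> i" and k': "\<And>i. i \<in> Basis \<Longrightarrow> 0 < k' \<bullet> i"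
  shows "real (cnt k') * (\<Prod>i\<in>Basis. k \<bullet> i) \<le> real (cnt k) * (\<Prod>i\<in>Basis. 2 * (k' \<bullet> i) + k \<bullet> i)"
proof -
  define \<kappa> where "\<kappa> = k /\<^sub>R 2"
  have \<kappa>: "\<kappa> \<bullet> i = k \<bullet> i / 2" for i by (simp add: \<kappa>_def)
  have "real (card (\<Lambda> \<inter> cbox (- k') k')) * (\<Prod>i\<in>Basis. \<kappa> \<bullet> i) \<le> real (cnt k) * (\<Prod>i\<in>Basis. (k' + \<kappa>) \<bullet> i)"
  proof (rule box_packing[where c="\<lambda>x. x"])
    fix z
    show "card {j \<in> \<Lambda> \<inter> cbox (- k') k'. z \<in> cbox (j - \<kappa>) (j + \<kappa>)} \<le> cnt k"
    proof (rule card_translates_le_cnt)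
      fix x y assume xy: "x \<in> {j \<in> \<Lambda> \<inter> cbox (- k') k'. z \<in> cbox (j - \<kappa>) (j + \<kappa>)}"
        "y \<in> {j \<in> \<Lambda> \<inter> cbox (- k') k'. z \<in> cbox (j - \<kappa>) (j + \<kappa>)}"
      have "\<bar>(x - y) \<bullet> i\<bar> \<le> k \<bullet> i" if i: "i \<in> Basis" for i
      proof -
        have "\<bar>(z - x) \<bullet> i\<bar> \<le> \<kappa> \<bullet> i" "\<bar>(z - y) \<bullet> i\<bar> \<le> \<kappa> \<bullet> i"
          using xy i unfolding mem_cbox_centered by auto
        then show ?thesis unfolding \<kappa> inner_diff_left by linarith
      qed
      then show "x - y \<in> \<Lambda> \<inter> cbox (- k) k"
        using xy by (auto simp: diff_mem mem_cbox_symmetric)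
    qed (rule finite_subset[OF _ finite_box[of k']], auto)
  next
    fix j assume "j \<in> \<Lambda> \<inter> cbox (- k') k'"
    then have j: "\<bar>j \<bullet> i\<bar> \<le> k' \<bullet> i" if "i \<in> Basis" for i using that by (auto simp: mem_cbox_symmetric)
    show "cbox (j - \<kappa>) (j + \<kappa>) \<subseteq> cbox (- (k' + \<kappa>)) (k' + \<kappa>)"
    proof
      fix x assume "x \<in> cbox (j - \<kappa>) (j + \<kappa>)"
      then have "\<bar>x \<bullet> i\<bar> \<le> (k' + \<kappa>) \<bullet> i" if "i \<in> Basis" for i
        using that j[OF that] unfolding mem_cbox_centered inner_diff_left inner_add_left by force
      then show "x \<in> cbox (- (k' + \<kappa>)) (k' + \<kappa>)" by (simp only: mem_cbox_symmetric) auto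
    qed
  qed (use k k' in \<open>auto simp: finite_box \<kappa> inner_add_left less_imp_le add_nonneg_nonneg\<close>)
  moreover have two: "(\<Prod>i\<in>Basis. 2 * f i) = 2 ^ DIM('a) * (\<Prod>i\<in>Basis. f i)" for f :: "'a \<Rightarrow> real"
    by (simp add: prod.distrib)
  ultimately
  have "real (cnt k') * (\<Prod>i\<in>Basis. 2 * (\<kappa> \<bullet> i)) \<le> real (cnt k) * (\<Prod>i\<in>Basis. 2 * ((k' + \<kappa>) \<bullet> i))"
    unfolding two by (simp add: cnt_def mult_ac)
  then show ?thesis by (simp add: \<kappa> inner_add_left)
qed

text \<open>Here \<open>2 * k' + k\<close> is at most \<open>3 * k'\<close>. So volume divided by
  count increases with the box up to the factor \<open>3 ^ DIM('a)\<close>.\<close>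

lemma cnt_ratio:
  assumes k: "\<And>i. i \<in> Basis \<Longrightarrow> 0 < k \<bullet> i" and le: "\<And>i. i \<in> Basis \<Longrightarrow> k \<bullet> i \<le> k' \<bullet> i"
  shows "real (cnt k') * (\<Prod>i\<in>Basis. k \<bullet> i) \<le> 3 ^ DIM('a) * real (cnt k) * (\<Prod>i\<in>Basis. k' \<bullet> i)"
proof -
  have k': "0 < k' \<bullet> i" if "i \<in> Basis" for i using k[OF that] le[OF that] by linarith
  have "(\<Prod>i\<in>Basis. 2 * (k' \<bullet> i) + k \<bullet> i) \<le> (\<Prod>i\<in>Basis. 3 * (k' \<bullet> i))"
    using le k k' by (intro prod_mono) (force intro!: add_nonneg_nonneg simp: less_imp_le)
  then have "(\<Prod>i\<in>Basis. 2 * (k' \<bullet> i) + k \<bullet> i) \<le> 3 ^ DIM('a) * (\<Prod>i\<in>Basis. k' \<bullet> i)"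
    by (simp add: prod.distrib)
  then have "real (cnt k) * (\<Prod>i\<in>Basis. 2 * (k' \<bullet> i) + k \<bullet> i) \<le> real (cnt k) * (3 ^ DIM('a) * (\<Prod>i\<in>Basis. k' \<bullet> i))"
    by (intro mult_left_mono) auto
  with cnt_packing[of k k'] k k' show ?thesis by (simp add: mult_ac)
qed

lemma cnt_scale_le:
  assumes k: "\<And>i. i \<in> Basis \<Longrightarrow> 0 < k \<bullet> i" and a: "0 < a" "0 < b"
  shows "real (cnt (b *\<^sub>R k)) * a ^ DIM('a) \<le> real (cnt (a *\<^sub>R k)) * (2 * b + a) ^ DIM('a)"
proof -
  have pos: "0 < (\<Prod>i\<in>Basis. k \<bullet> i)" using k by (intro prod_pos) auto
  have "real (cnt (b *\<^sub>R k)) * (\<Prod>i\<in>Basis. a * (k \<bullet> i)) \<le> real (cnt (a *\<^sub>R k)) * (\<Prod>i\<in>Basis. (2 * b + a) * (k \<bullet> i))"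
    using cnt_packing[of "a *\<^sub>R k" "b *\<^sub>R k"] k a by (simp add: algebra_simps)
  then show ?thesis using pos by (simp add: prod.distrib mult.assoc[symmetric])
qed

text \<open>If \<open>\<Lambda> + cbox (- k) k\<close> is not everything, the neighbourhoods of \<open>\<Lambda>\<close> of size \<open>j \<kappa>\<close>,
  \<open>j \<le> 3 s\<close>, are strictly increasing in \<open>j\<close>; picking a new point at every third step gives \<open>s\<close>
  points whose boxes of size \<open>\<kappa>\<close> are disjoint modulo \<open>\<Lambda>\<close>.\<close>

lemma exists_separated:
  assumes k: "\<And>i. i \<in> Basis \<Longrightarrow> 0 < k \<bullet> i" and nc: "\<not> covers k" and s: "0 < s"
  defines "\<kappa> \<equiv> k /\<^sub>R (3 * real s)"
  obtains z where "\<And>i. i \<in> {1..s} \<Longrightarrow> z i \<in> cbox (- k) k"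
    and "\<And>i j \<nu>. i \<in> {1..s} \<Longrightarrow> j \<in> {1..s} \<Longrightarrow> \<nu> \<in> \<Lambda> \<Longrightarrow> z i - z j - \<nu> \<in> cbox (- (2 *\<^sub>R \<kappa>)) (2 *\<^sub>R \<kappa>) \<Longrightarrow> i = j"
proof -
  define P where "P j = {z. \<exists>\<nu>\<in>\<Lambda>. \<forall>i\<in>Basis. \<bar>(z - \<nu>) \<bullet> i\<bar> \<le> real j * (\<kappa> \<bullet> i)}" for j :: nat
  have \<kappa>: "0 < \<kappa> \<bullet> i" if "i \<in> Basis" for i using k[OF that] s by (simp add: \<kappa>_def)
  have k\<kappa>: "k \<bullet> i = 3 * real s * (\<kappa> \<bullet> i)" for i using s by (simp add: \<kappa>_def)
  obtain z0 where "z0 \<notin> P (3 * s)"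
    using nc by (auto simp: covers_def P_def mem_cbox_symmetric k\<kappa>)
  have P_mono: "P j \<subseteq> P j'" if "j \<le> j'" for j j'
  proof
    fix x assume "x \<in> P j"
    moreover have "real j * (\<kappa> \<bullet> i) \<le> real j' * (\<kappa> \<bullet> i)" if "i \<in> Basis" for i
      using \<kappa>[OF that] \<open>j \<le> j'\<close> by simp
    ultimately show "x \<in> P j'" unfolding P_def by (blast intro: order_trans)
  qed
  \<comment> \<open>A step that adds nothing would stop the growth for good, while
    \<open>0 \<in> \<Lambda>\<close> makes the sets \<open>P n\<close> exhaust the space. As
    \<open>z0\<close> is still missing from \<open>P (3 * s)\<close>, no step up to there is
    idle.\<close>
  have strict: "\<not> P (Suc j) \<subseteq> P j" if "j \<le> 3 * s" for j
  proof
    assume stop: "P (Suc j) \<subseteq> P j"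
    have "P (j + n) \<subseteq> P j" for n
    proof (induction n)
      case (Suc n)
      show ?case
      proof (cases "j + n = 0")
        case False
        \<comment> \<open>Contracting \<open>z - \<nu>\<close> by \<open>u\<close> lands in
          \<open>P (j + n)\<close>, hence in \<open>P j\<close> by induction; the part removed has
          size at most \<open>\<kappa>\<close>, which is one further step.\<close>
        define u where "u = real (j + n) / real (Suc (j + n))"
        have u: "u * (real (Suc (j + n)) * x) = real (j + n) * x" "(1 - u) * (real (Suc (j + n)) * x) = x" "0 \<le> u" "u \<le> 1" for x
          by (auto simp: u_def field_simps)
        show ?thesis
        proof
          fix z assume "z \<in> P (j + Suc n)"
          then obtain \<nu> where l: "\<nu> \<in> \<Lambda>" and z: "\<And>i. i \<in> Basis \<Longrightarrow> \<bar>(z - \<nu>) \<bullet> i\<bar> \<le> real (Suc (j + n)) * (\<kappa> \<bullet> i)"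
            by (auto simp: P_def)
          define z' where "z' = \<nu> + u *\<^sub>R (z - \<nu>)"
          have "\<bar>(z' - \<nu>) \<bullet> i\<bar> \<le> real (j + n) * (\<kappa> \<bullet> i)" if "i \<in> Basis" for i
            using mult_left_mono[OF z[OF that] u(3)] u by (simp add: z'_def abs_mult del: of_nat_Suc of_nat_add)
          with l have "z' \<in> P (j + n)" by (auto simp: P_def)
          then obtain \<nu>' where l': "\<nu>' \<in> \<Lambda>" and z': "\<And>i. i \<in> Basis \<Longrightarrow> \<bar>(z' - \<nu>') \<bullet> i\<bar> \<le> real j * (\<kappa> \<bullet> i)"
            using subsetD[OF Suc.IH, of z'] by (auto simp: P_def)
          have "\<bar>(z - \<nu>') \<bullet> i\<bar> \<le> real (Suc j) * (\<kappa> \<bullet> i)" if "i \<in> Basis" for i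
          proof -
            have "z - z' = (1 - u) *\<^sub>R (z - \<nu>)" by (simp add: z'_def algebra_simps)
            then have "\<bar>(z - z') \<bullet> i\<bar> \<le> \<kappa> \<bullet> i"
              using mult_left_mono[OF z[OF that], of "1 - u"] u by (simp add: abs_mult del: of_nat_Suc of_nat_add)
            then show ?thesis using z'[OF that] by (simp add: inner_diff_left algebra_simps)
          qed
          then have "z \<in> P (Suc j)" using l' by (auto simp: P_def)
          then show "z \<in> P j" using stop by auto
        qed
      qed (use stop in auto)
    qed simp
    moreover have "\<exists>n. z0 \<in> P n"
    proof -
      have "\<exists>n::nat. \<forall>i\<in>Basis. \<bar>z0 \<bullet> i\<bar> / (\<kappa> \<bullet> i) \<le> real n"
      proof -
        obtain n :: nat where n: "Max ((\<lambda>i. \<bar>z0 \<bullet> i\<bar> / (\<kappa> \<bullet> i)) ` Basis) \<le> real n"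
          using real_arch_simple by blast
        have "\<bar>z0 \<bullet> i\<bar> / (\<kappa> \<bullet> i) \<le> real n" if "i \<in> Basis" for i
          using that by (intro order_trans[OF Max_ge n]) auto
        then show ?thesis by auto
      qed
      then obtain n :: nat where "\<forall>i\<in>Basis. \<bar>(z0 - 0) \<bullet> i\<bar> \<le> real n * (\<kappa> \<bullet> i)"
        using \<kappa> by (auto simp: field_simps)
      then show ?thesis using zero_mem unfolding P_def by blast
    qed
    then obtain n where "z0 \<in> P n" ..
    with P_mono[of n "j + n"] have "z0 \<in> P (j + n)" by auto
    ultimately have "z0 \<in> P (3 * s)" using P_mono[OF that] by blast
    with \<open>z0 \<notin> P (3 * s)\<close> show False by simp
  qed
  \<comment> \<open>The new points can be moved into \<open>cbox (- k) k\<close>: each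
    \<open>P j\<close> is invariant under \<open>\<Lambda>\<close>, and \<open>3 * i\<close> steps
    of size \<open>\<kappa>\<close> amount to at most \<open>k\<close>.\<close>
  have "\<exists>z. z \<in> cbox (- k) k \<and> z \<in> P (3 * i) \<and> z \<notin> P (3 * i - 1)" if i: "i \<in> {1..s}" for i
  proof -
    have "3 * i = Suc (3 * i - 1)" using i by auto
    then obtain z where z: "z \<in> P (3 * i)" "z \<notin> P (3 * i - 1)" using strict[of "3 * i - 1"] i by auto
    then obtain \<nu> where l: "\<nu> \<in> \<Lambda>" "\<And>b. b \<in> Basis \<Longrightarrow> \<bar>(z - \<nu>) \<bullet> b\<bar> \<le> real (3 * i) * (\<kappa> \<bullet> b)"
      by (auto simp: P_def)
    have "z - \<nu> \<notin> P (3 * i - 1)"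
    proof
      assume "z - \<nu> \<in> P (3 * i - 1)"
      then obtain \<mu> where m: "\<mu> \<in> \<Lambda>" "\<forall>b\<in>Basis. \<bar>(z - \<nu> - \<mu>) \<bullet> b\<bar> \<le> real (3 * i - 1) * (\<kappa> \<bullet> b)"
        by (auto simp: P_def)
      have "\<mu> - (0 - \<nu>) \<in> \<Lambda>" by (intro diff_mem m l zero_mem)
      then have "\<mu> + \<nu> \<in> \<Lambda>" by simp
      with m(2) have "z \<in> P (3 * i - 1)" by (auto simp: P_def diff_diff_eq add.commute intro!: bexI[of _ "\<mu> + \<nu>"])
      with z show False by simp
    qed
    moreover have "z - \<nu> \<in> P (3 * i)" using l zero_mem by (auto simp: P_def intro!: bexI[of _ 0])
    moreover have "z - \<nu> \<in> cbox (- k) k"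
    proof -
      have "real (3 * i) * (\<kappa> \<bullet> b) \<le> k \<bullet> b" if "b \<in> Basis" for b
        using \<kappa>[OF that] i by (simp add: k\<kappa>)
      then show ?thesis unfolding mem_cbox_symmetric using l(2) order_trans by blast
    qed
    ultimately show ?thesis by blast
  qed
  then obtain z where z: "\<And>i. i \<in> {1..s} \<Longrightarrow> z i \<in> cbox (- k) k"
    "\<And>i. i \<in> {1..s} \<Longrightarrow> z i \<in> P (3 * i)" "\<And>i. i \<in> {1..s} \<Longrightarrow> z i \<notin> P (3 * i - 1)"
    by metis
  \<comment> \<open>The spacing by three leaves room for the tolerance \<open>2 * \<kappa>\<close>:
    closeness modulo \<open>\<Lambda>\<close> would put \<open>z j\<close> into
    \<open>P (3 * i + 2)\<close>, which lies in the excluded \<open>P (3 * j - 1)\<close>.\<close>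
  have sep: False if ij: "i \<in> {1..s}" "j \<in> {1..s}" "i < j" and l: "\<nu> \<in> \<Lambda>"
    "\<And>b. b \<in> Basis \<Longrightarrow> \<bar>(z j - z i - \<nu>) \<bullet> b\<bar> \<le> 2 * (\<kappa> \<bullet> b)" for i j \<nu>
  proof -
    obtain \<mu> where m: "\<mu> \<in> \<Lambda>" "\<And>b. b \<in> Basis \<Longrightarrow> \<bar>(z i - \<mu>) \<bullet> b\<bar> \<le> real (3 * i) * (\<kappa> \<bullet> b)"
      using z(2)[OF ij(1)] by (auto simp: P_def)
    have "\<nu> - (0 - \<mu>) \<in> \<Lambda>" by (intro diff_mem m l zero_mem)
    moreover have "\<bar>(z j - (\<nu> - (0 - \<mu>))) \<bullet> b\<bar> \<le> real (3 * i + 2) * (\<kappa> \<bullet> b)" if "b \<in> Basis" for b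
      using l(2)[OF that] m(2)[OF that] by (simp add: inner_diff_left inner_add_left algebra_simps)
    ultimately have "z j \<in> P (3 * i + 2)" by (auto simp: P_def)
    moreover have "P (3 * i + 2) \<subseteq> P (3 * j - 1)" using ij by (intro P_mono) auto
    ultimately show False using z(3)[OF ij(2)] by auto
  qed
  show ?thesis
  proof (rule that[of z])
    fix i j \<nu> assume ij: "i \<in> {1..s}" "j \<in> {1..s}" and l: "\<nu> \<in> \<Lambda>"
      and d: "z i - z j - \<nu> \<in> cbox (- (2 *\<^sub>R \<kappa>)) (2 *\<^sub>R \<kappa>)"
    then have d1: "\<bar>(z i - z j - \<nu>) \<bullet> b\<bar> \<le> 2 * (\<kappa> \<bullet> b)" if "b \<in> Basis" for b
      using that by (auto simp: mem_cbox_symmetric)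
    have d2: "\<bar>(z j - z i - (0 - \<nu>)) \<bullet> b\<bar> \<le> 2 * (\<kappa> \<bullet> b)" if "b \<in> Basis" for b
      using d1[OF that] by (simp add: inner_diff_left inner_add_left abs_le_iff)
    show "i = j"
      using sep[OF ij(2,1) _ l d1] sep[OF ij _ diff_mem[OF zero_mem l] d2] by (metis linorder_neqE_nat)
  qed (use z in auto)
qed

text \<open>The separated points turn each lattice point of the box into \<open>s\<close> centres.
  Boxes of half size \<open>\<kappa>\<close> can overlap only if they come from the same separated
  point, so the multiplicity stays \<open>cnt (2 *\<^sub>R \<kappa>)\<close> and plain packing
  improves by the factor \<open>s\<close>. The enclosing box \<open>3 *\<^sub>R k\<close> is
  \<open>9 * s\<close> times \<open>\<kappa>\<close>.\<close>

lemma cnt_sparse: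
  assumes k: "\<And>i. i \<in> Basis \<Longrightarrow> 0 < k \<bullet> i" and nc: "\<not> covers k" and s: "0 < s"
  defines "\<kappa> \<equiv> k /\<^sub>R (3 * real s)"
  shows "real s * real (cnt k) \<le> real (cnt (2 *\<^sub>R \<kappa>)) * (9 * real s) ^ DIM('a)"
proof -
  obtain z where z: "\<And>i. i \<in> {1..s} \<Longrightarrow> z i \<in> cbox (- k) k"
    and sep: "\<And>i j \<nu>. i \<in> {1..s} \<Longrightarrow> j \<in> {1..s} \<Longrightarrow> \<nu> \<in> \<Lambda> \<Longrightarrow> z i - z j - \<nu> \<in> cbox (- (2 *\<^sub>R \<kappa>)) (2 *\<^sub>R \<kappa>) \<Longrightarrow> i = j"
    using exists_separated[OF k nc s] unfolding \<kappa>_def by metis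
  have \<kappa>: "0 < \<kappa> \<bullet> i" if "i \<in> Basis" for i using k[OF that] s by (simp add: \<kappa>_def)
  have k\<kappa>: "k \<bullet> i = 3 * real s * (\<kappa> \<bullet> i)" for i using s by (simp add: \<kappa>_def)
  have \<kappa>k: "\<kappa> \<bullet> i \<le> k \<bullet> i" if "i \<in> Basis" for i using \<kappa>[OF that] s by (simp add: k\<kappa>)
  define J where "J = {1..s} \<times> (\<Lambda> \<inter> cbox (- k) k)"
  define c where "c = (\<lambda>(i, \<nu>). z i + \<nu>)"
  have "real (card J) * (\<Prod>i\<in>Basis. \<kappa> \<bullet> i) \<le> real (cnt (2 *\<^sub>R \<kappa>)) * (\<Prod>i\<in>Basis. (3 *\<^sub>R k) \<bullet> i)"
  proof (rule box_packing[where c=c])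
    show "finite J" by (simp add: J_def finite_box)
  next
    fix j assume "j \<in> J"
    then obtain i0 \<nu>0 where j0: "c j = z i0 + \<nu>0" "z i0 \<in> cbox (- k) k" "\<nu>0 \<in> cbox (- k) k"
      using z by (auto simp: J_def c_def)
    have j: "\<bar>c j \<bullet> i\<bar> \<le> 2 * (k \<bullet> i)" if "i \<in> Basis" for i
    proof -
      have "\<bar>z i0 \<bullet> i\<bar> \<le> k \<bullet> i" "\<bar>\<nu>0 \<bullet> i\<bar> \<le> k \<bullet> i"
        using j0(2,3) that unfolding mem_cbox_symmetric by auto
      then show ?thesis by (simp add: j0(1) inner_add_left)
    qed
    show "cbox (c j - \<kappa>) (c j + \<kappa>) \<subseteq> cbox (- (3 *\<^sub>R k)) (3 *\<^sub>R k)"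
    proof
      fix x assume x: "x \<in> cbox (c j - \<kappa>) (c j + \<kappa>)"
      have "\<bar>x \<bullet> i\<bar> \<le> 3 * (k \<bullet> i)" if "i \<in> Basis" for i
      proof -
        have "\<bar>(x - c j) \<bullet> i\<bar> \<le> \<kappa> \<bullet> i" using x that unfolding mem_cbox_centered by auto
        then show ?thesis using j[OF that] \<kappa>k[OF that] by (simp add: inner_diff_left)
      qed
      then show "x \<in> cbox (- (3 *\<^sub>R k)) (3 *\<^sub>R k)" by (simp only: mem_cbox_symmetric) auto
    qed
  next
    fix x
    define S where "S = {j \<in> J. x \<in> cbox (c j - \<kappa>) (c j + \<kappa>)}"
    have fin: "finite S" by (simp add: S_def J_def finite_box)
    have close: "\<bar>(c j - c j') \<bullet> i\<bar> \<le> 2 * (\<kappa> \<bullet> i)" if "j \<in> S" "j' \<in> S" "i \<in> Basis" for j j' i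
    proof -
      have "\<bar>(x - c j) \<bullet> i\<bar> \<le> \<kappa> \<bullet> i" "\<bar>(x - c j') \<bullet> i\<bar> \<le> \<kappa> \<bullet> i"
        using that unfolding S_def mem_cbox_centered by auto
      then show ?thesis by (simp add: inner_diff_left)
    qed
    have same: "fst j = fst j'" if "j \<in> S" "j' \<in> S" for j j'
    proof (rule sep)
      show "snd j' - snd j \<in> \<Lambda>" using that by (auto simp: S_def J_def intro!: diff_mem)
      have "z (fst j) - z (fst j') - (snd j' - snd j) = c j - c j'"
        by (simp add: c_def case_prod_beta)
      then show "z (fst j) - z (fst j') - (snd j' - snd j) \<in> cbox (- (2 *\<^sub>R \<kappa>)) (2 *\<^sub>R \<kappa>)"
        using close[OF that] by (simp add: mem_cbox_symmetric)
    qed (use that in \<open>auto simp: S_def J_def\<close>)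
    have "card S = card (snd ` S)"
      by (rule card_image[symmetric], rule inj_onI) (metis same prod_eqI)
    also have "\<dots> \<le> cnt (2 *\<^sub>R \<kappa>)"
    proof (rule card_translates_le_cnt)
      fix a b assume "a \<in> snd ` S" "b \<in> snd ` S"
      then obtain j j' where j: "j \<in> S" "j' \<in> S" "a = snd j" "b = snd j'" by auto
      have "a - b = c j - c j'" using same[OF j(1,2)] j by (simp add: c_def case_prod_beta)
      moreover have "a - b \<in> \<Lambda>" using j by (auto simp: S_def J_def intro!: diff_mem)
      ultimately show "a - b \<in> \<Lambda> \<inter> cbox (- (2 *\<^sub>R \<kappa>)) (2 *\<^sub>R \<kappa>)"
        using close[OF j(1,2)] by (auto simp: mem_cbox_symmetric)
    qed (rule finite_imageI[OF fin])
    finally show "card {j \<in> J. x \<in> cbox (c j - \<kappa>) (c j + \<kappa>)} \<le> cnt (2 *\<^sub>R \<kappa>)" unfolding S_def .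
  next
    fix i :: 'a assume i: "i \<in> Basis"
    show "0 \<le> \<kappa> \<bullet> i" using \<kappa>[OF i] by simp
    show "0 \<le> (3 *\<^sub>R k) \<bullet> i" using k[OF i] by simp
  qed
  also have "card J = s * cnt k" by (simp add: J_def cnt_def card_cartesian_product)
  also have "(\<Prod>i\<in>Basis. (3 *\<^sub>R k) \<bullet> i) = (9 * real s) ^ DIM('a) * (\<Prod>i\<in>Basis. \<kappa> \<bullet> i)"
  proof -
    have "(\<Prod>i\<in>Basis. (3 *\<^sub>R k) \<bullet> i) = (\<Prod>i\<in>Basis. (9 * real s) * (\<kappa> \<bullet> i))"
      by (intro prod.cong refl) (simp add: k\<kappa>)
    then show ?thesis by (simp add: prod.distrib power_mult_distrib)
  qed
  finally have "(real s * real (cnt k)) * (\<Prod>i\<in>Basis. \<kappa> \<bullet> i) \<le> (real (cnt (2 *\<^sub>R \<kappa>)) * (9 * real s) ^ DIM('a)) * (\<Prod>i\<in>Basis. \<kappa> \<bullet> i)"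
    by (simp add: mult_ac)
  moreover have "0 < (\<Prod>i\<in>Basis. \<kappa> \<bullet> i)" using \<kappa> by (intro prod_pos) auto
  ultimately show ?thesis by (rule mult_right_le_imp_le)
qed

text \<open>With \<open>s\<close> of order \<open>1 / \<theta>\<close> the factor \<open>s\<close>
  in \<open>cnt_sparse\<close> becomes the gain of one power of \<theta> over
  \<open>cnt_scale_le\<close>. For \<open>\<theta> > 1/3\<close> the latter suffices because
  \<open>6 * \<theta>\<close> exceeds 1.\<close>

lemma cnt_not_covers:
  assumes k: "\<And>i. i \<in> Basis \<Longrightarrow> 0 < k \<bullet> i" and nc: "\<not> covers k" and \<theta>: "0 < \<theta>" "\<theta> \<le> 1"
  shows "real (cnt k) * \<theta> ^ DIM('a) \<le> 6 * 81 ^ DIM('a) * \<theta> * real (cnt (\<theta> *\<^sub>R k))"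
proof (cases "\<theta> \<le> 1/3")
  case True
  define s where "s = nat \<lfloor>1 / (3 * \<theta>)\<rfloor>"
  have ge1: "1 \<le> 1 / (3 * \<theta>)" using True \<theta> by (simp add: field_simps)
  then have "1 \<le> \<lfloor>1 / (3 * \<theta>)\<rfloor>" by (simp add: le_floor_iff)
  then have s: "real s \<le> 1 / (3 * \<theta>)" "1 / (3 * \<theta>) < real s + 1" "1 \<le> real s" "0 < s"
  proof -
    have "real s = of_int \<lfloor>1 / (3 * \<theta>)\<rfloor>" using \<open>1 \<le> \<lfloor>1 / (3 * \<theta>)\<rfloor>\<close> unfolding s_def by (intro of_nat_nat) linarith
    then show "real s \<le> 1 / (3 * \<theta>)" "1 / (3 * \<theta>) < real s + 1" "1 \<le> real s" "0 < s"
      using \<open>1 \<le> \<lfloor>1 / (3 * \<theta>)\<rfloor>\<close> by linarith+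
  qed
  \<comment> \<open>Rounding down costs a factor 2: \<open>3 * s * \<theta>\<close> lies between 1/2
    and 1. The lower bound is the source of the constant 6.\<close>
  have st: "3 * real s * \<theta> \<le> 1" "1 \<le> 6 * real s * \<theta>"
  proof -
    show "3 * real s * \<theta> \<le> 1" using s(1) \<theta> by (simp add: field_simps)
    have "1 / (3 * \<theta>) \<le> 2 * real s" using s by linarith
    then show "1 \<le> 6 * real s * \<theta>" using \<theta> by (simp add: field_simps)
  qed
  have le: "cnt (2 *\<^sub>R (k /\<^sub>R (3 * real s))) \<le> cnt ((4 * \<theta>) *\<^sub>R k)"
  proof (rule cnt_mono)
    fix i :: 'a assume i: "i \<in> Basis"
    have "2 / (3 * real s) \<le> 4 * \<theta>" using st s by (simp add: field_simps)
    then have "(2 / (3 * real s)) * (k \<bullet> i) \<le> (4 * \<theta>) * (k \<bullet> i)"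
      using k[OF i] by (intro mult_right_mono) auto
    then show "(2 *\<^sub>R (k /\<^sub>R (3 * real s))) \<bullet> i \<le> ((4 * \<theta>) *\<^sub>R k) \<bullet> i"
      by (simp only: inner_scaleR_left divide_inverse mult.assoc)
  qed
  have "real s * real (cnt k) \<le> real (cnt (2 *\<^sub>R (k /\<^sub>R (3 * real s)))) * (9 * real s) ^ DIM('a)"
    by (rule cnt_sparse[OF k nc s(4)])
  also have "\<dots> \<le> real (cnt ((4 * \<theta>) *\<^sub>R k)) * (9 * real s) ^ DIM('a)"
    by (rule mult_right_mono) (simp_all only: of_nat_le_iff le, simp)
  finally have "real s * real (cnt k) * \<theta> ^ DIM('a) \<le> real (cnt ((4 * \<theta>) *\<^sub>R k)) * (9 * real s) ^ DIM('a) * \<theta> ^ DIM('a)"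
    by (rule mult_right_mono) (use \<theta> in simp)
  also have "\<dots> = (real (cnt ((4 * \<theta>) *\<^sub>R k)) * \<theta> ^ DIM('a)) * (9 * real s) ^ DIM('a)"
    by (simp add: mult_ac)
  also have "\<dots> \<le> (real (cnt (\<theta> *\<^sub>R k)) * (2 * (4 * \<theta>) + \<theta>) ^ DIM('a)) * (9 * real s) ^ DIM('a)"
    by (rule mult_right_mono, rule cnt_scale_le[OF k]) (use \<theta> in simp_all)
  also have "\<dots> = real (cnt (\<theta> *\<^sub>R k)) * (27 * (3 * real s * \<theta>)) ^ DIM('a)"
  proof -
    have "27 * (3 * real s * \<theta>) = (2 * (4 * \<theta>) + \<theta>) * (9 * real s)" by simp
    then show ?thesis by (simp only: power_mult_distrib[of "2 * (4 * \<theta>) + \<theta>"] mult.assoc)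
  qed
  also have "\<dots> \<le> real (cnt (\<theta> *\<^sub>R k)) * 81 ^ DIM('a)"
    by (rule mult_left_mono, rule power_mono) (use st \<theta> in simp_all)
  finally have "(6 * \<theta>) * (real s * real (cnt k) * \<theta> ^ DIM('a)) \<le> (6 * \<theta>) * (real (cnt (\<theta> *\<^sub>R k)) * 81 ^ DIM('a))"
    by (rule mult_left_mono) (use \<theta> in simp_all)
  moreover have "1 * (real (cnt k) * \<theta> ^ DIM('a)) \<le> (6 * real s * \<theta>) * (real (cnt k) * \<theta> ^ DIM('a))"
    by (rule mult_right_mono) (use st \<theta> in simp_all)
  ultimately show ?thesis by (simp add: mult_ac)
next
  case False
  have "real (cnt (1 *\<^sub>R k)) * \<theta> ^ DIM('a) \<le> real (cnt (\<theta> *\<^sub>R k)) * (2 * 1 + \<theta>) ^ DIM('a)"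
    by (rule cnt_scale_le) (use k \<theta> in auto)
  also have "\<dots> \<le> real (cnt (\<theta> *\<^sub>R k)) * 81 ^ DIM('a)"
    using \<theta> by (intro mult_left_mono power_mono) auto
  also have "\<dots> \<le> (6 * \<theta>) * (real (cnt (\<theta> *\<^sub>R k)) * 81 ^ DIM('a))"
    using False \<theta> mult_right_mono[of 1 "6 * \<theta>" "real (cnt (\<theta> *\<^sub>R k)) * 81 ^ DIM('a)"] by auto
  finally show ?thesis by (simp add: mult_ac)
qed

end

section \<open>The lattice of a matrix and its hitting counts\<close>

lemma infnorm_le_iff_cart: "infnorm (x :: real ^ 'n::finite) \<le> r \<longleftrightarrow> (\<forall>i. \<bar>x $ i\<bar> \<le> r)"
proof
  assume "\<forall>i. \<bar>x $ i\<bar> \<le> r"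
  then show "infnorm x \<le> r" unfolding infnorm_cart by (intro cSup_least) auto
qed (use component_le_infnorm_cart order_trans in blast)

lemma infnorm_diff_le: "infnorm (x - y) \<le> infnorm x + infnorm (y :: 'a::euclidean_space)"
  using infnorm_triangle[of x "- y"] by (simp add: infnorm_neg)

lemma infnorm_diff_le_add:
  "infnorm x \<le> a \<Longrightarrow> infnorm y \<le> b \<Longrightarrow> z = x - y \<Longrightarrow> infnorm (z :: 'a::euclidean_space) \<le> a + b"
  using infnorm_diff_le[of x y] by simp

lemma vec_of_int_diff: "vec_of_int (p - q) = vec_of_int p - vec_of_int q"
  by (simp add: vec_eq_iff)

lemma vec_of_int_inj: "vec_of_int p = vec_of_int q \<longleftrightarrow> p = q"
  by (simp add: vec_eq_iff)

definition cube :: "real ^ 'n::finite \<Rightarrow> real \<Rightarrow> (real ^ 'n) set" where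
  "cube x r = {y. infnorm (x - y) \<le> r}"

lemma cube_eq_cbox: "cube x r = cbox (x - (\<chi> i. r)) (x + (\<chi> i. r))"
  by (auto simp: cube_def infnorm_le_iff_cart mem_box_cart abs_le_iff) (smt (verit))+

lemma cube_borel [measurable]: "cube x r \<in> sets borel"
  by (simp add: cube_eq_cbox)

lemma emeasure_cube:
  fixes x :: "real ^ 'n::finite"
  assumes "0 \<le> r"
  shows "emeasure lborel (cube x r) = ennreal ((2 * r) ^ CARD('n))"
proof -
  have "(\<Prod>i\<in>Basis. (\<chi> i. r :: real ^ 'n) \<bullet> i) = (\<Prod>i\<in>(Basis :: (real ^ 'n) set). r)"
    by (intro prod.cong refl) (auto simp: Basis_vec_def inner_axis)
  moreover have "0 \<le> (\<chi> i. r :: real ^ 'n) \<bullet> i" if "i \<in> Basis" for i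
    using that assms by (auto simp: Basis_vec_def inner_axis)
  ultimately show ?thesis
    unfolding cube_eq_cbox by (subst emeasure_lborel_cbox_centered) (simp_all add: power_mult_distrib)
qed

lemma card_int_vectors:
  assumes "finite S"
  shows "card {q :: int ^ 'n::finite. \<forall>i. q $ i \<in> S} = card S ^ CARD('n)"
proof -
  have "bij_betw vec_nth {q :: int ^ 'n. \<forall>i. q $ i \<in> S} (Pi\<^sub>E UNIV (\<lambda>_. S))"
    by (rule bij_betw_byWitness[where f'="vec_lambda"]) auto
  then have "card {q :: int ^ 'n. \<forall>i. q $ i \<in> S} = card (Pi\<^sub>E (UNIV :: 'n set) (\<lambda>_. S))"
    by (rule bij_betw_same_card)
  then show ?thesis by (simp add: card_PiE)
qed

definition int_ball :: "real \<Rightarrow> (int ^ 'n::finite) set" where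
  "int_ball T = {q. infnorm (vec_of_int q) \<le> T}"

lemma int_ball_eq: "int_ball T = {q. \<forall>i. q $ i \<in> {- \<lfloor>T\<rfloor>..\<lfloor>T\<rfloor>}}"
proof -
  have "\<bar>real_of_int z\<bar> \<le> T \<longleftrightarrow> z \<in> {- \<lfloor>T\<rfloor>..\<lfloor>T\<rfloor>}" for z
    by (auto simp: abs_le_iff le_floor_iff minus_le_iff)
  then show ?thesis by (simp add: int_ball_def infnorm_le_iff_cart)
qed

lemma finite_int_ball [simp]: "finite (int_ball T :: (int ^ 'n::finite) set)"
proof -
  have "finite (Pi\<^sub>E (UNIV :: 'n set) (\<lambda>i. {- \<lfloor>T\<rfloor>..\<lfloor>T\<rfloor>}))"
    by (intro finite_PiE) auto
  then have "finite (vec_nth -` Pi\<^sub>E UNIV (\<lambda>i. {- \<lfloor>T\<rfloor>..\<lfloor>T\<rfloor>}) :: (int ^ 'n) set)"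
    by (rule finite_vimageI) (simp add: inj_def vec_nth_inject)
  then show ?thesis
    by (elim rev_finite_subset) (auto simp: int_ball_eq PiE_iff)
qed

lemma card_int_ball_bounds:
  assumes "1 \<le> T"
  shows "T ^ CARD('n) \<le> real (card (int_ball T :: (int ^ 'n::finite) set))"
    "real (card (int_ball T :: (int ^ 'n::finite) set)) \<le> (3 * T) ^ CARD('n)"
proof -
  have "1 \<le> \<lfloor>T\<rfloor>" using assms by (simp add: le_floor_iff)
  then have "real (card (int_ball T :: (int ^ 'n) set)) = (2 * real_of_int \<lfloor>T\<rfloor> + 1) ^ CARD('n)"
    unfolding int_ball_eq by (subst card_int_vectors) simp_all
  moreover have "T \<le> 2 * real_of_int \<lfloor>T\<rfloor> + 1" "2 * real_of_int \<lfloor>T\<rfloor> + 1 \<le> 3 * T"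
    using assms \<open>1 \<le> \<lfloor>T\<rfloor>\<close> by linarith+
  ultimately show "T ^ CARD('n) \<le> real (card (int_ball T :: (int ^ 'n) set))"
    "real (card (int_ball T :: (int ^ 'n) set)) \<le> (3 * T) ^ CARD('n)"
    using assms by (simp_all only: power_mono[of T] power_mono[of "2 * real_of_int \<lfloor>T\<rfloor> + 1"])
qed

definition dlat :: "real ^ 'n::finite ^ 'm::finite \<Rightarrow> ((real ^ 'm) \<times> (real ^ 'n)) set" where
  "dlat A = range (\<lambda>(p, q). (A *v vec_of_int q - vec_of_int p, vec_of_int q))"

definition size_vec :: "real \<Rightarrow> real \<Rightarrow> (real ^ 'm::finite) \<times> (real ^ 'n::finite)" where
  "size_vec r T = (\<chi> i. r, \<chi> j. T)"

lemma mem_cbox_size_vec: "(x, y) \<in> cbox (- size_vec r T) (size_vec r T) \<longleftrightarrow> infnorm x \<le> r \<and> infnorm y \<le> T"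
  by (auto simp: size_vec_def uminus_prod_def cbox_Pair_eq infnorm_le_iff_cart mem_box_cart abs_le_iff minus_le_iff)

lemma inner_size_vec: "i \<in> Basis \<Longrightarrow> size_vec r T \<bullet> i = r \<or> size_vec r T \<bullet> i = T"
  by (auto simp: size_vec_def Basis_prod_def Basis_vec_def inner_axis)

lemma inner_size_vec_mono:
  assumes "i \<in> Basis" "r \<le> r'" "T \<le> T'"
  shows "size_vec r T \<bullet> i \<le> size_vec r' T' \<bullet> i"
  using assms by (auto simp: size_vec_def Basis_prod_def Basis_vec_def inner_axis)

lemma prod_size_vec:
  "(\<Prod>i\<in>(Basis :: ((real ^ 'm::finite) \<times> (real ^ 'n::finite)) set). size_vec r T \<bullet> i) = r ^ CARD('m) * T ^ CARD('n)"
proof -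
  have "(\<Prod>i\<in>(Basis :: ((real ^ 'm) \<times> (real ^ 'n)) set). size_vec r T \<bullet> i)
    = (\<Prod>i\<in>(Basis :: (real ^ 'm) set). (\<chi> i. r :: real ^ 'm) \<bullet> i) * (\<Prod>i\<in>(Basis :: (real ^ 'n) set). (\<chi> i. T :: real ^ 'n) \<bullet> i)"
    unfolding Basis_prod_def
    by (subst prod.union_disjoint) (auto simp: prod.reindex inj_on_def size_vec_def)
  also have "(\<Prod>i\<in>(Basis :: (real ^ 'm) set). (\<chi> i. r :: real ^ 'm) \<bullet> i) = (\<Prod>i\<in>(Basis :: (real ^ 'm) set). r)"
    by (intro prod.cong refl) (auto simp: Basis_vec_def inner_axis)
  also have "(\<Prod>i\<in>(Basis :: (real ^ 'n) set). (\<chi> i. T :: real ^ 'n) \<bullet> i) = (\<Prod>i\<in>(Basis :: (real ^ 'n) set). T)"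
    by (intro prod.cong refl) (auto simp: Basis_vec_def inner_axis)
  finally show ?thesis by simp
qed

lemma scaleR_size_vec: "a *\<^sub>R size_vec r T = size_vec (a * r) (a * T)"
  by (simp add: size_vec_def vec_eq_iff prod_eq_iff)

definition hits :: "real ^ 'n::finite ^ 'm::finite \<Rightarrow> real \<Rightarrow> real \<Rightarrow> real ^ 'm \<Rightarrow> nat" where
  "hits A r T b = card {(p :: int ^ 'm, q :: int ^ 'n).
     infnorm (A *v vec_of_int q - vec_of_int p - b) \<le> r \<and> infnorm (vec_of_int q) \<le> T}"

lemma finite_hits: "finite {(p :: int ^ 'm, q :: int ^ 'n).
     infnorm (A *v vec_of_int q - vec_of_int p - b) \<le> r \<and> infnorm (vec_of_int q) \<le> T}"
  for A :: "real ^ 'n::finite ^ 'm::finite"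
proof (rule finite_subset[OF _ finite_N_count[of A "r + infnorm b" T]], safe)
  fix p :: "int ^ 'm" and q :: "int ^ 'n" assume "infnorm (A *v vec_of_int q - vec_of_int p - b) \<le> r"
  then show "infnorm (A *v vec_of_int q - vec_of_int p) \<le> r + infnorm b"
    using infnorm_triangle[of "A *v vec_of_int q - vec_of_int p - b" b] by simp
qed

lemma N_count_eq_card_dlat: "N_count A r T = card (dlat A \<inter> cbox (- size_vec r T) (size_vec r T))"
  and finite_dlat: "finite (dlat A \<inter> cbox (- size_vec r T) (size_vec r T))"
proof -
  let ?f = "\<lambda>(p, q). (A *v vec_of_int q - vec_of_int p, vec_of_int q)"
  have eq: "dlat A \<inter> cbox (- size_vec r T) (size_vec r T) = ?f ` {(p, q).
     infnorm (A *v vec_of_int q - vec_of_int p) \<le> r \<and> infnorm (vec_of_int q) \<le> T}"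
    by (auto simp: dlat_def mem_cbox_size_vec image_iff)
  have "inj ?f" by (auto simp: inj_def vec_of_int_inj)
  then show "N_count A r T = card (dlat A \<inter> cbox (- size_vec r T) (size_vec r T))"
    unfolding eq N_count_def by (subst card_image) (auto intro: inj_on_subset)
  show "finite (dlat A \<inter> cbox (- size_vec r T) (size_vec r T))"
    unfolding eq by (intro finite_imageI finite_N_count)
qed

interpretation dlat: discrete_subgroup "dlat A" for A :: "real ^ 'n::finite ^ 'm::finite"
proof
  show "0 \<in> dlat A"
    by (auto simp: dlat_def image_iff zero_prod_def intro!: exI[of _ 0])
  show "x - y \<in> dlat A" if xy: "x \<in> dlat A" "y \<in> dlat A" for x y
  proof -
    obtain p q p' q' where "x = (A *v vec_of_int q - vec_of_int p, vec_of_int q)"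
      "y = (A *v vec_of_int q' - vec_of_int p', vec_of_int q')"
      using xy by (auto simp: dlat_def)
    then have "x - y = (\<lambda>(p, q). (A *v vec_of_int q - vec_of_int p, vec_of_int q)) (p - p', q - q')"
      by (simp add: vec_of_int_diff matrix_vector_mult_diff_distrib)
    then show ?thesis unfolding dlat_def by blast
  qed
  fix k :: "(real ^ 'm) \<times> (real ^ 'n)"
  have "cbox (- k) k \<subseteq> cbox (- size_vec (infnorm (fst k)) (infnorm (snd k))) (size_vec (infnorm (fst k)) (infnorm (snd k)))"
  proof
    fix x assume "x \<in> cbox (- k) k"
    then have "(fst x, snd x) \<in> cbox (- fst k, - snd k) (fst k, snd k)" by (simp add: uminus_prod_def)
    then have "\<bar>fst x $ i\<bar> \<le> fst k $ i" "\<bar>snd x $ j\<bar> \<le> snd k $ j" for i j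
      unfolding cbox_Pair_eq by (auto simp: mem_box_cart abs_le_iff) (metis minus_le_iff)+
    then have "infnorm (fst x) \<le> infnorm (fst k)" "infnorm (snd x) \<le> infnorm (snd k)"
      unfolding infnorm_le_iff_cart[of "fst x"] infnorm_le_iff_cart[of "snd x"]
      by (meson abs_ge_self component_le_infnorm_cart order_trans)+
    then show "x \<in> cbox (- size_vec (infnorm (fst k)) (infnorm (snd k))) (size_vec (infnorm (fst k)) (infnorm (snd k)))"
      using mem_cbox_size_vec[of "fst x" "snd x"] by simp
  qed
  then show "finite (dlat A \<inter> cbox (- k) k)"
    by (intro finite_subset[OF _ finite_dlat]) auto
qed

lemma cnt_dlat: "dlat.cnt A (size_vec r T) = N_count A r T"
  by (simp add: dlat.cnt_def N_count_eq_card_dlat)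

definition lat_covers :: "real ^ 'n::finite ^ 'm::finite \<Rightarrow> real \<Rightarrow> real \<Rightarrow> bool" where
  "lat_covers A r T \<longleftrightarrow> dlat.covers A (size_vec r T)"

text \<open>Covering is applied to the point \<open>(b, 0)\<close>, whose second component turns
  into the bound on the height.\<close>

lemma lat_coversD:
  assumes "lat_covers A r T"
  obtains p q where "infnorm (A *v vec_of_int q - vec_of_int p - b) \<le> r" "infnorm (vec_of_int q) \<le> T"
proof -
  obtain l where "l \<in> dlat A" "(b, 0) - l \<in> cbox (- size_vec r T) (size_vec r T)"
    using assms unfolding lat_covers_def dlat.covers_def by blast
  then obtain p q where "(b - (A *v vec_of_int q - vec_of_int p), 0 - vec_of_int q) \<in> cbox (- size_vec r T) (size_vec r T)"
    by (auto simp: dlat_def)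
  then have "infnorm (b - (A *v vec_of_int q - vec_of_int p)) \<le> r" "infnorm (0 - vec_of_int q) \<le> T"
    by (simp_all only: mem_cbox_size_vec)
  then show ?thesis by (intro that) (simp_all add: infnorm_sub[of b] infnorm_neg)
qed

lemma N_count_mono: "r \<le> r' \<Longrightarrow> T \<le> T' \<Longrightarrow> N_count A r T \<le> N_count A r' T'"
  unfolding cnt_dlat[symmetric] by (rule dlat.cnt_mono) (rule inner_size_vec_mono)

lemma N_count_pos:
  assumes "0 \<le> r" "0 \<le> T"
  shows "0 < N_count A r T"
  unfolding cnt_dlat[symmetric]
proof (rule dlat.cnt_pos)
  fix i :: "(real ^ 'b) \<times> (real ^ 'a)" assume "i \<in> Basis"
  from inner_size_vec[OF this, of r T] assms show "0 \<le> size_vec r T \<bullet> i" by auto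
qed

lemma size_vec_pos: "0 < r \<Longrightarrow> 0 < T \<Longrightarrow> i \<in> Basis \<Longrightarrow> 0 < size_vec r T \<bullet> i"
  using inner_size_vec[of i r T] by auto

lemma N_count_double:
  fixes A :: "real ^ 'n::finite ^ 'm::finite"
  assumes "0 < r" "0 < T"
  shows "real (N_count A (2 * r) (2 * T)) \<le> 5 ^ (CARD('m) + CARD('n)) * real (N_count A r T)"
  using dlat.cnt_scale_le[OF size_vec_pos[OF assms], of 1 2 A]
  by (simp add: scaleR_size_vec cnt_dlat mult.commute)

lemma M_ratio_pos: "0 < r \<Longrightarrow> 0 < T \<Longrightarrow> 0 < M_ratio A r T"
  by (simp add: M_ratio_def N_count_pos less_imp_le)

lemma M_ratio_mono:
  fixes A :: "real ^ 'n::finite ^ 'm::finite"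
  assumes "0 < r" "0 < T" "r \<le> r'" "T \<le> T'"
  shows "M_ratio A r T \<le> 3 ^ (CARD('m) + CARD('n)) * M_ratio A r' T'"
proof -
  have "real (N_count A r' T') * (r ^ CARD('m) * T ^ CARD('n))
      \<le> 3 ^ (CARD('m) + CARD('n)) * real (N_count A r T) * (r' ^ CARD('m) * T' ^ CARD('n))"
    using dlat.cnt_ratio[OF size_vec_pos[OF assms(1,2)] inner_size_vec_mono[OF _ assms(3,4)], of A]
    by (simp add: cnt_dlat prod_size_vec)
  then show ?thesis
    using N_count_pos[of r T A] N_count_pos[of r' T' A] assms
    by (simp add: M_ratio_def divide_simps mult_ac)
qed

lemma M_ratio_not_covers_scale:
  fixes A :: "real ^ 'n::finite ^ 'm::finite"
  assumes "0 < r" "0 < T" "\<not> lat_covers A r T" "0 < \<theta>" "\<theta> \<le> 1"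
  shows "M_ratio A (\<theta> * r) (\<theta> * T) \<le> 6 * 81 ^ (CARD('m) + CARD('n)) * \<theta> * M_ratio A r T"
proof -
  have "real (N_count A r T) * \<theta> ^ (CARD('m) + CARD('n))
      \<le> 6 * 81 ^ (CARD('m) + CARD('n)) * \<theta> * real (N_count A (\<theta> * r) (\<theta> * T))"
    using dlat.cnt_not_covers[OF size_vec_pos[OF assms(1,2)], of A \<theta>] assms
    by (simp add: cnt_dlat scaleR_size_vec lat_covers_def)
  then have "(real (N_count A r T) * \<theta> ^ (CARD('m) + CARD('n))) * (r ^ CARD('m) * T ^ CARD('n))
    \<le> (6 * 81 ^ (CARD('m) + CARD('n)) * \<theta> * real (N_count A (\<theta> * r) (\<theta> * T))) * (r ^ CARD('m) * T ^ CARD('n))"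
    using assms by (intro mult_right_mono) auto
  moreover have "0 < real (N_count A r T)" "0 < real (N_count A (\<theta> * r) (\<theta> * T))"
    using assms by (auto intro!: N_count_pos)
  ultimately show ?thesis
    by (simp add: M_ratio_def divide_simps power_mult_distrib power_add mult_ac)
qed

text \<open>The gain is known for uniform shrinking, whereas radius and height shrink at different
  rates. So \<open>(r, T)\<close> is first compared with the box \<open>(r', T')\<close> shrunk by
  the larger rate, at the cost that turns 81 into 243. The sum of the rates replaces their maximum
  because it is easier to sum over stages.\<close>

lemma M_ratio_not_covers:
  fixes A :: "real ^ 'n::finite ^ 'm::finite"
  assumes "0 < r" "0 < T" "r \<le> r'" "T \<le> T'" "\<not> lat_covers A r' T'"
  shows "M_ratio A r T \<le> 6 * 243 ^ (CARD('m) + CARD('n)) * (r / r' + T / T') * M_ratio A r' T'"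
proof -
  define \<theta> where "\<theta> = max (r / r') (T / T')"
  have \<theta>: "0 < \<theta>" "\<theta> \<le> 1" "r \<le> \<theta> * r'" "T \<le> \<theta> * T'" "\<theta> \<le> r / r' + T / T'"
    using assms by (auto simp: \<theta>_def max_def field_simps)
  have "M_ratio A r T \<le> 3 ^ (CARD('m) + CARD('n)) * M_ratio A (\<theta> * r') (\<theta> * T')"
    using assms \<theta> by (intro M_ratio_mono)
  also have "\<dots> \<le> 3 ^ (CARD('m) + CARD('n)) * (6 * 81 ^ (CARD('m) + CARD('n)) * \<theta> * M_ratio A r' T')"
    using assms \<theta> by (intro mult_left_mono M_ratio_not_covers_scale) auto
  also have "\<dots> = 6 * (3 * 81) ^ (CARD('m) + CARD('n)) * \<theta> * M_ratio A r' T'"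
    by (subst power_mult_distrib) simp
  also have "\<dots> \<le> 6 * (3 * 81) ^ (CARD('m) + CARD('n)) * (r / r' + T / T') * M_ratio A r' T'"
    using assms \<theta> M_ratio_pos[of r' T' A] by (intro mult_right_mono mult_left_mono) auto
  finally show ?thesis by simp
qed

section \<open>Hitting counts under translation by lattice points\<close>

lemma hits_zero: "hits A r T 0 = N_count A r T"
  by (simp add: hits_def N_count_def)

lemma hits_shift:
  assumes "infnorm (vec_of_int q) \<le> T"
  shows "hits A r T' b \<le> hits A r (T' + T) (b + (A *v vec_of_int q - vec_of_int p))"
proof -
  let ?f = "\<lambda>(p', q'). (p' + p, q' + q)"
  show ?thesis unfolding hits_def
  proof (rule card_inj_on_le[of ?f])
    show "?f ` {(p', q'). infnorm (A *v vec_of_int q' - vec_of_int p' - b) \<le> r \<and> infnorm (vec_of_int q') \<le> T'}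
      \<subseteq> {(p', q'). infnorm (A *v vec_of_int q' - vec_of_int p' - (b + (A *v vec_of_int q - vec_of_int p))) \<le> r
          \<and> infnorm (vec_of_int q') \<le> T' + T}"
    proof safe
      fix p' q' assume pq: "infnorm (A *v vec_of_int q' - vec_of_int p' - b) \<le> r" "infnorm (vec_of_int q') \<le> T'"
      have "A *v vec_of_int (q' + q) - vec_of_int (p' + p) - (b + (A *v vec_of_int q - vec_of_int p))
        = A *v vec_of_int q' - vec_of_int p' - b"
        by (simp add: vec_of_int_add matrix_vector_right_distrib)
      then show "infnorm (A *v vec_of_int (q' + q) - vec_of_int (p' + p) - (b + (A *v vec_of_int q - vec_of_int p))) \<le> r"
        using pq by (simp only:)
      show "infnorm (vec_of_int (q' + q)) \<le> T' + T"
        using infnorm_triangle[of "vec_of_int q'" "vec_of_int q"] pq assms by (simp add: vec_of_int_add)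
    qed
  qed (auto simp: inj_on_def finite_hits)
qed

lemma hits_pos_iff: "0 < hits A r T b \<longleftrightarrow> (\<exists>p q. infnorm (A *v vec_of_int q - vec_of_int p - b) \<le> r \<and> infnorm (vec_of_int q) \<le> T)"
  unfolding hits_def using finite_hits[of A b r T] by (auto simp: card_gt_0_iff)

text \<open>Subtracting one fixed hit sends all hits to lattice points near the origin, with radius
  and height at most doubled.\<close>

lemma hits_le_N_count: "hits A r T b \<le> N_count A (2 * r) (2 * T)"
proof (cases "0 < hits A r T b")
  case True
  then obtain p0 q0 where pq: "infnorm (A *v vec_of_int q0 - vec_of_int p0 - b) \<le> r" "infnorm (vec_of_int q0) \<le> T"
    unfolding hits_pos_iff by blast
  have "hits A r T b \<le> hits A (2 * r) T (A *v vec_of_int q0 - vec_of_int p0)"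
    unfolding hits_def
  proof (intro card_mono finite_hits, safe)
    fix p q assume "infnorm (A *v vec_of_int q - vec_of_int p - b) \<le> r"
    then show "infnorm (A *v vec_of_int q - vec_of_int p - (A *v vec_of_int q0 - vec_of_int p0)) \<le> 2 * r"
      using infnorm_diff_le_add[of "A *v vec_of_int q - vec_of_int p - b" r "A *v vec_of_int q0 - vec_of_int p0 - b" r
          "A *v vec_of_int q - vec_of_int p - (A *v vec_of_int q0 - vec_of_int p0)"] pq by simp
  qed
  also have "\<dots> \<le> hits A (2 * r) (T + T) (A *v vec_of_int q0 - vec_of_int p0 + (A *v vec_of_int (- q0) - vec_of_int (- p0)))"
    by (rule hits_shift) (simp add: vec_of_int_minus infnorm_neg pq)
  also have "A *v vec_of_int q0 - vec_of_int p0 + (A *v vec_of_int (- q0) - vec_of_int (- p0)) = 0"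
  proof -
    have "A *v vec_of_int q0 + A *v vec_of_int (- q0) = 0"
      by (simp add: matrix_vector_right_distrib[symmetric] vec_of_int_minus)
    then show ?thesis by (simp add: vec_of_int_minus algebra_simps)
  qed
  finally show ?thesis by (simp add: hits_zero)
qed simp

text \<open>One hit plus any lattice point of the box is a hit of the doubled box. With
  \<open>hits_le_N_count\<close> this makes the multiplicity, up to doubling, of order
  \<open>N_count\<close> wherever it is positive, which is why first moments measure the union of
  the balls.\<close>

lemma N_count_le_hits:
  assumes "0 < hits A r T b"
  shows "N_count A r T \<le> hits A (2 * r) (2 * T) b"
proof -
  obtain p0 q0 where pq: "infnorm (A *v vec_of_int q0 - vec_of_int p0 - b) \<le> r" "infnorm (vec_of_int q0) \<le> T"
    using assms unfolding hits_pos_iff by blast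
  have "N_count A r T \<le> hits A r (T + T) (0 + (A *v vec_of_int q0 - vec_of_int p0))"
    unfolding hits_zero[symmetric] by (rule hits_shift[OF pq(2)])
  also have "\<dots> \<le> hits A (2 * r) (2 * T) b"
    unfolding hits_def
  proof (intro card_mono finite_hits, safe)
    fix p q assume "infnorm (A *v vec_of_int q - vec_of_int p - (0 + (A *v vec_of_int q0 - vec_of_int p0))) \<le> r"
    note sum = infnorm_triangle[of "A *v vec_of_int q - vec_of_int p - (0 + (A *v vec_of_int q0 - vec_of_int p0))"
        "A *v vec_of_int q0 - vec_of_int p0 - b"]
    have "A *v vec_of_int q - vec_of_int p - (0 + (A *v vec_of_int q0 - vec_of_int p0)) + (A *v vec_of_int q0 - vec_of_int p0 - b)
        = A *v vec_of_int q - vec_of_int p - b"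
      by simp
    with sum show "infnorm (A *v vec_of_int q - vec_of_int p - b) \<le> 2 * r"
      using pq \<open>infnorm (A *v vec_of_int q - vec_of_int p - (0 + (A *v vec_of_int q0 - vec_of_int p0))) \<le> r\<close>
      by (simp only:)
  qed simp
  finally show ?thesis .
qed

text \<open>Translating a lattice point back to the origin keeps the radius. This counts the
  overlaps in the second moment.\<close>

lemma hits_lattice_le:
  assumes "infnorm (vec_of_int q) \<le> T"
  shows "hits A r T' (A *v vec_of_int q) \<le> N_count A r (T' + T)"
proof -
  have "hits A r T' (A *v vec_of_int q) \<le> hits A r (T' + T) (A *v vec_of_int q + (A *v vec_of_int (- q) - vec_of_int 0))"
    by (rule hits_shift) (simp add: vec_of_int_minus infnorm_neg assms)
  also have "A *v vec_of_int q + (A *v vec_of_int (- q) - vec_of_int 0) = 0"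
    by (simp add: matrix_vector_right_distrib[symmetric] vec_of_int_minus)
  finally show ?thesis by (simp add: hits_zero)
qed

lemma hits_periodic: "hits A r T (b + vec_of_int p) = hits A r T b"
proof -
  have le: "hits A r T b \<le> hits A r T (b + vec_of_int p)" for b p
    using hits_shift[of 0 0 A r T b "- p"] by (simp add: vec_of_int_minus infnorm_eq_0[THEN iffD2])
  show ?thesis using le[of b p] le[of "b + vec_of_int p" "- p"] by (simp add: vec_of_int_minus)
qed

section \<open>Unfolding over the unit cube and moments of the hitting counts\<close>

lemma unit_cube_borel [measurable]: "(unit_cube :: (real ^ 'm::finite) set) \<in> sets borel"
proof -
  have "unit_cube = (\<Inter>i. {x :: real ^ 'm. 0 \<le> x $ i} \<inter> {x. x $ i < 1})"
    by (auto simp: unit_cube_def)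
  also have "\<dots> \<in> sets borel"
    by (intro sets.countable_INT'' sets.Int) auto
  finally show ?thesis .
qed

lemma emeasure_unit_cube: "emeasure lborel (unit_cube :: (real ^ 'm::finite) set) = 1"
proof -
  have "emeasure (torus_measure :: 'm torus measure) UNIV = emeasure lebesgue (unit_cube :: (real ^ 'm) set)"
    by (subst emeasure_torus_measure) (auto simp: sets_torus_measure)
  then show ?thesis by (simp add: emeasure_torus_measure_UNIV)
qed

lemma nn_integral_count_unit_cube:
  "(\<integral>\<^sup>+p. indicator unit_cube (x - vec_of_int p :: real ^ 'm::finite) \<partial>count_space UNIV) = (1 :: ennreal)"
proof -
  define p0 :: "int ^ 'm" where "p0 = (\<chi> i. \<lfloor>x $ i\<rfloor>)"
  have "x - vec_of_int p \<in> unit_cube \<longleftrightarrow> p \<in> {p0}" for p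
  proof -
    have "x - vec_of_int p \<in> unit_cube \<longleftrightarrow> (\<forall>i. \<lfloor>x $ i\<rfloor> = p $ i)"
      by (auto simp: unit_cube_def floor_eq_iff algebra_simps)
    then show ?thesis by (auto simp: p0_def vec_eq_iff)
  qed
  then have "(\<integral>\<^sup>+p. indicator unit_cube (x - vec_of_int p) \<partial>count_space UNIV) = (\<integral>\<^sup>+p. indicator {p0} p \<partial>count_space UNIV)"
    by (intro nn_integral_cong) (simp add: indicator_def)
  then show ?thesis by simp
qed

lemma nn_integral_count_measurable [measurable]:
  fixes f :: "'i::countable \<Rightarrow> 'a \<Rightarrow> ennreal"
  assumes [measurable]: "\<And>p. f p \<in> borel_measurable M"
  shows "(\<lambda>x. \<integral>\<^sup>+p. f p x \<partial>count_space UNIV) \<in> borel_measurable M"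
proof -
  interpret sigma_finite_measure "count_space (UNIV :: 'i set)"
    by (rule sigma_finite_measure_count_space)
  have "(\<lambda>y. (case_prod f) (fst y, snd y)) \<in> borel_measurable (count_space UNIV \<Otimes>\<^sub>M M)"
    by (rule measurable_pair_measure_countable1) auto
  from measurable_compose[OF measurable_pair_swap' this]
  have "(\<lambda>(x, p). f p x) \<in> borel_measurable (M \<Otimes>\<^sub>M count_space UNIV)"
    by (simp add: case_prod_beta)
  then show ?thesis by (rule borel_measurable_nn_integral)
qed

lemma nn_integral_lborel_shift:
  fixes c :: "'a::euclidean_space"
  assumes [measurable]: "f \<in> borel_measurable borel"
  shows "(\<integral>\<^sup>+x. f (c + x) \<partial>lborel) = (\<integral>\<^sup>+x. f x \<partial>lborel)"
proof -
  have "(\<integral>\<^sup>+x. f x \<partial>lborel) = (\<integral>\<^sup>+x. f x \<partial>distr lborel borel ((+) c))"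
    by (simp add: lborel_distr_plus)
  then show ?thesis by (simp add: nn_integral_distr)
qed

text \<open>The usual unfolding: insert the partition of unity formed by the integer translates of
  the unit cube, exchange sum and integral, and move each translate back to the cube.\<close>

lemma nn_integral_unfold:
  fixes \<phi> g :: "real ^ 'm::finite \<Rightarrow> ennreal"
  assumes [measurable]: "\<phi> \<in> borel_measurable borel" "g \<in> borel_measurable borel"
    and per: "\<And>x p. g (x + vec_of_int p) = g x"
  shows "(\<integral>\<^sup>+x. (\<integral>\<^sup>+p. \<phi> (x + vec_of_int p) \<partial>count_space UNIV) * g x * indicator unit_cube x \<partial>lborel)
    = (\<integral>\<^sup>+x. \<phi> x * g x \<partial>lborel)"
proof -
  have "(\<integral>\<^sup>+x. \<phi> x * g x \<partial>lborel)
      = (\<integral>\<^sup>+x. (\<integral>\<^sup>+p. \<phi> x * g x * indicator unit_cube (x - vec_of_int p) \<partial>count_space UNIV) \<partial>lborel)"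
    by (simp add: nn_integral_cmult nn_integral_count_unit_cube)
  also have "\<dots> = (\<integral>\<^sup>+p. (\<integral>\<^sup>+x. \<phi> x * g x * indicator unit_cube (x - vec_of_int p) \<partial>lborel) \<partial>count_space UNIV)"
    by (rule nn_integral_count_space_nn_integral) auto
  also have "\<dots> = (\<integral>\<^sup>+p. (\<integral>\<^sup>+x. \<phi> (x + vec_of_int p) * g x * indicator unit_cube x \<partial>lborel) \<partial>count_space UNIV)"
  proof (rule nn_integral_cong)
    fix p :: "int ^ 'm"
    have "(\<integral>\<^sup>+x. \<phi> x * g x * indicator unit_cube (x - vec_of_int p) \<partial>lborel)
      = (\<integral>\<^sup>+x. \<phi> (vec_of_int p + x) * g (vec_of_int p + x) * indicator unit_cube (vec_of_int p + x - vec_of_int p) \<partial>lborel)"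
      by (rule nn_integral_lborel_shift[symmetric]) simp
    then show "(\<integral>\<^sup>+x. \<phi> x * g x * indicator unit_cube (x - vec_of_int p) \<partial>lborel)
      = (\<integral>\<^sup>+x. \<phi> (x + vec_of_int p) * g x * indicator unit_cube x \<partial>lborel)"
      using per[of _ p] by (simp add: add.commute[of "vec_of_int p"])
  qed
  also have "\<dots> = (\<integral>\<^sup>+x. (\<integral>\<^sup>+p. \<phi> (x + vec_of_int p) * g x * indicator unit_cube x \<partial>count_space UNIV) \<partial>lborel)"
    by (rule nn_integral_count_space_nn_integral[symmetric]) auto
  also have "\<dots> = (\<integral>\<^sup>+x. (\<integral>\<^sup>+p. \<phi> (x + vec_of_int p) \<partial>count_space UNIV) * g x * indicator unit_cube x \<partial>lborel)"
    by (simp add: nn_integral_multc)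
  finally show ?thesis by simp
qed

text \<open>Fixing \<open>q\<close> writes the count as a sum of periodised indicators of cubes, the
  shape required by unfolding.\<close>

lemma hits_eq_nn_integral:
  fixes A :: "real ^ 'n::finite ^ 'm::finite"
  shows "of_nat (hits A r T b)
    = (\<Sum>q\<in>int_ball T. \<integral>\<^sup>+p. indicator (cube (A *v vec_of_int q) r) (b + vec_of_int p) \<partial>count_space UNIV :: ennreal)"
proof -
  define P where "P q = {p. infnorm (A *v vec_of_int q - vec_of_int p - b) \<le> r}" for q
  have eq: "{(p, q). infnorm (A *v vec_of_int q - vec_of_int p - b) \<le> r \<and> infnorm (vec_of_int q) \<le> T}
    = (\<lambda>(q, p). (p, q)) ` Sigma (int_ball T) P"
    by (auto simp: P_def int_ball_def image_iff)
  have fin: "finite (P q)" for q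
    by (rule finite_subset[OF _ finite_imageI[OF finite_hits[of A b r "infnorm (vec_of_int q)"], of fst]])
      (auto simp: P_def image_iff)
  have "hits A r T b = card (Sigma (int_ball T) P)"
    unfolding hits_def eq by (rule card_image) (auto simp: inj_on_def)
  also have "\<dots> = (\<Sum>q\<in>int_ball T. card (P q))"
    using fin by (intro card_SigmaI) auto
  finally have "(of_nat (hits A r T b) :: ennreal) = (\<Sum>q\<in>int_ball T. of_nat (card (P q)))"
    by simp
  also have "\<dots> = (\<Sum>q\<in>int_ball T. \<integral>\<^sup>+p. indicator (cube (A *v vec_of_int q) r) (b + vec_of_int p) \<partial>count_space UNIV)"
  proof (intro sum.cong refl)
    fix q
    have "(\<integral>\<^sup>+p. indicator (cube (A *v vec_of_int q) r) (b + vec_of_int p) \<partial>count_space UNIV)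
      = (\<integral>\<^sup>+p. indicator (P q) p \<partial>count_space UNIV :: ennreal)"
      by (intro nn_integral_cong) (auto simp: cube_def P_def indicator_def diff_diff_eq add.commute)
    also have "\<dots> = of_nat (card (P q))"
      using fin by (simp add: emeasure_count_space_finite)
    finally show "of_nat (card (P q)) = (\<integral>\<^sup>+p. indicator (cube (A *v vec_of_int q) r) (b + vec_of_int p) \<partial>count_space UNIV)" ..
  qed
  finally show ?thesis .
qed

lemma hits_measurable [measurable]: "(\<lambda>b. of_nat (hits A r T b) :: ennreal) \<in> borel_measurable borel"
  unfolding hits_eq_nn_integral by measurable

lemma nn_integral_hits_mult:
  fixes A :: "real ^ 'n::finite ^ 'm::finite"
  assumes [measurable]: "g \<in> borel_measurable borel" and per: "\<And>x p. g (x + vec_of_int p) = g x"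
  shows "(\<integral>\<^sup>+b. of_nat (hits A r T b) * g b * indicator unit_cube b \<partial>lborel)
    = (\<Sum>q\<in>int_ball T. \<integral>\<^sup>+b. indicator (cube (A *v vec_of_int q) r) b * g b \<partial>lborel)"
  unfolding hits_eq_nn_integral sum_distrib_right
  by (subst nn_integral_sum) (auto simp: nn_integral_unfold[OF _ _ per])

lemma nn_integral_hits:
  fixes A :: "real ^ 'n::finite ^ 'm::finite"
  assumes "0 \<le> r"
  shows "(\<integral>\<^sup>+b. of_nat (hits A r T b) * indicator unit_cube b \<partial>lborel)
    = ennreal (real (card (int_ball T :: (int ^ 'n) set)) * (2 * r) ^ CARD('m))"
  using nn_integral_hits_mult[of "\<lambda>_. 1" A r T] assms
  by (simp add: emeasure_cube ennreal_mult' ennreal_of_nat_eq_real_of_nat)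

text \<open>Unfolding one factor leaves integrals over the cubes around the points
  \<open>A q\<close>. A translated cube of the other family meets such a cube only if the centres
  are within \<open>r + r'\<close>, so the relevant translates are counted by \<open>hits\<close> at
  \<open>A q\<close>, and each contributes at most the volume of a cube of radius
  \<open>r'\<close>.\<close>

lemma nn_integral_hits_hits:
  fixes A :: "real ^ 'n::finite ^ 'm::finite"
  assumes "0 \<le> r" "0 \<le> r'"
  shows "(\<integral>\<^sup>+b. of_nat (hits A r T b) * of_nat (hits A r' T' b) * indicator unit_cube b \<partial>lborel)
    \<le> ennreal (real (card (int_ball T :: (int ^ 'n) set)) * (2 * r') ^ CARD('m) * real (N_count A (r + r') (T' + T)))"
proof -
  have "(\<integral>\<^sup>+b. indicator (cube (A *v vec_of_int q) r) b * of_nat (hits A r' T' b) \<partial>lborel)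
    \<le> ennreal ((2 * r') ^ CARD('m) * real (N_count A (r + r') (T' + T)))" if q: "q \<in> int_ball T" for q
  proof -
    have "(\<integral>\<^sup>+b. indicator (cube (A *v vec_of_int q) r) b * of_nat (hits A r' T' b) \<partial>lborel)
      = (\<integral>\<^sup>+b. (\<Sum>q'\<in>int_ball T'. \<integral>\<^sup>+p. indicator (cube (A *v vec_of_int q) r) b * indicator (cube (A *v vec_of_int q') r') (b + vec_of_int p) \<partial>count_space UNIV) \<partial>lborel)"
      unfolding hits_eq_nn_integral sum_distrib_left by (simp add: nn_integral_cmult)
    also have "\<dots> = (\<Sum>q'\<in>int_ball T'. \<integral>\<^sup>+p. (\<integral>\<^sup>+b. indicator (cube (A *v vec_of_int q) r) b * indicator (cube (A *v vec_of_int q') r') (b + vec_of_int p) \<partial>lborel) \<partial>count_space UNIV)"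
      by (simp add: nn_integral_sum nn_integral_count_space_nn_integral)
    also have "\<dots> \<le> (\<Sum>q'\<in>int_ball T'. \<integral>\<^sup>+p. ennreal ((2 * r') ^ CARD('m)) * indicator (cube (A *v vec_of_int q') (r + r')) (A *v vec_of_int q + vec_of_int p) \<partial>count_space UNIV)"
    proof (intro sum_mono nn_integral_mono)
      fix q' and p :: "int ^ 'm"
      let ?c = "A *v vec_of_int q' :: real ^ 'm"
      show "(\<integral>\<^sup>+b. indicator (cube (A *v vec_of_int q) r) b * indicator (cube ?c r') (b + vec_of_int p) \<partial>lborel)
        \<le> ennreal ((2 * r') ^ CARD('m)) * indicator (cube ?c (r + r')) (A *v vec_of_int q + vec_of_int p)"
      proof (cases "A *v vec_of_int q + vec_of_int p \<in> cube ?c (r + r')")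
        case True
        have "(\<integral>\<^sup>+b. indicator (cube (A *v vec_of_int q) r) b * indicator (cube ?c r') (b + vec_of_int p) \<partial>lborel)
          \<le> (\<integral>\<^sup>+b. indicator (cube ?c r') (vec_of_int p + b) \<partial>lborel)"
          by (intro nn_integral_mono) (simp add: indicator_def add.commute)
        also have "\<dots> = (\<integral>\<^sup>+b. indicator (cube ?c r') b \<partial>lborel)"
          by (rule nn_integral_lborel_shift) simp
        also have "\<dots> = ennreal ((2 * r') ^ CARD('m))"
          using assms by (simp add: emeasure_cube)
        finally show ?thesis using True by simp
      next
        case False
        have "b \<notin> cube (A *v vec_of_int q) r \<or> b + vec_of_int p \<notin> cube ?c r'" for b
        proof (rule ccontr)
          assume "\<not> ?thesis"
          then have "infnorm (A *v vec_of_int q - b) \<le> r" "infnorm (?c - (b + vec_of_int p)) \<le> r'"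
            by (auto simp: cube_def)
          then have "infnorm (?c - (A *v vec_of_int q + vec_of_int p)) \<le> r' + r"
            using infnorm_diff_le[of "?c - (b + vec_of_int p)" "A *v vec_of_int q - b"] by (simp add: algebra_simps)
          with False show False by (simp add: cube_def add.commute)
        qed
        then have "(indicator (cube (A *v vec_of_int q) r) b * indicator (cube ?c r') (b + vec_of_int p) :: ennreal) = 0" for b
          by (auto simp: indicator_def)
        then have "(\<integral>\<^sup>+b. indicator (cube (A *v vec_of_int q) r) b * indicator (cube ?c r') (b + vec_of_int p) \<partial>lborel) = (\<integral>\<^sup>+b. 0 \<partial>(lborel :: (real ^ 'm) measure))"
          by (rule nn_integral_cong)
        then show ?thesis by simp
      qed
    qed
    also have "\<dots> = ennreal ((2 * r') ^ CARD('m)) * of_nat (hits A (r + r') T' (A *v vec_of_int q))"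
      unfolding hits_eq_nn_integral sum_distrib_left by (simp add: nn_integral_cmult)
    also have "\<dots> \<le> ennreal ((2 * r') ^ CARD('m)) * of_nat (N_count A (r + r') (T' + T))"
      using q by (intro mult_left_mono of_nat_mono hits_lattice_le) (auto simp: int_ball_def)
    also have "\<dots> = ennreal ((2 * r') ^ CARD('m) * real (N_count A (r + r') (T' + T)))"
      using assms by (simp add: ennreal_mult ennreal_of_nat_eq_real_of_nat)
    finally show ?thesis .
  qed
  then have "(\<Sum>q\<in>int_ball T. \<integral>\<^sup>+b. indicator (cube (A *v vec_of_int q) r) b * of_nat (hits A r' T' b) \<partial>lborel)
    \<le> (\<Sum>q\<in>(int_ball T :: (int ^ 'n) set). ennreal ((2 * r') ^ CARD('m) * real (N_count A (r + r') (T' + T))))"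
    by (rule sum_mono)
  also have "\<dots> = ennreal (real (card (int_ball T :: (int ^ 'n) set)) * (2 * r') ^ CARD('m) * real (N_count A (r + r') (T' + T)))"
    using assms by (simp add: ennreal_mult' ennreal_of_nat_eq_real_of_nat mult.assoc)
  finally show ?thesis
    by (subst nn_integral_hits_mult) (simp_all add: hits_periodic)
qed

section \<open>Second moments along dyadic stages\<close>

lemma geometric_sum_le:
  fixes x :: real
  assumes "0 \<le> x" "x < 1"
  shows "(\<Sum>i\<le>n. x ^ i) \<le> 1 / (1 - x)" "(\<Sum>i\<le>n. x ^ (n - i)) \<le> 1 / (1 - x)"
proof -
  show le: "(\<Sum>i\<le>n. x ^ i) \<le> 1 / (1 - x)"
    using assms by (subst sum_gp0) (auto simp: divide_simps)
  have "(\<Sum>i\<le>n. x ^ (n - i)) = (\<Sum>i\<le>n. x ^ i)"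
    by (rule sum.reindex_bij_witness[of _ "\<lambda>i. n - i" "\<lambda>i. n - i"]) auto
  then show "(\<Sum>i\<le>n. x ^ (n - i)) \<le> 1 / (1 - x)" using le by simp
qed

text \<open>The decay hypothesis forces the partial sums \<open>B i\<close> of \<open>\<beta>\<close> to be at most of order \<open>sqrt (y i)\<close>,
  and \<open>\<beta> i / (1 + B i)\<^sup>2\<close> is dominated by a telescoping sum.\<close>

lemma sum_quotient_le:
  fixes \<beta> y :: "nat \<Rightarrow> real"
  assumes x: "0 < x" "x < 1" and C: "0 < C"
    and \<beta>: "\<And>i. 0 \<le> \<beta> i" "\<And>i. \<beta> i \<le> 1"
    and y: "\<And>i. i \<le> n \<Longrightarrow> \<beta> i \<noteq> 0 \<Longrightarrow> 1 \<le> C * y i"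
    and decay: "\<And>i j. i \<le> n \<Longrightarrow> \<beta> i \<noteq> 0 \<Longrightarrow> j \<le> i \<Longrightarrow> \<beta> j \<le> C * y i * (x ^ j + x ^ (i - j))"
  shows "(\<Sum>i\<le>n. \<beta> i / y i) \<le> 2 * C + 8 * C / (1 - sqrt x)\<^sup>2"
proof -
  define B where "B i = (\<Sum>j\<le>i. \<beta> j)" for i
  define K where "K = 2 * C + 8 * C / (1 - sqrt x)\<^sup>2"
  have sx: "0 \<le> sqrt x" "sqrt x < 1" using x by auto
  have K: "0 \<le> K" using C by (simp add: K_def)
  have B: "0 \<le> B i" for i using \<beta> by (simp add: B_def sum_nonneg)
  have term_le: "\<beta> i / y i \<le> K * (\<beta> i / (1 + B i)\<^sup>2)" if i: "i \<le> n" for i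
  proof (cases "\<beta> i = 0")
    case False
    have Cy: "1 \<le> C * y i" using y[OF i False] .
    then have yi: "0 < y i" using C by (metis less_le_trans zero_less_mult_pos zero_less_one)
    have "\<beta> j \<le> sqrt (C * y i) * (sqrt x ^ j + sqrt x ^ (i - j))" if "j \<le> i" for j
    proof -
      \<comment> \<open>The square roots put \<open>(B i)\<^sup>2\<close>, not just
        \<open>B i\<close>, below a multiple of \<open>y i\<close>. With the first power the
        comparison series could grow logarithmically.\<close>
      have "\<beta> j \<le> sqrt (\<beta> j)"
        using \<beta>[of j] by (intro real_le_rsqrt) (auto simp: power2_eq_square mult_left_le)
      also have "\<dots> \<le> sqrt (C * y i * (x ^ j + x ^ (i - j)))"
        using decay[OF i False that] by (rule real_sqrt_le_mono)
      also have "\<dots> \<le> sqrt (C * y i) * (sqrt (x ^ j) + sqrt (x ^ (i - j)))"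
        unfolding real_sqrt_mult[of "C * y i"] using x Cy by (intro mult_left_mono sqrt_add_le_add_sqrt real_sqrt_ge_zero) auto
      finally show ?thesis by (simp add: real_sqrt_power)
    qed
    then have "B i \<le> (\<Sum>j\<le>i. sqrt (C * y i) * (sqrt x ^ j + sqrt x ^ (i - j)))"
      unfolding B_def by (intro sum_mono) auto
    also have "\<dots> = sqrt (C * y i) * ((\<Sum>j\<le>i. sqrt x ^ j) + (\<Sum>j\<le>i. sqrt x ^ (i - j)))"
      by (simp add: sum_distrib_left[symmetric] sum.distrib)
    also have "\<dots> \<le> sqrt (C * y i) * (1 / (1 - sqrt x) + 1 / (1 - sqrt x))"
      using geometric_sum_le[OF sx, of i] Cy by (intro mult_left_mono add_mono) auto
    finally have "(B i)\<^sup>2 \<le> (sqrt (C * y i) * (2 / (1 - sqrt x)))\<^sup>2"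
      using B by (intro power_mono) auto
    also have "\<dots> = C * y i * (4 / (1 - sqrt x)\<^sup>2)"
      using Cy by (simp add: power_mult_distrib power_divide)
    finally have B2: "(B i)\<^sup>2 \<le> C * y i * (4 / (1 - sqrt x)\<^sup>2)" .
    have "(1 + B i)\<^sup>2 \<le> 2 + 2 * (B i)\<^sup>2"
      using zero_le_power2[of "1 - B i"] by (simp add: power2_eq_square algebra_simps)
    also have "\<dots> \<le> 2 * (C * y i) + 2 * (C * y i * (4 / (1 - sqrt x)\<^sup>2))" using B2 Cy by linarith
    also have "\<dots> = K * y i" by (simp add: K_def algebra_simps)
    finally have "(1 + B i)\<^sup>2 \<le> K * y i" .
    moreover have "0 < (1 + B i)\<^sup>2" using B[of i] by (intro zero_less_power) auto
    ultimately have "\<beta> i * (1 + B i)\<^sup>2 \<le> \<beta> i * (K * y i)" using \<beta> by (intro mult_left_mono) auto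
    then show ?thesis using \<open>0 < (1 + B i)\<^sup>2\<close> yi by (simp add: divide_simps mult_ac)
  qed simp
  have "(\<Sum>i\<le>k. \<beta> i / (1 + B i)\<^sup>2) \<le> 1 - 1 / (1 + B k)" for k
  proof (induction k)
    case 0
    have u: "1 \<le> 1 + \<beta> 0" using \<beta>(1)[of 0] by simp
    then have "\<beta> 0 / (1 + \<beta> 0)\<^sup>2 \<le> \<beta> 0 / (1 + \<beta> 0)"
      using \<beta>(1)[of 0] by (intro divide_left_mono self_le_power) auto
    also have "\<dots> = 1 - 1 / (1 + \<beta> 0)" using u by (simp add: divide_simps)
    finally show ?case by (simp add: B_def)
  next
    case (Suc k)
    have eq: "B (Suc k) = B k + \<beta> (Suc k)" by (simp add: B_def)
    let ?u = "1 + B k" and ?v = "1 + B (Suc k)"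
    have uv: "0 < ?u" "?u \<le> ?v" using B[of k] \<beta>(1)[of "Suc k"] eq by auto
    have "\<beta> (Suc k) / ?v\<^sup>2 \<le> \<beta> (Suc k) / (?u * ?v)"
      using uv \<beta>(1)[of "Suc k"] by (intro divide_left_mono) (auto simp: power2_eq_square mult_right_mono)
    also have "\<dots> = 1 / ?u - 1 / ?v" using uv eq by (simp add: divide_simps)
    finally show ?case using Suc.IH by simp
  qed
  moreover have "0 \<le> 1 / (1 + B n)" using B[of n] by simp
  ultimately have tel: "(\<Sum>i\<le>n. \<beta> i / (1 + B i)\<^sup>2) \<le> 1" by (metis diff_ge_0_iff_ge diff_le_eq le_add_same_cancel1 order_trans add.commute)
  have "(\<Sum>i\<le>n. \<beta> i / y i) \<le> (\<Sum>i\<le>n. K * (\<beta> i / (1 + B i)\<^sup>2))"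
    using term_le by (intro sum_mono) auto
  also have "\<dots> = K * (\<Sum>i\<le>n. \<beta> i / (1 + B i)\<^sup>2)" by (simp add: sum_distrib_left)
  also have "\<dots> \<le> K * 1" using tel K by (intro mult_left_mono)
  finally show ?thesis by (simp add: K_def)
qed

text \<open>Each pair is charged to the end with the larger weight. With that end fixed, division by
  its weight gives a sequence bounded by 1, to which \<open>sum_quotient_le\<close> applies; every
  row and every column then costs at most \<open>W\<close>. In the application \<open>E\<close>
  marks the pairs that do not cover.\<close>

lemma pair_sum_le:
  fixes a :: "nat \<Rightarrow> real" and D :: "nat \<Rightarrow> nat \<Rightarrow> real"
  assumes x: "0 < x" "x < 1" and C: "0 < C"
    and a: "\<And>k. 0 < a k" and D: "\<And>k l. 0 < D k l"
    and decay: "\<And>k j l. K \<le> k \<Longrightarrow> k \<le> j \<Longrightarrow> j \<le> l \<Longrightarrow> l \<le> L \<Longrightarrow> E k l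
       \<Longrightarrow> a j \<le> C * D k l * (x ^ (j - k) + x ^ (l - j))"
  shows "(\<Sum>k\<in>{K..L}. \<Sum>l\<in>{K..L}. if k \<le> l \<and> E k l then a k * a l / D k l else 0)
    \<le> 2 * (4 * C + 16 * C / (1 - sqrt x)\<^sup>2) * (\<Sum>k\<in>{K..L}. a k)"
proof -
  define W where "W = 4 * C + 16 * C / (1 - sqrt x)\<^sup>2"
  have W: "W = 2 * (2 * C) + 8 * (2 * C) / (1 - sqrt x)\<^sup>2" by (simp add: W_def)
  have pow1: "x ^ i \<le> 1" for i using x by (simp add: power_le_one)
  \<comment> \<open>At \<open>j = k\<close> and \<open>j = l\<close> one of the two powers is 1 and
    the other at most 1; this is where \<open>C\<close> doubles.\<close>
  have ends: "a k \<le> 2 * C * D k l" "a l \<le> 2 * C * D k l" if "K \<le> k" "k \<le> l" "l \<le> L" "E k l" for k l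
  proof -
    have CD: "0 \<le> C * D k l" using C D[of k l] by simp
    show "a k \<le> 2 * C * D k l"
      using decay[OF that(1) order_refl that(2,3,4)] mult_left_mono[OF add_left_mono[OF pow1[of "l - k"], of 1] CD] by simp
    show "a l \<le> 2 * C * D k l"
      using decay[OF that(1) that(2) order_refl that(3,4)] mult_left_mono[OF add_right_mono[OF pow1[of "l - k"], of 1] CD] by simp
  qed
  have dec2: "a j \<le> 2 * C * D k l * (x ^ (j - k) + x ^ (l - j))" if "K \<le> k" "k \<le> j" "j \<le> l" "l \<le> L" "E k l" for k j l
  proof -
    have "0 \<le> C * D k l * (x ^ (j - k) + x ^ (l - j))" using C D[of k l] x by (simp add: less_imp_le)
    then show ?thesis using decay[OF that] by linarith
  qed
  have row: "(\<Sum>l\<in>{K..L}. if k \<le> l \<and> E k l \<and> a l \<le> a k then a l / D k l else 0) \<le> W" if k: "k \<in> {K..L}" for k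
  proof -
    \<comment> \<open>Pairs outside \<open>E\<close>, or whose later end has the larger weight, get
      the value 0: \<open>sum_quotient_le\<close> asks for its lower bound and its decay only at
      indices with a nonzero term.\<close>
    define \<beta> where "\<beta> i = (if k + i \<le> L \<and> E k (k + i) \<and> a (k + i) \<le> a k then a (k + i) / a k else 0)" for i
    have "(\<Sum>l\<in>{K..L}. if k \<le> l \<and> E k l \<and> a l \<le> a k then a l / D k l else 0)
      = (\<Sum>l\<in>{k..L}. if k \<le> l \<and> E k l \<and> a l \<le> a k then a l / D k l else 0)"
      using k by (intro sum.mono_neutral_right) auto
    also have "\<dots> = (\<Sum>i\<le>L - k. \<beta> i / (D k (k + i) / a k))"
      using k a[of k] by (intro sum.reindex_bij_witness[where j="\<lambda>l. l - k" and i="\<lambda>i. k + i"]) (auto simp: \<beta>_def)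
    also have "\<dots> \<le> 2 * (2 * C) + 8 * (2 * C) / (1 - sqrt x)\<^sup>2"
    proof (rule sum_quotient_le[OF x])
      show "0 \<le> \<beta> i" "\<beta> i \<le> 1" for i using a by (auto simp: \<beta>_def less_imp_le)
    next
      fix i assume "i \<le> L - k" "\<beta> i \<noteq> 0"
      then have i: "k + i \<le> L" "E k (k + i)" by (auto simp: \<beta>_def split: if_splits)
      show "1 \<le> 2 * C * (D k (k + i) / a k)"
        using ends(1)[of k "k + i"] i k a[of k] by (simp add: field_simps)
      fix j assume j: "j \<le> i"
      have "a (k + j) \<le> 2 * C * D k (k + i) * (x ^ j + x ^ (i - j))"
        using dec2[of k "k + j" "k + i"] i j k by simp
      then have "a (k + j) / a k \<le> 2 * C * (D k (k + i) / a k) * (x ^ j + x ^ (i - j))"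
        using divide_right_mono[OF _ less_imp_le[OF a[of k]]] by fastforce
      moreover have "0 \<le> 2 * C * (D k (k + i) / a k) * (x ^ j + x ^ (i - j))"
        using C D[of k "k + i"] a[of k] x by (simp add: less_imp_le)
      ultimately show "\<beta> j \<le> 2 * C * (D k (k + i) / a k) * (x ^ j + x ^ (i - j))"
        by (simp add: \<beta>_def)
    qed (use C in simp)
    finally show ?thesis by (simp only: W)
  qed
  have col: "(\<Sum>k\<in>{K..L}. if k \<le> l \<and> E k l \<and> a k \<le> a l then a k / D k l else 0) \<le> W" if l: "l \<in> {K..L}" for l
  proof -
    define \<beta> where "\<beta> i = (if i \<le> l - K \<and> E (l - i) l \<and> a (l - i) \<le> a l then a (l - i) / a l else 0)" for i
    have "(\<Sum>k\<in>{K..L}. if k \<le> l \<and> E k l \<and> a k \<le> a l then a k / D k l else 0)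
      = (\<Sum>k\<in>{K..l}. if k \<le> l \<and> E k l \<and> a k \<le> a l then a k / D k l else 0)"
      using l by (intro sum.mono_neutral_right) auto
    also have "\<dots> = (\<Sum>i\<le>l - K. \<beta> i / (D (l - i) l / a l))"
      using l a[of l] by (intro sum.reindex_bij_witness[where j="\<lambda>k. l - k" and i="\<lambda>i. l - i"]) (auto simp: \<beta>_def)
    also have "\<dots> \<le> 2 * (2 * C) + 8 * (2 * C) / (1 - sqrt x)\<^sup>2"
    proof (rule sum_quotient_le[OF x])
      show "0 \<le> \<beta> i" "\<beta> i \<le> 1" for i using a by (auto simp: \<beta>_def less_imp_le)
    next
      fix i assume "i \<le> l - K" "\<beta> i \<noteq> 0"
      then have i: "i \<le> l - K" "E (l - i) l" by (auto simp: \<beta>_def split: if_splits)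
      show "1 \<le> 2 * C * (D (l - i) l / a l)"
      proof -
        have "K \<le> l - i" using i l by auto
        then have "a l \<le> 2 * C * D (l - i) l" using i l by (intro ends(2)) auto
        then show ?thesis using a[of l] by (simp add: field_simps)
      qed
      fix j assume j: "j \<le> i"
      have "K \<le> l - i" "l - j - (l - i) = i - j" "l - (l - j) = j" using i j l by auto
      then have "a (l - j) \<le> 2 * C * D (l - i) l * (x ^ j + x ^ (i - j))"
        using dec2[of "l - i" "l - j" l] i j l by (simp add: add.commute)
      then have "a (l - j) / a l \<le> 2 * C * (D (l - i) l / a l) * (x ^ j + x ^ (i - j))"
        using divide_right_mono[OF _ less_imp_le[OF a[of l]]] by fastforce
      moreover have "0 \<le> 2 * C * (D (l - i) l / a l) * (x ^ j + x ^ (i - j))"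
        using C D[of "l - i" l] a[of l] x by (simp add: less_imp_le)
      ultimately show "\<beta> j \<le> 2 * C * (D (l - i) l / a l) * (x ^ j + x ^ (i - j))"
        by (simp add: \<beta>_def)
    qed (use C in simp)
    finally show ?thesis by (simp only: W)
  qed
  have "(\<Sum>k\<in>{K..L}. \<Sum>l\<in>{K..L}. if k \<le> l \<and> E k l then a k * a l / D k l else 0)
    \<le> (\<Sum>k\<in>{K..L}. \<Sum>l\<in>{K..L}. a k * (if k \<le> l \<and> E k l \<and> a l \<le> a k then a l / D k l else 0)
        + a l * (if k \<le> l \<and> E k l \<and> a k \<le> a l then a k / D k l else 0))"
    using a D by (intro sum_mono) (auto simp: less_imp_le mult.commute)
  also have "\<dots> = (\<Sum>k\<in>{K..L}. a k * (\<Sum>l\<in>{K..L}. if k \<le> l \<and> E k l \<and> a l \<le> a k then a l / D k l else 0))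
    + (\<Sum>l\<in>{K..L}. a l * (\<Sum>k\<in>{K..L}. if k \<le> l \<and> E k l \<and> a k \<le> a l then a k / D k l else 0))"
    unfolding sum.distrib sum_distrib_left by (subst (2) sum.swap) simp
  also have "\<dots> \<le> (\<Sum>k\<in>{K..L}. a k * W) + (\<Sum>l\<in>{K..L}. a l * W)"
    using row col a by (intro add_mono sum_mono mult_left_mono) (auto simp: less_imp_le)
  also have "\<dots> = 2 * W * (\<Sum>k\<in>{K..L}. a k)"
    by (simp add: sum_distrib_right[symmetric])
  finally show ?thesis by (simp only: W_def)
qed

section \<open>Ratios along dyadic stages and the second moment method\<close>

lemma geometric_decay:
  fixes r :: "nat \<Rightarrow> real"
  assumes "\<And>k. k0 \<le> k \<Longrightarrow> r (Suc k) \<le> \<rho> * r k" "0 \<le> \<rho>" "k0 \<le> k" "k \<le> j"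
  shows "r j \<le> \<rho> ^ (j - k) * r k"
  using assms(4)
proof (induction j rule: dec_induct)
  case (step j)
  have "r (Suc j) \<le> \<rho> * r j" using assms step by simp
  also have "\<dots> \<le> \<rho> * (\<rho> ^ (j - k) * r k)" using step assms by (intro mult_left_mono) auto
  finally show ?case using step by (simp add: Suc_diff_le)
qed simp

text \<open>The mean of \<open>hits\<close> over the torus, at least \<open>r ^ m * T ^ n\<close>,
  cannot exceed its upper bound \<open>N_count A (2 * r) (2 * T)\<close>; undoing the doubling costs
  \<open>5 ^ (m + n)\<close>.\<close>

lemma M_ratio_le:
  fixes A :: "real ^ 'n::finite ^ 'm::finite"
  assumes "0 < r" "1 \<le> T"
  shows "M_ratio A r T \<le> 5 ^ (CARD('m) + CARD('n))"
proof -
  have "ennreal (real (card (int_ball T :: (int ^ 'n) set)) * (2 * r) ^ CARD('m))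
    = (\<integral>\<^sup>+b. of_nat (hits A r T b) * indicator unit_cube b \<partial>lborel)"
    using assms by (simp add: nn_integral_hits)
  also have "\<dots> \<le> (\<integral>\<^sup>+b. of_nat (N_count A (2 * r) (2 * T)) * indicator (unit_cube :: (real ^ 'm) set) b \<partial>lborel)"
    by (intro nn_integral_mono mult_right_mono of_nat_mono hits_le_N_count) auto
  also have "\<dots> = ennreal (real (N_count A (2 * r) (2 * T)))"
    by (simp add: nn_integral_cmult emeasure_unit_cube ennreal_of_nat_eq_real_of_nat)
  finally have "real (card (int_ball T :: (int ^ 'n) set)) * (2 * r) ^ CARD('m) \<le> real (N_count A (2 * r) (2 * T))"
    by (simp add: ennreal_le_iff)
  also have "\<dots> \<le> 5 ^ (CARD('m) + CARD('n)) * real (N_count A r T)"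
    using assms by (intro N_count_double) auto
  finally have le: "real (card (int_ball T :: (int ^ 'n) set)) * (2 * r) ^ CARD('m) \<le> 5 ^ (CARD('m) + CARD('n)) * real (N_count A r T)" .
  have "T ^ CARD('n) * r ^ CARD('m) \<le> real (card (int_ball T :: (int ^ 'n) set)) * (2 * r) ^ CARD('m)"
    using assms by (intro mult_mono card_int_ball_bounds power_mono) auto
  with le have "r ^ CARD('m) * T ^ CARD('n) \<le> 5 ^ (CARD('m) + CARD('n)) * real (N_count A r T)"
    by (simp add: mult.commute)
  then show ?thesis using N_count_pos[of r T A] assms by (simp add: M_ratio_def divide_simps)
qed

text \<open>If the box covers, every \<open>b\<close> has a hit and hence at least
  \<open>N_count A r T\<close> hits of the doubled box, so the mean cannot be small.\<close>

lemma M_ratio_ge_covers: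
  fixes A :: "real ^ 'n::finite ^ 'm::finite"
  assumes "0 < r" "1 \<le> T" "lat_covers A r T"
  shows "1 / (4 ^ CARD('m) * 6 ^ CARD('n)) \<le> M_ratio A r T"
proof -
  have "N_count A r T \<le> hits A (2 * r) (2 * T) b" for b
    by (rule N_count_le_hits, rule lat_coversD[OF assms(3), of b]) (auto simp: hits_pos_iff)
  then have "(\<integral>\<^sup>+b. of_nat (N_count A r T) * indicator (unit_cube :: (real ^ 'm) set) b \<partial>lborel)
    \<le> (\<integral>\<^sup>+b. of_nat (hits A (2 * r) (2 * T) b) * indicator unit_cube b \<partial>lborel)"
    by (intro nn_integral_mono mult_right_mono of_nat_mono) auto
  also have "\<dots> = ennreal (real (card (int_ball (2 * T) :: (int ^ 'n) set)) * (2 * (2 * r)) ^ CARD('m))"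
    using assms by (simp add: nn_integral_hits)
  finally have "ennreal (real (N_count A r T)) \<le> ennreal (real (card (int_ball (2 * T) :: (int ^ 'n) set)) * (2 * (2 * r)) ^ CARD('m))"
    by (simp add: nn_integral_cmult emeasure_unit_cube ennreal_of_nat_eq_real_of_nat)
  then have "real (N_count A r T) \<le> real (card (int_ball (2 * T) :: (int ^ 'n) set)) * (2 * (2 * r)) ^ CARD('m)"
    using assms by (simp add: ennreal_le_iff)
  also have "\<dots> \<le> (3 * (2 * T)) ^ CARD('n) * (2 * (2 * r)) ^ CARD('m)"
    using assms by (intro mult_right_mono card_int_ball_bounds) auto
  also have "\<dots> = (4 ^ CARD('m) * 6 ^ CARD('n)) * (r ^ CARD('m) * T ^ CARD('n))"
    using power_mult_distrib[of 6 T "CARD('n)"] power_mult_distrib[of 4 r "CARD('m)"] by (simp add: mult_ac)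
  finally show ?thesis
    using N_count_pos[of r T A] assms by (simp add: M_ratio_def divide_simps mult_ac)
qed

lemma second_moment_pair:
  fixes A :: "real ^ 'n::finite ^ 'm::finite"
  assumes "0 < r'" "r' \<le> r" "1 \<le> T" "T \<le> T'"
  shows "(\<integral>\<^sup>+b. of_nat (hits A r T b) * of_nat (hits A r' T' b) * indicator unit_cube b \<partial>lborel)
    \<le> ennreal (3 ^ CARD('n) * 2 ^ CARD('m) * 5 ^ (CARD('m) + CARD('n))
        * (M_ratio A r T * M_ratio A r' T' / M_ratio A r T') * (real (N_count A r T) * real (N_count A r' T')))"
proof -
  have pos: "0 < real (N_count A r T)" "0 < real (N_count A r' T')" "0 < real (N_count A r T')"
    using assms by (auto intro!: N_count_pos)
  have "real (card (int_ball T :: (int ^ 'n) set)) * (2 * r') ^ CARD('m) * real (N_count A (r + r') (T' + T))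
    \<le> (3 * T) ^ CARD('n) * (2 * r') ^ CARD('m) * real (N_count A (2 * r) (2 * T'))"
    using assms by (intro mult_mono card_int_ball_bounds order_refl) (auto intro!: N_count_mono)
  also have "\<dots> \<le> (3 * T) ^ CARD('n) * (2 * r') ^ CARD('m) * (5 ^ (CARD('m) + CARD('n)) * real (N_count A r T'))"
    using assms by (intro mult_left_mono N_count_double) auto
  \<comment> \<open>The powers of \<open>r\<close> and \<open>T'\<close> in the product of the
    ratios cancel against \<open>M_ratio A r T'\<close>; times the two counts,
    \<open>T ^ n * r' ^ m * N_count A r T'\<close> remains.\<close>
  also have "\<dots> = 3 ^ CARD('n) * 2 ^ CARD('m) * 5 ^ (CARD('m) + CARD('n))
        * (M_ratio A r T * M_ratio A r' T' / M_ratio A r T') * (real (N_count A r T) * real (N_count A r' T'))"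
    using pos assms by (simp add: M_ratio_def power_mult_distrib field_simps)
  finally show ?thesis
    using assms by (intro order_trans[OF nn_integral_hits_hits] ennreal_leI) auto
qed

lemma hits_measurable_real [measurable]: "(\<lambda>b. real (hits A r T b)) \<in> borel_measurable borel"
proof -
  have eq: "(\<lambda>b. real (hits A r T b)) = (\<lambda>b. enn2real (of_nat (hits A r T b)))"
    by (simp add: ennreal_of_nat_eq_real_of_nat)
  show ?thesis by (subst eq) measurable
qed

lemma hits_pos_borel [measurable]: "{b. 0 < hits A r T b} \<in> sets borel"
proof -
  have "{b. 0 < hits A r T b} = {b \<in> space borel. (0 :: ennreal) < of_nat (hits A r T b)}" by auto
  also have "\<dots> \<in> sets borel" by measurable
  finally show ?thesis .
qed

lemma first_moment_ge:
  fixes A :: "real ^ 'n::finite ^ 'm::finite"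
  assumes "0 < r" "1 \<le> T"
  shows "ennreal (M_ratio A r T * real (N_count A r T)) \<le> (\<integral>\<^sup>+b. of_nat (hits A r T b) * indicator unit_cube b \<partial>lborel)"
proof -
  have "0 < real (N_count A r T)" using assms by (auto intro!: N_count_pos)
  then have "M_ratio A r T * real (N_count A r T) = T ^ CARD('n) * r ^ CARD('m)"
    by (simp add: M_ratio_def)
  also have "\<dots> \<le> real (card (int_ball T :: (int ^ 'n) set)) * (2 * r) ^ CARD('m)"
    using assms by (intro mult_mono card_int_ball_bounds power_mono) auto
  finally show ?thesis using assms by (simp add: nn_integral_hits ennreal_leI)
qed

text \<open>The box of stage \<open>j\<close> arises from \<open>(r k, 2 ^ l)\<close> by shrinking
  the radius through \<open>j - k\<close> stages and the height through \<open>l - j\<close> stages;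
  \<open>max \<rho> (1/2)\<close> is a common rate for both.\<close>

lemma M_ratio_decay:
  fixes A :: "real ^ 'n::finite ^ 'm::finite" and r :: "nat \<Rightarrow> real"
  assumes pos: "\<And>k. 0 < r k" and \<rho>: "0 < \<rho>" "\<rho> < 1"
    and dec: "\<And>k. k0 \<le> k \<Longrightarrow> r (Suc k) \<le> \<rho> * r k"
    and "k0 \<le> k" "k \<le> j" "j \<le> l" "\<not> lat_covers A (r k) (2 ^ l)"
  shows "M_ratio A (r j) (2 ^ j) \<le> 6 * 243 ^ (CARD('m) + CARD('n)) * M_ratio A (r k) (2 ^ l)
    * (max \<rho> (1/2) ^ (j - k) + max \<rho> (1/2) ^ (l - j))"
proof -
  have rj: "r j \<le> \<rho> ^ (j - k) * r k"
    using geometric_decay[of k0 r \<rho> k j] assms by simp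
  have "\<rho> ^ (j - k) \<le> 1" using \<rho> by (simp add: power_le_one)
  then have rjk: "r j \<le> r k" using rj pos[of k] mult_right_mono[of "\<rho> ^ (j - k)" 1 "r k"] by linarith
  have "M_ratio A (r j) (2 ^ j) \<le> 6 * 243 ^ (CARD('m) + CARD('n)) * (r j / r k + 2 ^ j / 2 ^ l) * M_ratio A (r k) (2 ^ l)"
    using assms rjk by (intro M_ratio_not_covers) (auto intro: power_increasing)
  also have "\<dots> \<le> 6 * 243 ^ (CARD('m) + CARD('n)) * (max \<rho> (1/2) ^ (j - k) + max \<rho> (1/2) ^ (l - j)) * M_ratio A (r k) (2 ^ l)"
  proof (intro mult_right_mono mult_left_mono add_mono)
    have "r j / r k \<le> \<rho> ^ (j - k)" using rj pos[of k] by (simp add: divide_simps)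
    also have "\<dots> \<le> max \<rho> (1/2) ^ (j - k)" using \<rho> by (intro power_mono) auto
    finally show "r j / r k \<le> max \<rho> (1/2) ^ (j - k)" .
    have "(2 :: real) ^ j / 2 ^ l = (1/2) ^ (l - j)"
      using \<open>j \<le> l\<close> by (simp add: power_diff power_divide)
    also have "\<dots> \<le> max \<rho> (1/2) ^ (l - j)" by (intro power_mono) auto
    finally show "(2 :: real) ^ j / 2 ^ l \<le> max \<rho> (1/2) ^ (l - j)" .
  qed (use pos M_ratio_pos[of "r k" "2 ^ l" A] in \<open>auto simp: less_imp_le\<close>)
  finally show ?thesis by (simp add: mult_ac)
qed

text \<open>Without covering at any \<open>l\<close>, \<open>M_ratio_decay\<close> together with
  \<open>M_ratio_le\<close> would bound all partial sums from \<open>k\<close> onwards by two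
  geometric series.\<close>

lemma eventually_lat_covers:
  fixes A :: "real ^ 'n::finite ^ 'm::finite" and r :: "nat \<Rightarrow> real"
  assumes pos: "\<And>k. 0 < r k" and \<rho>: "0 < \<rho>" "\<rho> < 1"
    and dec: "\<And>k. k0 \<le> k \<Longrightarrow> r (Suc k) \<le> \<rho> * r k"
    and div: "\<not> summable (\<lambda>k. M_ratio A (r k) (2 ^ k))" and k: "k0 \<le> k"
  shows "\<exists>l. lat_covers A (r k) (2 ^ l)"
proof (rule ccontr)
  assume "\<not> ?thesis"
  then have nc: "\<not> lat_covers A (r k) (2 ^ l)" for l by blast
  define x where "x = max \<rho> (1/2)"
  have x: "0 < x" "x < 1" using \<rho> by (auto simp: x_def)
  define C where "C = (6 * 243 ^ (CARD('m) + CARD('n)) * 5 ^ (CARD('m) + CARD('n)) :: real)"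
  have C: "0 < C" by (simp add: C_def)
  have a: "M_ratio A (r (k + i)) (2 ^ (k + i)) \<le> C * (x ^ i + x ^ (n - i))" if "i \<le> n" for i n
  proof -
    have "M_ratio A (r (k + i)) (2 ^ (k + i)) \<le> 6 * 243 ^ (CARD('m) + CARD('n)) * M_ratio A (r k) (2 ^ (k + n)) * (x ^ i + x ^ (n - i))"
      using M_ratio_decay[of r \<rho> k0 k "k + i" "k + n" A] pos \<rho> dec k nc that by (simp add: x_def)
    also have "\<dots> \<le> 6 * 243 ^ (CARD('m) + CARD('n)) * 5 ^ (CARD('m) + CARD('n)) * (x ^ i + x ^ (n - i))"
      using x pos by (intro mult_right_mono mult_left_mono M_ratio_le) auto
    finally show ?thesis by (simp add: C_def)
  qed
  have "(\<Sum>i\<le>n. M_ratio A (r (k + i)) (2 ^ (k + i))) \<le> C * (2 / (1 - x))" for n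
  proof -
    have "(\<Sum>i\<le>n. M_ratio A (r (k + i)) (2 ^ (k + i))) \<le> (\<Sum>i\<le>n. C * (x ^ i + x ^ (n - i)))"
      using a by (intro sum_mono) auto
    also have "\<dots> = C * ((\<Sum>i\<le>n. x ^ i) + (\<Sum>i\<le>n. x ^ (n - i)))"
      by (simp add: sum_distrib_left[symmetric] sum.distrib)
    also have "\<dots> \<le> C * (1 / (1 - x) + 1 / (1 - x))"
      using geometric_sum_le[of x n] x C by (intro mult_left_mono add_mono) auto
    finally show ?thesis by simp
  qed
  then have "summable (\<lambda>i. M_ratio A (r (k + i)) (2 ^ (k + i)))"
    by (intro bounded_imp_summable[of _ "C * (2 / (1 - x))"] less_imp_le[OF M_ratio_pos[OF pos]]) auto
  then have "summable (\<lambda>i. M_ratio A (r (i + k)) (2 ^ (i + k)))" by (simp add: add.commute)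
  with div show False using summable_iff_shift[of "\<lambda>k. M_ratio A (r k) (2 ^ k)" k] by blast
qed

text \<open>Cauchy-Schwarz for \<open>Z\<close> against the indicator of \<open>V\<close>: a
  function whose second moment is comparable to the square of its first cannot live on a small
  set.\<close>

lemma Chung_Erdos_bound:
  assumes [measurable]: "Z \<in> borel_measurable M" "V \<in> sets M"
    and supp: "\<And>x. x \<in> space M \<Longrightarrow> Z x \<noteq> 0 \<Longrightarrow> x \<in> V"
    and first: "ennreal S \<le> (\<integral>\<^sup>+x. Z x \<partial>M)" and second: "(\<integral>\<^sup>+x. Z x ^ 2 \<partial>M) \<le> ennreal (C * S\<^sup>2)"
    and S: "0 < S" and C: "0 < C"
  shows "ennreal (1 / C) \<le> emeasure M V"
proof -
  have "ennreal (S\<^sup>2) = (ennreal S)\<^sup>2" using S by (simp add: ennreal_power)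
  also have "\<dots> \<le> (\<integral>\<^sup>+x. Z x * indicator V x \<partial>M)\<^sup>2"
  proof -
    have "(\<integral>\<^sup>+x. Z x \<partial>M) = (\<integral>\<^sup>+x. Z x * indicator V x \<partial>M)"
      using supp by (intro nn_integral_cong) (auto simp: indicator_def)
    then show ?thesis using first by (intro power_mono) auto
  qed
  also have "\<dots> \<le> (\<integral>\<^sup>+x. Z x ^ 2 \<partial>M) * (\<integral>\<^sup>+x. indicator V x ^ 2 \<partial>M)"
    by (rule Cauchy_Schwarz_nn_integral) auto
  also have "(\<integral>\<^sup>+x. indicator V x ^ 2 \<partial>M) = emeasure M V"
  proof -
    have "(\<lambda>x. indicator V x ^ 2) = (indicator V :: _ \<Rightarrow> ennreal)" by (auto simp: indicator_def fun_eq_iff)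
    then show ?thesis by simp
  qed
  also have "(\<integral>\<^sup>+x. Z x ^ 2 \<partial>M) * emeasure M V \<le> ennreal (C * S\<^sup>2) * emeasure M V"
    using second by (rule mult_right_mono) simp
  finally have le: "ennreal (S\<^sup>2) \<le> ennreal (C * S\<^sup>2) * emeasure M V" .
  show ?thesis
  proof (cases "emeasure M V")
    case (real v)
    with le have "S\<^sup>2 \<le> C * S\<^sup>2 * v" using S C by (simp add: ennreal_mult[symmetric] ennreal_le_iff)
    then have "1 \<le> C * v" using S by (simp add: power2_eq_square)
    then show ?thesis using real C by (simp add: ennreal_leI divide_simps mult.commute)
  qed simp
qed

text \<open>The second moment method is run on the stages \<open>K\<close> to \<open>L\<close>, with
  \<open>L\<close> so large that their ratios sum to \<open>S \<ge> 1\<close>. Noncovering pairs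
  contribute order \<open>S\<close>, covering pairs order \<open>S ^ 2\<close>; since
  \<open>S \<ge> 1\<close> absorbs the former, the constant does not depend on
  \<open>K\<close>.\<close>

lemma hits_infinitely_often_positive:
  fixes A :: "real ^ 'n::finite ^ 'm::finite" and r :: "nat \<Rightarrow> real"
  assumes pos: "\<And>k. 0 < r k" and \<rho>: "0 < \<rho>" "\<rho> < 1"
    and dec: "\<And>k. k0 \<le> k \<Longrightarrow> r (Suc k) \<le> \<rho> * r k"
    and div: "\<not> summable (\<lambda>k. M_ratio A (r k) (2 ^ k))"
  obtains c where "0 < c" "\<And>K. k0 \<le> K \<Longrightarrow> ennreal c \<le> emeasure lborel {b \<in> unit_cube. \<exists>k\<ge>K. 0 < hits A (r k) (2 ^ k) b}"
proof -
  define x where "x = max \<rho> (1/2)"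
  have x: "0 < x" "x < 1" using \<rho> by (auto simp: x_def)
  define a where "a k = M_ratio A (r k) (2 ^ k)" for k
  define D where "D k l = M_ratio A (r k) (2 ^ l)" for k l
  define E where "E k l \<longleftrightarrow> \<not> lat_covers A (r k) (2 ^ l)" for k l
  define N where "N k = real (N_count A (r k) (2 ^ k))" for k
  have a: "0 < a k" and D: "0 < D k l" and N: "0 < N k" for k l
    using pos by (auto simp: a_def D_def N_def intro!: M_ratio_pos N_count_pos less_imp_le[OF pos])
  define C1 :: real where "C1 = 6 * 243 ^ (CARD('m) + CARD('n))"
  define C2 :: real where "C2 = 3 ^ CARD('n) * 2 ^ CARD('m) * 5 ^ (CARD('m) + CARD('n))"
  define C3 :: real where "C3 = 4 ^ CARD('m) * 6 ^ CARD('n)"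
  define C4 where "C4 = 2 * (4 * C1 + 16 * C1 / (1 - sqrt x)\<^sup>2)"
  define C where "C = 2 * C2 * (C4 + C3)"
  have Cpos: "0 < C1" "0 < C2" "0 < C3" by (simp_all add: C1_def C2_def C3_def)
  then have "0 < C4" by (simp add: C4_def add_pos_nonneg)
  then have C: "0 < C" using Cpos by (simp add: C_def)
  \<comment> \<open>A bounded substitute for the indicator of a hit at stage \<open>k\<close>, with
    integral at least \<open>a k\<close>.\<close>
  define w where "w k b = real (hits A (r k) (2 ^ k) b) / N k" for k b
  have w_nonneg: "0 \<le> w k b" for k b using N[of k] by (simp add: w_def)
  have w_eq: "ennreal (w k b) = ennreal (1 / N k) * of_nat (hits A (r k) (2 ^ k) b)" for k b
    using N[of k] by (simp add: w_def ennreal_of_nat_eq_real_of_nat ennreal_mult[symmetric] less_imp_le)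
  have w_meas [measurable]: "(\<lambda>b. ennreal (w k b)) \<in> borel_measurable borel" for k
    unfolding w_eq by measurable
  have mono_r: "r l \<le> r k" if "k0 \<le> k" "k \<le> l" for k l
  proof -
    have "r l \<le> \<rho> ^ (l - k) * r k" using geometric_decay[of k0 r \<rho> k l] dec \<rho> that by simp
    also have "\<dots> \<le> 1 * r k" using pos[of k] \<rho> by (intro mult_right_mono power_le_one) auto
    finally show ?thesis by simp
  qed
  have first: "ennreal (a k) \<le> (\<integral>\<^sup>+b. ennreal (w k b) * indicator unit_cube b \<partial>lborel)" for k
  proof -
    have "ennreal (a k) = ennreal (1 / N k) * ennreal (a k * N k)"
      using N[of k] a[of k] by (simp add: ennreal_mult[symmetric] less_imp_le)
    also have "\<dots> \<le> ennreal (1 / N k) * (\<integral>\<^sup>+b. of_nat (hits A (r k) (2 ^ k) b) * indicator unit_cube b \<partial>lborel)"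
      using first_moment_ge[of "r k" "2 ^ k" A] pos by (intro mult_left_mono) (auto simp: a_def N_def)
    also have "\<dots> = (\<integral>\<^sup>+b. ennreal (w k b) * indicator unit_cube b \<partial>lborel)"
      unfolding w_eq by (subst nn_integral_cmult[symmetric]) (auto simp: mult.assoc)
    finally show ?thesis .
  qed
  define G where "G k l = (\<integral>\<^sup>+b. ennreal (w k b * w l b) * indicator unit_cube b \<partial>lborel)" for k l
  have G_sym: "G k l = G l k" for k l by (simp add: G_def mult.commute)
  have G_le: "G k l \<le> ennreal (C2 * (a k * a l / D k l))" if "k0 \<le> k" "k \<le> l" for k l
  proof -
    have "G k l = ennreal (1 / (N k * N l)) * (\<integral>\<^sup>+b. of_nat (hits A (r k) (2 ^ k) b) * of_nat (hits A (r l) (2 ^ l) b) * indicator unit_cube b \<partial>lborel)"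
      unfolding G_def using N[of k] N[of l]
      by (subst nn_integral_cmult[symmetric])
        (auto simp: w_def ennreal_of_nat_eq_real_of_nat ennreal_mult[symmetric] mult.assoc[symmetric] less_imp_le intro!: nn_integral_cong)
    also have "\<dots> \<le> ennreal (1 / (N k * N l)) * ennreal (C2 * (a k * a l / D k l) * (N k * N l))"
      using second_moment_pair[of "r l" "r k" "2 ^ k" "2 ^ l" A] mono_r[OF that] pos that
      by (intro mult_left_mono) (auto simp: C2_def a_def D_def N_def power_increasing)
    also have "\<dots> = ennreal (C2 * (a k * a l / D k l))"
      using N[of k] N[of l] a[of k] a[of l] D[of k l] Cpos by (subst ennreal_mult[symmetric]) (auto simp: less_imp_le)
    finally show ?thesis .
  qed
  have main: "ennreal (1 / C) \<le> emeasure lborel {b \<in> unit_cube. \<exists>k\<ge>K. 0 < hits A (r k) (2 ^ k) b}" if K: "k0 \<le> K" for K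
  proof -
    have "\<exists>L. 1 \<le> (\<Sum>k\<in>{K..L}. a k)"
    proof (rule ccontr)
      assume "\<not> ?thesis"
      then have lt: "(\<Sum>k\<in>{K..L}. a k) < 1" for L by (meson not_le)
      have "(\<Sum>i\<le>n. a (i + K)) \<le> 1" for n
      proof -
        have "(\<Sum>i\<le>n. a (i + K)) = (\<Sum>k\<in>{K..n + K}. a k)"
          by (rule sum.reindex_bij_witness[where i="\<lambda>k. k - K" and j="\<lambda>i. i + K"]) auto
        then show ?thesis using lt[of "n + K"] by simp
      qed
      then have "summable (\<lambda>i. a (i + K))"
        using a by (intro bounded_imp_summable) (auto simp: less_imp_le)
      then have "summable a" by (simp add: summable_iff_shift)
      moreover have "a = (\<lambda>k. M_ratio A (r k) (2 ^ k))" by (simp add: fun_eq_iff a_def)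
      ultimately show False using div by simp
    qed
    then obtain L where L: "1 \<le> (\<Sum>k\<in>{K..L}. a k)" ..
    define S where "S = (\<Sum>k\<in>{K..L}. a k)"
    have S: "1 \<le> S" using L by (simp add: S_def)
    define M where "M = restrict_space lborel (unit_cube :: (real ^ 'm) set)"
    define Z where "Z b = (\<Sum>k\<in>{K..L}. ennreal (w k b))" for b
    have Z_meas [measurable]: "Z \<in> borel_measurable borel" by (simp add: Z_def[abs_def])
    define V where "V = {b \<in> unit_cube. \<exists>k\<ge>K. 0 < hits A (r k) (2 ^ k) b}"
    have "V = unit_cube \<inter> (\<Union>k\<in>{K..}. {b. 0 < hits A (r k) (2 ^ k) b})" by (auto simp: V_def)
    also have "\<dots> \<in> sets borel" by (intro sets.Int unit_cube_borel sets.countable_UN'') auto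
    finally have V: "V \<in> sets borel" .
    have V_sub: "V \<subseteq> unit_cube" by (auto simp: V_def)
    have VM: "V \<in> sets M" unfolding M_def
      by (subst sets_restrict_space_iff) (simp_all add: V V_sub)
    have int_M: "(\<integral>\<^sup>+b. f b \<partial>M) = (\<integral>\<^sup>+b. f b * indicator unit_cube b \<partial>lborel)" for f
      by (simp add: M_def nn_integral_restrict_space)
    have "ennreal (1 / C) \<le> emeasure M V"
    proof (rule Chung_Erdos_bound[where Z=Z and S=S])
      show "Z \<in> borel_measurable M" unfolding M_def by (intro measurable_restrict_space1) simp
      show "b \<in> V" if "b \<in> space M" "Z b \<noteq> 0" for b
        using that by (auto simp: Z_def M_def space_restrict_space V_def w_def) (metis gr0I div_0 ennreal_0 of_nat_0)
      have "ennreal S = (\<Sum>k\<in>{K..L}. ennreal (a k))" using a by (simp add: S_def less_imp_le)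
      also have "\<dots> \<le> (\<Sum>k\<in>{K..L}. \<integral>\<^sup>+b. ennreal (w k b) * indicator unit_cube b \<partial>lborel)"
        using first by (intro sum_mono)
      also have "\<dots> = (\<integral>\<^sup>+b. Z b \<partial>M)"
        unfolding int_M Z_def sum_distrib_right by (subst nn_integral_sum) auto
      finally show "ennreal S \<le> (\<integral>\<^sup>+b. Z b \<partial>M)" .
      have "(\<integral>\<^sup>+b. (Z b)\<^sup>2 \<partial>M) = (\<integral>\<^sup>+b. (\<Sum>k\<in>{K..L}. \<Sum>l\<in>{K..L}. ennreal (w k b * w l b) * indicator unit_cube b) \<partial>lborel)"
        unfolding int_M
      proof (rule nn_integral_cong)
        fix b
        have "(Z b)\<^sup>2 = (\<Sum>k\<in>{K..L}. \<Sum>l\<in>{K..L}. ennreal (w k b * w l b))"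
          unfolding Z_def by (simp only: power2_eq_square sum_product ennreal_mult[OF w_nonneg w_nonneg])
        then show "(Z b)\<^sup>2 * indicator unit_cube b = (\<Sum>k\<in>{K..L}. \<Sum>l\<in>{K..L}. ennreal (w k b * w l b) * indicator unit_cube b)"
          by (simp only: sum_distrib_right)
      qed
      also have "\<dots> = (\<Sum>k\<in>{K..L}. \<Sum>l\<in>{K..L}. G k l)"
      proof -
        have meas: "(\<lambda>b. ennreal (w k b * w l b) * indicator unit_cube b) \<in> borel_measurable lborel" for k l
          unfolding w_def by measurable
        show ?thesis by (simp only: nn_integral_sum[OF borel_measurable_sum[OF meas]] nn_integral_sum[OF meas] G_def)
      qed
      \<comment> \<open>The overlap bound needs the later stage to have the smaller radius, so
        symmetry reduces to \<open>k \<le> l\<close>, with the diagonal counted twice.\<close>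
      also have "\<dots> \<le> (\<Sum>k\<in>{K..L}. \<Sum>l\<in>{K..L}. (if k \<le> l then G k l else 0) + (if l \<le> k then G l k else 0))"
        by (intro sum_mono) (auto simp: G_sym)
      also have "\<dots> = 2 * (\<Sum>k\<in>{K..L}. \<Sum>l\<in>{K..L}. if k \<le> l then G k l else 0)"
        unfolding sum.distrib by (subst (2) sum.swap) (simp add: mult_2)
      also have "\<dots> \<le> 2 * (\<Sum>k\<in>{K..L}. \<Sum>l\<in>{K..L}. ennreal (C2 * ((if k \<le> l \<and> E k l then a k * a l / D k l else 0) + C3 * (a k * a l))))"
      proof (intro mult_left_mono sum_mono)
        fix k l assume kl: "k \<in> {K..L}" "l \<in> {K..L}"
        show "(if k \<le> l then G k l else 0) \<le> ennreal (C2 * ((if k \<le> l \<and> E k l then a k * a l / D k l else 0) + C3 * (a k * a l)))"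
        proof (cases "k \<le> l")
          case True
          have "a k * a l / D k l \<le> (if k \<le> l \<and> E k l then a k * a l / D k l else 0) + C3 * (a k * a l)"
          proof (cases "E k l")
            case False
            then have "1 / C3 \<le> D k l" using pos by (simp add: E_def D_def C3_def M_ratio_ge_covers)
            then have "1 / D k l \<le> C3" using D[of k l] Cpos by (simp add: divide_simps mult.commute)
            then have "(a k * a l) * (1 / D k l) \<le> (a k * a l) * C3" using a by (intro mult_left_mono) (auto simp: less_imp_le)
            then show ?thesis using False by (simp add: mult.commute)
          qed (use True a Cpos in \<open>auto simp: less_imp_le\<close>)
          then have "C2 * (a k * a l / D k l) \<le> C2 * ((if k \<le> l \<and> E k l then a k * a l / D k l else 0) + C3 * (a k * a l))"
            using Cpos by (intro mult_left_mono) auto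
          then have "ennreal (C2 * (a k * a l / D k l)) \<le> ennreal (C2 * ((if k \<le> l \<and> E k l then a k * a l / D k l else 0) + C3 * (a k * a l)))"
            by (rule ennreal_leI)
          moreover have "G k l \<le> ennreal (C2 * (a k * a l / D k l))" using K kl True by (intro G_le) auto
          ultimately have "G k l \<le> ennreal (C2 * ((if k \<le> l \<and> E k l then a k * a l / D k l else 0) + C3 * (a k * a l)))"
            by (rule order_trans[rotated])
          then show ?thesis using True by (simp only: if_True simp_thms)
        qed simp
      qed simp
      also have "\<dots> = ennreal (2 * C2 * ((\<Sum>k\<in>{K..L}. \<Sum>l\<in>{K..L}. if k \<le> l \<and> E k l then a k * a l / D k l else 0)
          + C3 * (\<Sum>k\<in>{K..L}. \<Sum>l\<in>{K..L}. a k * a l)))"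
      proof -
        have nn: "0 \<le> C2 * ((if k \<le> l \<and> E k l then a k * a l / D k l else 0) + C3 * (a k * a l))" for k l
          using a D Cpos by (auto simp: less_imp_le intro!: mult_nonneg_nonneg add_nonneg_nonneg divide_nonneg_nonneg)
        have "(\<Sum>k\<in>{K..L}. \<Sum>l\<in>{K..L}. ennreal (C2 * ((if k \<le> l \<and> E k l then a k * a l / D k l else 0) + C3 * (a k * a l))))
          = ennreal (\<Sum>k\<in>{K..L}. \<Sum>l\<in>{K..L}. C2 * ((if k \<le> l \<and> E k l then a k * a l / D k l else 0) + C3 * (a k * a l)))"
          by (simp only: sum_ennreal nn sum_nonneg)
        also have "(\<Sum>k\<in>{K..L}. \<Sum>l\<in>{K..L}. C2 * ((if k \<le> l \<and> E k l then a k * a l / D k l else 0) + C3 * (a k * a l)))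
          = C2 * ((\<Sum>k\<in>{K..L}. \<Sum>l\<in>{K..L}. if k \<le> l \<and> E k l then a k * a l / D k l else 0)
          + C3 * (\<Sum>k\<in>{K..L}. \<Sum>l\<in>{K..L}. a k * a l))"
          by (simp only: sum_distrib_left[symmetric] sum.distrib)
        finally show ?thesis by (simp add: ennreal_mult' mult.assoc)
      qed
      also have "\<dots> \<le> ennreal (2 * C2 * (C4 * S + C3 * S\<^sup>2))"
      proof (intro ennreal_leI mult_left_mono add_mono)
        show "(\<Sum>k\<in>{K..L}. \<Sum>l\<in>{K..L}. if k \<le> l \<and> E k l then a k * a l / D k l else 0) \<le> C4 * S"
          unfolding C4_def S_def
        proof (rule pair_sum_le[OF x Cpos(1) a D])
          fix k j l assume h: "K \<le> k" "k \<le> j" "j \<le> l" "l \<le> L" "E k l"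
          then show "a j \<le> C1 * D k l * (x ^ (j - k) + x ^ (l - j))"
            using M_ratio_decay[of r \<rho> k0 k j l A] pos \<rho> dec h(2,3) K by (simp add: a_def D_def C1_def x_def E_def)
        qed
        show "(\<Sum>k\<in>{K..L}. \<Sum>l\<in>{K..L}. a k * a l) \<le> S\<^sup>2"
          by (simp add: S_def power2_eq_square sum_product)
      qed (use Cpos in auto)
      also have "\<dots> \<le> ennreal (C * S\<^sup>2)"
      proof (rule ennreal_leI)
        have "S \<le> S\<^sup>2" using S by (simp add: power2_eq_square)
        then have "C4 * S \<le> C4 * S\<^sup>2" using \<open>0 < C4\<close> by (intro mult_left_mono) auto
        then have "2 * C2 * (C4 * S + C3 * S\<^sup>2) \<le> 2 * C2 * (C4 * S\<^sup>2 + C3 * S\<^sup>2)" using Cpos by (intro mult_left_mono) auto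
        then show "2 * C2 * (C4 * S + C3 * S\<^sup>2) \<le> C * S\<^sup>2" by (simp add: C_def algebra_simps)
      qed
      finally show "(\<integral>\<^sup>+b. (Z b)\<^sup>2 \<partial>M) \<le> ennreal (C * S\<^sup>2)" .
    qed (use VM S C in simp_all)
    also have "emeasure M V = emeasure lborel V"
      unfolding M_def by (rule emeasure_restrict_space) (simp_all add: V_sub)
    finally show ?thesis by (simp add: V_def)
  qed
  show ?thesis by (rule that[of "1 / C"]) (use C main in auto)
qed

section \<open>Invariance under a dense group of translations\<close>

text \<open>By Fatou, Lebesgue measure restricted to a set invariant under a dense group of translations
  does not increase on open sets under arbitrary translations; hence it is translation invariant.\<close>

lemma translation_open_le:
  fixes G U :: "'a::euclidean_space set"
  assumes [measurable]: "G \<in> sets borel" and U: "open U"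
    and dense: "\<And>x e. 0 < e \<Longrightarrow> \<exists>t\<in>\<Gamma>. dist t x < e"
    and inv: "\<And>t x. t \<in> \<Gamma> \<Longrightarrow> t + x \<in> G \<longleftrightarrow> x \<in> G"
  shows "(\<integral>\<^sup>+x. indicator U (s + x) * indicator G x \<partial>lborel) \<le> (\<integral>\<^sup>+x. indicator U x * indicator G x \<partial>lborel)"
proof -
  have [measurable]: "U \<in> sets borel" using U by simp
  have "\<exists>t\<in>\<Gamma>. dist t s < 1 / real (Suc n)" for n by (rule dense) simp
  then obtain t where t: "\<And>n. t n \<in> \<Gamma>" "\<And>n. dist (t n) s < 1 / real (Suc n)" by metis
  have "\<forall>\<^sub>F n in sequentially. dist (t n) s \<le> 1 / real (Suc n)"
    by (intro always_eventually allI less_imp_le t)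
  moreover have "\<forall>\<^sub>F n in sequentially. 0 \<le> dist (t n) s"
    by (intro always_eventually allI zero_le_dist)
  moreover have "(\<lambda>n. 1 / real (Suc n)) \<longlonglongrightarrow> 0"
    using LIMSEQ_Suc[OF lim_1_over_n[where 'a=real]] .
  ultimately have "(\<lambda>n. dist (t n) s) \<longlonglongrightarrow> 0"
    using tendsto_sandwich[of "\<lambda>_. 0" "\<lambda>n. dist (t n) s" sequentially "\<lambda>n. 1 / real (Suc n)" 0] by simp
  then have lim: "t \<longlonglongrightarrow> s" by (rule tendsto_dist_iff[THEN iffD2])
  \<comment> \<open>The indicator of an open set is lower semicontinuous, which is the direction
    that Fatou needs.\<close>
  have "(\<integral>\<^sup>+x. indicator U (s + x) * indicator G x \<partial>lborel)
    \<le> (\<integral>\<^sup>+x. liminf (\<lambda>n. indicator U (t n + x) * indicator G x) \<partial>lborel)"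
  proof (rule nn_integral_mono)
    fix x
    show "(indicator U (s + x) * indicator G x :: ennreal) \<le> liminf (\<lambda>n. indicator U (t n + x) * indicator G x)"
    proof (cases "s + x \<in> U")
      case True
      have "(\<lambda>n. t n + x) \<longlonglongrightarrow> s + x" using lim by (intro tendsto_intros)
      then have "\<forall>\<^sub>F n in sequentially. t n + x \<in> U" using U True by (rule topological_tendstoD)
      then show ?thesis using True by (intro Liminf_bounded) (auto elim!: eventually_mono)
    qed simp
  qed
  also have "\<dots> \<le> liminf (\<lambda>n. \<integral>\<^sup>+x. indicator U (t n + x) * indicator G x \<partial>lborel)"
    by (rule nn_integral_liminf) measurable
  also have "(\<lambda>n. \<integral>\<^sup>+x. indicator U (t n + x) * indicator G x \<partial>lborel) = (\<lambda>n. \<integral>\<^sup>+x. indicator U x * indicator G x \<partial>lborel)"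
  proof
    fix n
    have "(\<integral>\<^sup>+x. indicator U (t n + x) * indicator G x \<partial>lborel)
      = (\<integral>\<^sup>+x. indicator U (t n + x) * indicator G (t n + x) \<partial>lborel :: ennreal)"
      using inv[OF t(1)] by (simp add: indicator_def)
    also have "\<dots> = (\<integral>\<^sup>+x. indicator U x * indicator G x \<partial>lborel)"
      by (rule nn_integral_lborel_shift) measurable
    finally show "(\<integral>\<^sup>+x. indicator U (t n + x) * indicator G x \<partial>lborel) = (\<integral>\<^sup>+x. indicator U x * indicator G x \<partial>lborel :: ennreal)" .
  qed
  also have "liminf (\<lambda>n::nat. \<integral>\<^sup>+x. indicator U x * indicator G x \<partial>lborel :: ennreal) = (\<integral>\<^sup>+x. indicator U x * indicator G x \<partial>lborel)"
    by (simp add: Liminf_const)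
  finally show ?thesis .
qed

lemma translation_borel_eq:
  fixes G H :: "'a::euclidean_space set"
  assumes G [measurable]: "G \<in> sets borel" and H [measurable]: "H \<in> sets borel"
    and dense: "\<And>x e. 0 < e \<Longrightarrow> \<exists>t\<in>\<Gamma>. dist t x < e"
    and inv: "\<And>t x. t \<in> \<Gamma> \<Longrightarrow> t + x \<in> G \<longleftrightarrow> x \<in> G"
  shows "(\<integral>\<^sup>+x. indicator H (s + x) * indicator G x \<partial>lborel) = (\<integral>\<^sup>+x. indicator H x * indicator G x \<partial>lborel)"
proof -
  define \<mu> where "\<mu> = density lborel (indicator G :: 'a \<Rightarrow> ennreal)"
  define \<nu> where "\<nu> = distr \<mu> borel ((+) s)"
  have \<mu>: "emeasure \<mu> X = (\<integral>\<^sup>+x. indicator X x * indicator G x \<partial>lborel)" if "X \<in> sets borel" for X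
    unfolding \<mu>_def using that by (subst emeasure_density) (auto simp: mult.commute)
  have \<nu>: "emeasure \<nu> X = (\<integral>\<^sup>+x. indicator X (s + x) * indicator G x \<partial>lborel)" if "X \<in> sets borel" for X
  proof -
    have [measurable]: "X \<in> sets borel" by fact
    have "(+) s -` X \<in> sets borel" using measurable_sets_borel[of "(+) s" borel X] that by simp
    then show ?thesis unfolding \<nu>_def using that
      by (subst emeasure_distr) (auto simp: \<mu>_def \<mu>[unfolded \<mu>_def] indicator_def)
  qed
  have "\<nu> = \<mu>"
  proof (rule measure_eqI_generator_eq)
    let ?E = "range (\<lambda>(a, b). box a b :: 'a set)"
    show "Int_stable ?E" by (auto simp: Int_stable_def box_Int_box)
    show "?E \<subseteq> Pow UNIV" "sets \<nu> = sigma_sets UNIV ?E" "sets \<mu> = sigma_sets UNIV ?E"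
      by (simp_all add: borel_eq_box \<mu>_def \<nu>_def)
    let ?A = "\<lambda>n::nat. box (- (real n *\<^sub>R One)) (real n *\<^sub>R One) :: 'a set"
    show "range ?A \<subseteq> ?E" "(\<Union>i. ?A i) = UNIV"
      unfolding UN_box_eq_UNIV by auto
    have eq: "emeasure \<nu> X = emeasure \<mu> X" if X: "open X" for X
    proof (rule antisym)
      have [measurable]: "X \<in> sets borel" using X by simp
      show "emeasure \<nu> X \<le> emeasure \<mu> X"
        using translation_open_le[OF G X dense inv] by (simp add: \<mu> \<nu>)
      have "(+) s -` X = (\<lambda>x. x - s) ` X"
        by (auto simp: image_iff) (metis add_diff_cancel_left')
      then have oY: "open ((+) s -` X)" using open_translation_subtract[OF X] by simp
      \<comment> \<open>The reverse inequality is the same statement for the translated open set and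
        the shift \<open>- s\<close>.\<close>
      have "(\<integral>\<^sup>+x. indicator ((+) s -` X) (- s + x) * indicator G x \<partial>lborel) \<le> (\<integral>\<^sup>+x. indicator ((+) s -` X) x * indicator G x \<partial>lborel)"
        by (rule translation_open_le[OF G oY dense inv])
      then show "emeasure \<mu> X \<le> emeasure \<nu> X" by (simp add: \<mu> \<nu> indicator_def)
    qed
    show "emeasure \<nu> X = emeasure \<mu> X" if "X \<in> ?E" for X
      using that by (auto intro!: eq open_box)
    fix i :: nat
    have "emeasure \<nu> (?A i) = emeasure \<mu> (?A i)" by (rule eq) (rule open_box)
    also have "\<dots> \<le> emeasure lborel (?A i)"
    proof -
      have "(\<integral>\<^sup>+x. indicator (?A i) x * indicator G x \<partial>lborel) \<le> (\<integral>\<^sup>+x. indicator (?A i) x \<partial>lborel)"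
        by (intro nn_integral_mono) (simp add: indicator_def)
      then show ?thesis by (simp add: \<mu>)
    qed
    finally show "emeasure \<nu> (?A i) \<noteq> \<infinity>" using emeasure_lborel_box_finite[of "- (real i *\<^sub>R One)" "real i *\<^sub>R One"]
      by (metis infinity_ennreal_def neq_top_trans less_top)
  qed
  then show ?thesis using \<mu>[OF H] \<nu>[OF H] by simp
qed

text \<open>Every translate of the complement has the same overlap with \<open>G\<close>, namely 0.
  Integrated over all translations, the overlap is by Fubini the product of the two measures, so the
  complement is null.\<close>

lemma zero_one_dense_invariant:
  fixes G :: "'a::euclidean_space set"
  assumes G [measurable]: "G \<in> sets borel" and pos: "emeasure lborel G \<noteq> 0"
    and dense: "\<And>x e. 0 < e \<Longrightarrow> \<exists>t\<in>\<Gamma>. dist t x < e"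
    and inv: "\<And>t x. t \<in> \<Gamma> \<Longrightarrow> t + x \<in> G \<longleftrightarrow> x \<in> G"
  shows "AE x in lborel. x \<in> G"
proof -
  define H where "H = - G"
  have H [measurable]: "H \<in> sets borel" by (simp add: H_def borel_comp)
  have "(\<integral>\<^sup>+x. indicator H (s + x) * indicator G x \<partial>lborel) = (0 :: ennreal)" for s
  proof -
    have "(\<integral>\<^sup>+x. indicator H (s + x) * indicator G x \<partial>lborel) = (\<integral>\<^sup>+x. indicator H x * indicator G x \<partial>lborel :: ennreal)"
      by (rule translation_borel_eq[OF G H dense inv])
    also have "\<dots> = (\<integral>\<^sup>+x. 0 \<partial>(lborel :: 'a measure))"
      by (rule nn_integral_cong) (simp add: H_def indicator_def)
    finally show ?thesis by simp
  qed
  then have "0 = (\<integral>\<^sup>+s. (\<integral>\<^sup>+x. indicator H (s + x) * indicator G x \<partial>lborel) \<partial>lborel :: ennreal)" by simp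
  also have "\<dots> = (\<integral>\<^sup>+x. (\<integral>\<^sup>+s. indicator H (s + x) * indicator G x \<partial>lborel) \<partial>lborel)"
    by (rule lborel_pair.Fubini') measurable
  also have "\<dots> = (\<integral>\<^sup>+x. emeasure lborel H * indicator G x \<partial>lborel)"
  proof (rule nn_integral_cong)
    fix x
    have "(\<integral>\<^sup>+s. indicator H (s + x) * indicator G x \<partial>lborel) = (\<integral>\<^sup>+s. indicator H (x + s) \<partial>lborel) * indicator G x"
      by (subst nn_integral_multc[symmetric]) (auto simp: add.commute)
    also have "(\<integral>\<^sup>+s. indicator H (x + s) \<partial>lborel) = (\<integral>\<^sup>+s. indicator H s \<partial>lborel)"
      by (rule nn_integral_lborel_shift) measurable
    finally show "(\<integral>\<^sup>+s. indicator H (s + x) * indicator G x \<partial>lborel) = emeasure lborel H * indicator G x" by simp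
  qed
  also have "\<dots> = emeasure lborel H * emeasure lborel G"
    by (subst nn_integral_cmult) auto
  finally have "emeasure lborel H = 0" using pos by (metis mult_eq_0_iff)
  then show ?thesis by (intro AE_I[of _ _ H]) (auto simp: H_def)
qed

text \<open>Unfolding with \<open>X\<close> in both roles writes the measure of \<open>X\<close> as
  an integral over the unit cube of a function vanishing off \<open>X\<close>.\<close>

lemma AE_periodic:
  fixes X :: "(real ^ 'm::finite) set"
  assumes [measurable]: "X \<in> sets borel" and per: "\<And>x p. x + vec_of_int p \<in> X \<longleftrightarrow> x \<in> X"
    and ae: "AE x in lborel. x \<in> unit_cube \<longrightarrow> x \<notin> X"
  shows "AE x in lborel. x \<notin> X"
proof -
  have "(\<integral>\<^sup>+x. indicator X x * indicator X x \<partial>lborel)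
    = (\<integral>\<^sup>+x. (\<integral>\<^sup>+p. indicator X (x + vec_of_int p) \<partial>count_space UNIV) * indicator X x * indicator unit_cube x \<partial>lborel :: ennreal)"
    by (rule nn_integral_unfold[symmetric]) (auto simp: indicator_def per)
  also have "\<dots> = (\<integral>\<^sup>+x. 0 \<partial>(lborel :: (real ^ 'm) measure))"
    by (rule nn_integral_cong_AE) (use ae in \<open>auto elim!: eventually_mono simp: indicator_def\<close>)
  finally have "(\<integral>\<^sup>+x. indicator X x * indicator X x \<partial>lborel) = (0 :: ennreal)" by simp
  then have "AE x in lborel. indicator X x * indicator X x = (0 :: ennreal)"
    by (subst (asm) nn_integral_0_iff_AE) auto
  then show ?thesis by eventually_elim (auto simp: indicator_def split: if_splits)
qed

lemma AE_hits_divergent: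
  fixes A :: "real ^ 'n::finite ^ 'm::finite" and r :: "nat \<Rightarrow> real"
  assumes pos: "\<And>k. 0 < r k" and \<rho>: "0 < \<rho>" "\<rho> < 1"
    and dec: "\<And>k. k0 \<le> k \<Longrightarrow> r (Suc k) \<le> \<rho> * r k"
    and div: "\<not> summable (\<lambda>k. M_ratio A (r k) (2 ^ k))"
  shows "AE b in lborel. \<exists>q. \<forall>K. \<exists>k\<ge>K. 0 < hits A (r k) (2 ^ k) (b - A *v vec_of_int q)"
proof -
  define L where "L = {b. \<forall>K. \<exists>k\<ge>K. 0 < hits A (r k) (2 ^ k) b}"
  \<comment> \<open>\<open>L\<close> is periodic, but translation by \<open>A q\<close> changes the
    admissible heights. The union over the countably many \<open>q\<close> is invariant and still
    Borel.\<close>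
  define G where "G = (\<Union>q. (\<lambda>b. b - A *v vec_of_int q) -` L)"
  define \<Gamma> where "\<Gamma> = range (\<lambda>(p, q). A *v vec_of_int q - vec_of_int p)"
  define W where "W K = {b \<in> unit_cube. \<exists>k\<ge>K. 0 < hits A (r k) (2 ^ k) b}" for K
  have L_eq: "L = (\<Inter>K. \<Union>k\<in>{K..}. {b. 0 < hits A (r k) (2 ^ k) b})" by (auto simp: L_def)
  have L_borel [measurable]: "L \<in> sets borel"
    unfolding L_eq by (intro sets.countable_INT'' sets.countable_UN'') auto
  have W_eq: "W K = unit_cube \<inter> (\<Union>k\<in>{K..}. {b. 0 < hits A (r k) (2 ^ k) b})" for K by (auto simp: W_def)
  have W_borel: "W K \<in> sets borel" for K
    unfolding W_eq by (intro sets.Int unit_cube_borel sets.countable_UN'') auto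
  have vim: "(\<lambda>b. b - c) -` L \<in> sets borel" for c
    using measurable_sets_borel[of "\<lambda>b. b - c" borel L] by simp
  have G_borel: "G \<in> sets borel"
    unfolding G_def by (intro sets.countable_UN'' vim) auto
  have "\<exists>c>0. \<forall>K\<ge>k0. ennreal c \<le> emeasure lborel (W K)"
    by (rule hits_infinitely_often_positive[OF pos \<rho> dec div, folded W_def]) auto
  then obtain c where c: "0 < c" "\<And>K. k0 \<le> K \<Longrightarrow> ennreal c \<le> emeasure lborel (W K)"
    by blast
  \<comment> \<open>Continuity from above along the decreasing sets \<open>W K\<close> keeps the
    bound \<open>c\<close> for the limsup set.\<close>
  have "(\<lambda>K. emeasure lborel (W K)) \<longlonglongrightarrow> emeasure lborel (\<Inter>K. W K)"
  proof (rule Lim_emeasure_decseq)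
    show "range W \<subseteq> sets lborel" using W_borel by auto
    have "W K' \<subseteq> W K" if "K \<le> K'" for K K'
      unfolding W_def using order_trans[OF that] by blast
    then show "decseq W" by (simp add: decseq_def)
    fix K
    have "emeasure lborel (W K) \<le> emeasure lborel (unit_cube :: (real ^ 'm) set)"
      by (rule emeasure_mono) (auto simp: W_def)
    then show "emeasure lborel (W K) \<noteq> \<infinity>"
      unfolding emeasure_unit_cube by (auto simp: top_unique)
  qed
  then have "ennreal c \<le> emeasure lborel (\<Inter>K. W K)"
    by (rule LIMSEQ_le_const) (use c in blast)
  also have "\<dots> \<le> emeasure lborel G"
  proof (rule emeasure_mono)
    have "x \<in> G" if "x \<in> (\<Inter>K. W K)" for x
    proof -
      have "x - A *v vec_of_int 0 \<in> L" using that by (simp add: L_def W_def)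
      then show ?thesis unfolding G_def by blast
    qed
    then show "(\<Inter>K. W K) \<subseteq> G" by blast
  qed (use G_borel in simp)
  finally have G_pos: "emeasure lborel G \<noteq> 0" using c(1) by auto
  have L_per: "x + vec_of_int p \<in> L \<longleftrightarrow> x \<in> L" for x p by (simp add: L_def hits_periodic)
  have G_inv1: "t + x \<in> G" if t: "t \<in> \<Gamma>" and x: "x \<in> G" for t x
  proof -
    obtain p q where t: "t = A *v vec_of_int q - vec_of_int p" using t by (auto simp: \<Gamma>_def)
    obtain q0 where "x - A *v vec_of_int q0 \<in> L" using x by (auto simp: G_def)
    then have "(x - A *v vec_of_int q0) + vec_of_int (- p) \<in> L" by (simp only: L_per)
    moreover have "(x - A *v vec_of_int q0) + vec_of_int (- p) = t + x - A *v vec_of_int (q0 + q)"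
      by (simp add: t vec_of_int_add vec_of_int_minus matrix_vector_right_distrib)
    ultimately show ?thesis unfolding G_def by (metis UN_iff UNIV_I vimageI)
  qed
  have \<Gamma>_minus: "- t \<in> \<Gamma>" if "t \<in> \<Gamma>" for t
  proof -
    obtain p q where t: "t = A *v vec_of_int q - vec_of_int p" using \<open>t \<in> \<Gamma>\<close> by (auto simp: \<Gamma>_def)
    have "A *v vec_of_int q + A *v vec_of_int (- q) = 0"
      by (simp add: matrix_vector_right_distrib[symmetric] vec_of_int_minus)
    then have "A *v vec_of_int (- q) = - (A *v vec_of_int q)" by (simp add: eq_neg_iff_add_eq_0 add.commute)
    then have "- t = (\<lambda>(p, q). A *v vec_of_int q - vec_of_int p) (- p, - q)"
      by (simp add: t vec_of_int_minus)
    then show ?thesis unfolding \<Gamma>_def by blast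
  qed
  have inv: "t + x \<in> G \<longleftrightarrow> x \<in> G" if "t \<in> \<Gamma>" for t x
    using G_inv1[OF that, of x] G_inv1[OF \<Gamma>_minus[OF that], of "t + x"] by auto
  \<comment> \<open>At each stage from \<open>k0\<close> on, divergence provides a height that
    covers, and so a point of \<open>\<Gamma>\<close> within sup distance \<open>r (k0 + i)\<close>
    of \<open>x\<close>. The factor \<open>d\<close> passes from the sup norm to the Euclidean
    norm.\<close>
  have dense: "\<exists>t\<in>\<Gamma>. dist t x < e" if "0 < e" for x e
  proof -
    define d where "d = sqrt (real DIM(real ^ 'm))"
    have d: "0 < d" by (simp add: d_def)
    have "(\<lambda>i. \<rho> ^ i * r k0) \<longlonglongrightarrow> 0 * r k0"
      using \<rho> by (intro tendsto_mult LIMSEQ_realpow_zero tendsto_const) auto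
    then have "\<forall>\<^sub>F i in sequentially. \<rho> ^ i * r k0 < e / d"
      using that d by (intro order_tendstoD(2)[of _ "0 * r k0"]) auto
    then obtain i where i: "\<rho> ^ i * r k0 < e / d" by (auto simp: eventually_sequentially)
    have "r (k0 + i) \<le> \<rho> ^ i * r k0" using geometric_decay[of k0 r \<rho> k0 "k0 + i"] dec \<rho> by simp
    with i have small: "d * r (k0 + i) < e" using d by (simp add: field_simps) (metis le_less_trans mult.commute mult_le_cancel_left_pos)
    obtain l where "lat_covers A (r (k0 + i)) (2 ^ l)"
      using eventually_lat_covers[OF pos \<rho> dec div, of "k0 + i"] by auto
    then obtain p q where "infnorm (A *v vec_of_int q - vec_of_int p - x) \<le> r (k0 + i)"
      by (rule lat_coversD)
    then have "norm (A *v vec_of_int q - vec_of_int p - x) \<le> d * r (k0 + i)"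
      using norm_le_infnorm[of "A *v vec_of_int q - vec_of_int p - x"] d unfolding d_def
      by (meson mult_left_mono order_trans less_imp_le)
    with small have "dist (A *v vec_of_int q - vec_of_int p) x < e" by (simp add: dist_norm)
    then show ?thesis unfolding \<Gamma>_def by force
  qed
  have "AE x in lborel. x \<in> G"
    by (rule zero_one_dense_invariant[OF G_borel G_pos dense inv])
  then show ?thesis by eventually_elim (auto simp: G_def L_def)
qed

text \<open>On this set the doubled count is at least \<open>N_count A r T\<close>, so Markov's
  inequality applies to it; 6 and 4 come from \<open>3 * (2 * T)\<close> and
  \<open>2 * (2 * r)\<close>.\<close>

lemma emeasure_hits_pos_le:
  fixes A :: "real ^ 'n::finite ^ 'm::finite"
  assumes "0 < r" "1 \<le> T"
  shows "emeasure lborel {b \<in> unit_cube. 0 < hits A r T b} \<le> ennreal (6 ^ CARD('n) * 4 ^ CARD('m) * M_ratio A r T)"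
proof -
  define V where "V = {b \<in> unit_cube. 0 < hits A r T b}"
  define N where "N = real (N_count A r T)"
  have N: "0 < N" using assms by (auto simp: N_def intro!: N_count_pos)
  have "V = unit_cube \<inter> {b. 0 < hits A r T b}" by (auto simp: V_def)
  then have [measurable]: "V \<in> sets borel" by simp
  have "ennreal N * emeasure lborel V = (\<integral>\<^sup>+b. of_nat (N_count A r T) * indicator V b \<partial>lborel)"
    by (simp add: nn_integral_cmult N_def ennreal_of_nat_eq_real_of_nat)
  also have "\<dots> \<le> (\<integral>\<^sup>+b. of_nat (hits A (2 * r) (2 * T) b) * indicator unit_cube b \<partial>lborel)"
  proof (rule nn_integral_mono)
    fix b
    show "of_nat (N_count A r T) * indicator V b \<le> (of_nat (hits A (2 * r) (2 * T) b) * indicator unit_cube b :: ennreal)"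
      using N_count_le_hits[of A r T b] by (auto simp: V_def indicator_def)
  qed
  also have "\<dots> = ennreal (real (card (int_ball (2 * T) :: (int ^ 'n) set)) * (2 * (2 * r)) ^ CARD('m))"
    using assms by (simp add: nn_integral_hits)
  also have "\<dots> \<le> ennreal ((3 * (2 * T)) ^ CARD('n) * (2 * (2 * r)) ^ CARD('m))"
    using assms by (intro ennreal_leI mult_right_mono card_int_ball_bounds) auto
  finally have le: "ennreal N * emeasure lborel V \<le> ennreal ((3 * (2 * T)) ^ CARD('n) * (2 * (2 * r)) ^ CARD('m))" .
  have "emeasure lborel V = ennreal (1 / N) * (ennreal N * emeasure lborel V)"
    using N by (simp add: mult.assoc[symmetric] ennreal_mult[symmetric])
  also have "\<dots> \<le> ennreal (1 / N) * ennreal ((3 * (2 * T)) ^ CARD('n) * (2 * (2 * r)) ^ CARD('m))"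
    using le by (rule mult_left_mono) simp
  also have "\<dots> = ennreal (6 ^ CARD('n) * 4 ^ CARD('m) * M_ratio A r T)"
  proof -
    have "1 / N * ((3 * (2 * T)) ^ CARD('n) * (2 * (2 * r)) ^ CARD('m)) = 6 ^ CARD('n) * 4 ^ CARD('m) * M_ratio A r T"
      using power_mult_distrib[of 6 T "CARD('n)"] power_mult_distrib[of 4 r "CARD('m)"]
      by (simp add: M_ratio_def N_def)
    then show ?thesis using N assms by (simp add: ennreal_mult[symmetric])
  qed
  finally show ?thesis by (simp add: V_def)
qed

text \<open>Borel-Cantelli works on the unit cube, where measures are finite, and periodicity
  carries the conclusion to the whole space. Heights are left general because
  \<open>2 ^ (k + 1)\<close> will be used.\<close>

lemma AE_hits_convergent:
  fixes A :: "real ^ 'n::finite ^ 'm::finite" and r T :: "nat \<Rightarrow> real"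
  assumes pos: "\<And>k. 0 < r k" "\<And>k. 1 \<le> T k"
    and summ: "summable (\<lambda>k. M_ratio A (r k) (T k))"
  shows "AE b in lborel. \<forall>\<^sub>F k in sequentially. hits A (r k) (T k) b = 0"
proof -
  define V where "V k = {b \<in> unit_cube. 0 < hits A (r k) (T k) b}" for k
  have V_eq: "V k = unit_cube \<inter> {b. 0 < hits A (r k) (T k) b}" for k by (auto simp: V_def)
  have V_borel [measurable]: "V k \<in> sets borel" for k by (simp add: V_eq)
  have V_le: "emeasure lborel (V k) \<le> ennreal (6 ^ CARD('n) * 4 ^ CARD('m) * M_ratio A (r k) (T k))" for k
    unfolding V_def by (rule emeasure_hits_pos_le) (use pos in auto)
  have M_nonneg: "0 \<le> M_ratio A (r k) (T k)" for k
    using pos by (intro less_imp_le M_ratio_pos) (auto intro: less_le_trans[OF zero_less_one])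
  have fin: "emeasure lborel (V k) < \<infinity>" for k using V_le[of k] by (simp add: le_less_trans)
  have "summable (\<lambda>k. measure lborel (V k))"
  proof (rule summable_comparison_test')
    show "summable (\<lambda>k. 6 ^ CARD('n) * 4 ^ CARD('m) * M_ratio A (r k) (T k))" using summ by (rule summable_mult)
    show "norm (measure lborel (V k)) \<le> 6 ^ CARD('n) * 4 ^ CARD('m) * M_ratio A (r k) (T k)" for k
      using enn2real_mono[OF V_le[of k]] M_nonneg[of k] by (simp add: measure_def)
  qed
  then have ae: "AE b in lborel. \<forall>\<^sub>F k in sequentially. b \<in> space lborel - V k"
    using fin by (intro borel_cantelli_AE1) auto
  define X where "X = (\<Inter>K. \<Union>k\<in>{K..}. {b. 0 < hits A (r k) (T k) b})"
  have X_borel: "X \<in> sets borel" unfolding X_def by (intro sets.countable_INT'' sets.countable_UN'') auto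
  have X_iff: "b \<notin> X \<longleftrightarrow> (\<forall>\<^sub>F k in sequentially. hits A (r k) (T k) b = 0)" for b
    by (auto simp: X_def eventually_sequentially)
  have "AE b in lborel. b \<notin> X"
  proof (rule AE_periodic[OF X_borel])
    show "x + vec_of_int p \<in> X \<longleftrightarrow> x \<in> X" for x p by (simp add: X_def hits_periodic)
    show "AE b in lborel. b \<in> unit_cube \<longrightarrow> b \<notin> X"
      using ae by eventually_elim (auto simp: X_iff V_def elim!: eventually_mono)
  qed
  then show ?thesis by (simp add: X_iff)
qed

section \<open>The inhomogeneous Lagrange constant\<close>

text \<open>The preimage of the exceptional set lies in a null set, so completeness of Lebesgue
  measure makes that set measurable on the torus.\<close>

lemma AE_torus_measureI:
  assumes "AE b in lborel. P (torus_of b)"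
  shows "AE t in (torus_measure :: 'm::finite torus measure). P t"
proof -
  obtain N where N: "N \<in> null_sets lborel" "{b :: real ^ 'm. \<not> P (torus_of b)} \<subseteq> N"
    using assms by (auto simp: eventually_ae_filter)
  define S where "S = {t. \<not> P t}"
  have sub: "torus_of -` S \<subseteq> N" using N by (auto simp: S_def)
  have "N \<in> null_sets lebesgue" using N(1) by (rule null_sets_completionI)
  then have null: "torus_of -` S \<in> null_sets lebesgue" using sub null_sets_completion_subset N(1) by blast
  then have S: "S \<in> sets torus_measure" by (auto simp: sets_torus_measure)
  have "emeasure lebesgue (torus_of -` S \<inter> unit_cube) \<le> emeasure lebesgue (torus_of -` S)"
    using null by (intro emeasure_mono) auto
  also have "\<dots> = 0" using null by auto
  finally have "emeasure torus_measure S = 0" using emeasure_torus_measure[OF S] by simp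
  then show ?thesis using S by (intro AE_I[of _ _ S]) (auto simp: S_def)
qed

lemma dist_int_le: "dist_int x \<le> infnorm (x - vec_of_int p)"
  unfolding dist_int_def by (rule cINF_lower) (auto intro!: bdd_belowI[of _ 0] infnorm_pos_le)

lemma dist_int_eq: obtains p where "dist_int x = infnorm (x - vec_of_int p)"
  using dist_int_attained[of x] by blast

lemma dyadic_scale:
  fixes x :: real
  assumes "1 \<le> x"
  obtains k :: nat where "2 ^ k \<le> x" "x < 2 ^ (k + 1)"
proof -
  have "\<exists>n::nat. x < 2 ^ n" by (rule real_arch_pow) simp
  then have L: "x < 2 ^ (LEAST n. x < 2 ^ n)" by (rule LeastI_ex)
  have m: "\<not> x < 2 ^ n" if "n < (LEAST n. x < 2 ^ n)" for n
    using that by (rule not_less_Least)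
  obtain k where k: "(LEAST n. x < 2 ^ n) = Suc k"
    using L assms by (cases "LEAST n. x < 2 ^ n") auto
  show ?thesis using that[of k] L m[of k] k by (simp add: not_less)
qed

section \<open>The limit inferior at a representative of the coset\<close>

definition lagrange_Liminf :: "real ^ 'n::finite ^ 'm::finite \<Rightarrow> (real \<Rightarrow> real) \<Rightarrow> real ^ 'm \<Rightarrow> ennreal" where
  "lagrange_Liminf A \<psi> b = Liminf (filtercomap (\<lambda>q. infnorm (vec_of_int q)) at_top)
     (\<lambda>q. ennreal (dist_int (A *v vec_of_int q - b) / \<psi> (infnorm (vec_of_int q))))"

lemma lagrange_const_torus_of: "lagrange_const A \<psi> (torus_of b) = lagrange_Liminf A \<psi> b"
  unfolding lagrange_Liminf_def by (rule lagrange_const.abs_eq)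

text \<open>A vector \<open>q\<close> with norm in \<open>[2 ^ k, 2 ^ (k + 1))\<close> has
  \<open>\<psi>\<close> at its norm at most \<open>\<psi> (2 ^ k)\<close>; a quotient below
  \<open>c\<close> would thus be a hit with radius \<open>c * \<psi> (2 ^ k)\<close> and height
  \<open>2 ^ (k + 1)\<close>.\<close>

lemma lagrange_Liminf_eq_top:
  fixes A :: "real ^ 'n::finite ^ 'm::finite"
  assumes pos: "\<And>x. x > 0 \<Longrightarrow> \<psi> x > 0" and anti: "antimono_on {0<..} \<psi>"
    and ev: "\<And>c::nat. 0 < c \<Longrightarrow> \<forall>\<^sub>F k in sequentially. hits A (real c * \<psi> (2 ^ k)) (2 ^ (k + 1)) b = 0"
  shows "lagrange_Liminf A \<psi> b = \<infinity>"
proof -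
  have "of_nat c \<le> lagrange_Liminf A \<psi> b" if c: "0 < c" for c
  proof -
    obtain K where K: "\<And>k. K \<le> k \<Longrightarrow> hits A (real c * \<psi> (2 ^ k)) (2 ^ (k + 1)) b = 0"
      using ev[OF c] by (auto simp: eventually_sequentially)
    have "ennreal (real c) \<le> ennreal (dist_int (A *v vec_of_int q - b) / \<psi> (infnorm (vec_of_int q)))"
      if q: "2 ^ K \<le> infnorm (vec_of_int q :: real ^ 'n)" for q
    proof (rule ennreal_leI, rule ccontr)
      define t where "t = infnorm (vec_of_int q :: real ^ 'n)"
      have t: "1 \<le> t" using q one_le_power[of "2 :: real" K] unfolding t_def by linarith
      obtain k where k: "2 ^ k \<le> t" "t < 2 ^ (k + 1)" using dyadic_scale[OF t] .
      have "(2 :: real) ^ K < 2 ^ (k + 1)" using q k by (simp add: t_def)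
      then have "K \<le> k" by (simp add: power_strict_increasing_iff[of "2 :: real" K "k + 1"] del: power_Suc)
      have "\<psi> t \<le> \<psi> (2 ^ k)" using anti k t by (auto simp: monotone_on_def)
      assume "\<not> real c \<le> dist_int (A *v vec_of_int q - b) / \<psi> (infnorm (vec_of_int q))"
      then have "dist_int (A *v vec_of_int q - b) < real c * \<psi> t"
        using pos[of t] t by (simp add: t_def[symmetric] not_le divide_less_eq)
      also have "\<dots> \<le> real c * \<psi> (2 ^ k)" using \<open>\<psi> t \<le> \<psi> (2 ^ k)\<close> by (intro mult_left_mono) auto
      finally have d: "dist_int (A *v vec_of_int q - b) \<le> real c * \<psi> (2 ^ k)" by simp
      obtain p where "dist_int (A *v vec_of_int q - b) = infnorm (A *v vec_of_int q - b - vec_of_int p)"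
        by (rule dist_int_eq)
      then have "infnorm (A *v vec_of_int q - vec_of_int p - b) \<le> real c * \<psi> (2 ^ k)"
        using d by (simp add: diff_diff_eq add.commute)
      moreover have "infnorm (vec_of_int q :: real ^ 'n) \<le> 2 ^ (k + 1)" using k by (simp add: t_def)
      ultimately have "0 < hits A (real c * \<psi> (2 ^ k)) (2 ^ (k + 1)) b" unfolding hits_pos_iff by blast
      with K[OF \<open>K \<le> k\<close>] show False by simp
    qed
    then have "ennreal (real c) \<le> lagrange_Liminf A \<psi> b"
      unfolding lagrange_Liminf_def
      by (intro Liminf_bounded) (auto simp: eventually_filtercomap_at_top_linorder)
    then show ?thesis by (simp add: ennreal_of_nat_eq_real_of_nat)
  qed
  then have ge: "of_nat (Suc c) \<le> lagrange_Liminf A \<psi> b" for c by blast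
  show ?thesis
  proof (rule ccontr)
    assume "lagrange_Liminf A \<psi> b \<noteq> \<infinity>"
    then obtain c :: nat where c: "lagrange_Liminf A \<psi> b < of_nat c"
      using ennreal_Ex_less_of_nat[of "lagrange_Liminf A \<psi> b"] by (auto simp: top.not_eq_extremum)
    also have "of_nat c \<le> (of_nat (Suc c) :: ennreal)" by (rule of_nat_mono) simp
    finally show False using ge[of c] by simp
  qed
qed

lemma lagrange_Liminf_eq_0:
  fixes A :: "real ^ 'n::finite ^ 'm::finite"
  assumes pos: "\<And>x. x > 0 \<Longrightarrow> \<psi> x > 0" and anti: "antimono_on {0<..} \<psi>"
    and lim: "(\<lambda>k. \<psi> (2 ^ (k + 1))) \<longlonglongrightarrow> 0"
    and nz: "\<And>p q. b \<noteq> A *v vec_of_int q - vec_of_int p"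
    and io: "\<And>j::nat. \<exists>q. \<forall>K. \<exists>k\<ge>K. 0 < hits A (\<psi> (2 ^ (k + 1)) / real (Suc j)) (2 ^ k) (b - A *v vec_of_int q)"
  shows "lagrange_Liminf A \<psi> b = 0"
proof -
  have "lagrange_Liminf A \<psi> b \<le> ennreal (1 / real (Suc j))" for j :: nat
  proof (rule ccontr)
    assume "\<not> ?thesis"
    then have "ennreal (1 / real (Suc j)) < lagrange_Liminf A \<psi> b" by simp
    then have "\<forall>\<^sub>F q in filtercomap (\<lambda>q. infnorm (vec_of_int q)) at_top.
        ennreal (1 / real (Suc j)) < ennreal (dist_int (A *v vec_of_int q - b) / \<psi> (infnorm (vec_of_int q)))"
      unfolding lagrange_Liminf_def by (rule less_LiminfD)
    then obtain Q0 where Q0: "\<And>q :: int ^ 'n. Q0 \<le> infnorm (vec_of_int q :: real ^ 'n) \<Longrightarrow>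
        ennreal (1 / real (Suc j)) < ennreal (dist_int (A *v vec_of_int q - b) / \<psi> (infnorm (vec_of_int q)))"
      by (auto simp: eventually_filtercomap_at_top_linorder)
    \<comment> \<open>Up to height \<open>Q\<close> the distances stay above some
      \<open>\<delta>\<close>, positive because \<open>b\<close> is no point \<open>A q - p\<close>.
      The radii tend to 0, so late hits come from larger vectors. The maximum with 0 makes the ball
      nonempty and later \<open>t\<close> positive.\<close>
    define Q where "Q = max Q0 0"
    define \<delta> where "\<delta> = Min ((\<lambda>q. dist_int (A *v vec_of_int q - b)) ` (int_ball Q :: (int ^ 'n) set))"
    have "0 \<in> (int_ball Q :: (int ^ 'n) set)" by (simp add: int_ball_def Q_def infnorm_eq_0[THEN iffD2])
    then have ne: "(int_ball Q :: (int ^ 'n) set) \<noteq> {}" by auto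
    have dist_pos: "0 < dist_int (A *v vec_of_int q - b)" for q
    proof -
      obtain p where p: "dist_int (A *v vec_of_int q - b) = infnorm (A *v vec_of_int q - b - vec_of_int p)"
        by (rule dist_int_eq)
      have "A *v vec_of_int q - b - vec_of_int p \<noteq> 0"
        using nz[of q p] by (metis add.commute diff_add_cancel diff_diff_eq eq_iff_diff_eq_0)
      then show ?thesis unfolding p by (simp add: infnorm_pos_lt)
    qed
    have \<delta>: "0 < \<delta>" unfolding \<delta>_def using ne dist_pos by (subst Min_gr_iff) auto
    have "\<forall>\<^sub>F k in sequentially. \<psi> (2 ^ (k + 1)) < \<delta>" using order_tendstoD(2)[OF lim \<delta>] .
    then obtain K1 where K1: "\<And>k. K1 \<le> k \<Longrightarrow> \<psi> (2 ^ (k + 1)) < \<delta>" by (auto simp: eventually_sequentially)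
    obtain q0 where q0: "\<And>K. \<exists>k\<ge>K. 0 < hits A (\<psi> (2 ^ (k + 1)) / real (Suc j)) (2 ^ k) (b - A *v vec_of_int q0)"
      using io[of j] by blast
    obtain K2 :: nat where K2: "infnorm (vec_of_int q0 :: real ^ 'n) < 2 ^ K2"
      using real_arch_pow[of 2 "infnorm (vec_of_int q0 :: real ^ 'n)"] by auto
    obtain k where k: "max K1 K2 \<le> k" "0 < hits A (\<psi> (2 ^ (k + 1)) / real (Suc j)) (2 ^ k) (b - A *v vec_of_int q0)"
      using q0 by blast
    then obtain p q where pq: "infnorm (A *v vec_of_int q - vec_of_int p - (b - A *v vec_of_int q0)) \<le> \<psi> (2 ^ (k + 1)) / real (Suc j)"
      "infnorm (vec_of_int q :: real ^ 'n) \<le> 2 ^ k"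
      unfolding hits_pos_iff by blast
    \<comment> \<open>Undoing the translation by \<open>A q0\<close> moves the vector to
      \<open>q + q0\<close>. Since \<open>2 ^ k\<close> exceeds the norm of \<open>q0\<close>, its
      height is at most \<open>2 ^ (k + 1)\<close>, the height matching the radius.\<close>
    define q' where "q' = q + q0"
    define t where "t = infnorm (vec_of_int q' :: real ^ 'n)"
    have eq: "A *v vec_of_int q - vec_of_int p - (b - A *v vec_of_int q0) = A *v vec_of_int q' - b - vec_of_int p"
      by (simp add: q'_def vec_of_int_add matrix_vector_right_distrib)
    have d: "dist_int (A *v vec_of_int q' - b) \<le> \<psi> (2 ^ (k + 1)) / real (Suc j)"
      using dist_int_le pq(1) unfolding eq by (rule order_trans)
    have "t \<le> infnorm (vec_of_int q :: real ^ 'n) + infnorm (vec_of_int q0 :: real ^ 'n)"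
      unfolding t_def q'_def vec_of_int_add by (rule infnorm_triangle)
    also have "\<dots> \<le> 2 ^ k + 2 ^ k"
    proof (rule add_mono[OF pq(2)])
      have "(2 :: real) ^ K2 \<le> 2 ^ k" using k(1) by (intro power_increasing) auto
      then show "infnorm (vec_of_int q0 :: real ^ 'n) \<le> 2 ^ k" using K2 by linarith
    qed
    finally have t_le: "t \<le> 2 ^ (k + 1)" by simp
    have \<psi>k: "0 < \<psi> (2 ^ (k + 1))" by (rule pos) simp
    have "\<psi> (2 ^ (k + 1)) / real (Suc j) \<le> \<psi> (2 ^ (k + 1)) / 1"
      using \<psi>k by (intro divide_left_mono) auto
    also have "\<dots> < \<delta>" using K1[of k] k(1) by simp
    finally have lt: "dist_int (A *v vec_of_int q' - b) < \<delta>" using d by linarith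
    have "q' \<notin> int_ball Q"
    proof
      assume "q' \<in> int_ball Q"
      then have "\<delta> \<le> dist_int (A *v vec_of_int q' - b)"
        unfolding \<delta>_def by (intro Min_le finite_imageI finite_int_ball imageI)
      with lt show False by linarith
    qed
    then have t_gt: "Q < t" by (simp add: int_ball_def t_def)
    then have t_pos: "0 < t" "Q0 \<le> t" by (auto simp: Q_def)
    have "\<psi> (2 ^ (k + 1)) \<le> \<psi> t" using anti t_pos t_le by (auto simp: monotone_on_def)
    then have "\<psi> (2 ^ (k + 1)) / real (Suc j) \<le> \<psi> t / real (Suc j)" by (intro divide_right_mono) auto
    with d have "dist_int (A *v vec_of_int q' - b) \<le> \<psi> t / real (Suc j)" by linarith
    then have "dist_int (A *v vec_of_int q' - b) / \<psi> t \<le> 1 / real (Suc j)"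
      using pos[OF t_pos(1)] by (simp add: divide_simps mult.commute del: of_nat_Suc)
    then have "ennreal (dist_int (A *v vec_of_int q' - b) / \<psi> (infnorm (vec_of_int q'))) \<le> ennreal (1 / real (Suc j))"
      unfolding t_def by (rule ennreal_leI)
    with Q0[of q'] t_pos(2) show False by (auto simp: t_def not_le[symmetric])
  qed
  then have le: "lagrange_Liminf A \<psi> b \<le> ennreal (1 / real (Suc j))" for j .
  have "(\<lambda>j. ennreal (1 / real (Suc j))) \<longlonglongrightarrow> ennreal 0"
    by (intro tendsto_ennrealI LIMSEQ_Suc[OF lim_1_over_n])
  then have "lagrange_Liminf A \<psi> b \<le> ennreal 0"
    by (rule LIMSEQ_le_const) (use le in blast)
  then show ?thesis by simp
qed

theorem corollary2p1:
  fixes A :: "real ^ 'n::finite ^ 'm::finite" and \<psi> :: "real \<Rightarrow> real"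
  assumes "\<And>x. x > 0 \<Longrightarrow> \<psi> x > 0"
    and "antimono_on {0<..} \<psi>"
    and "dyadically_regular \<psi>"
  shows "AE b in torus_measure. lagrange_const A \<psi> b =
    (if (\<Sum>k. ennreal (M_ratio A (\<psi> (2 ^ k)) (2 ^ k))) = \<infinity> then 0 else \<infinity>)"
proof (rule AE_torus_measureI)
  define a where "a k = M_ratio A (\<psi> (2 ^ k)) (2 ^ k)" for k :: nat
  have \<psi>_pos: "0 < \<psi> (2 ^ k)" for k :: nat by (rule assms(1)) simp
  have a: "0 < a k" for k by (simp add: a_def M_ratio_pos \<psi>_pos)
  obtain \<rho> k0 where "\<rho> \<in> {0<..<1}" and dec': "\<forall>k\<ge>k0. \<psi> (2 ^ (k + 1)) \<le> \<rho> * \<psi> (2 ^ k)"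
    using assms(3) unfolding dyadically_regular_def by blast
  then have \<rho>: "0 < \<rho>" "\<rho> < 1" by auto
  have dec: "\<psi> (2 ^ (k + 1)) \<le> \<rho> * \<psi> (2 ^ k)" if "k0 \<le> k" for k using dec' that by blast
  have lim: "(\<lambda>k. \<psi> (2 ^ (k + 1))) \<longlonglongrightarrow> 0"
  proof -
    have "(\<lambda>i. \<rho> ^ i * \<psi> (2 ^ k0)) \<longlonglongrightarrow> 0 * \<psi> (2 ^ k0)"
      using \<rho> by (intro tendsto_mult LIMSEQ_realpow_zero tendsto_const) auto
    moreover have "\<psi> (2 ^ (i + k0)) \<le> \<rho> ^ i * \<psi> (2 ^ k0)" for i
      using geometric_decay[of k0 "\<lambda>k. \<psi> (2 ^ k)" \<rho> k0 "i + k0"] dec \<rho> by simp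
    ultimately have "(\<lambda>i. \<psi> (2 ^ (i + k0))) \<longlonglongrightarrow> 0"
      using tendsto_sandwich[of "\<lambda>_. 0" "\<lambda>i. \<psi> (2 ^ (i + k0))" sequentially "\<lambda>i. \<rho> ^ i * \<psi> (2 ^ k0)" 0]
        \<psi>_pos by (simp add: less_imp_le)
    then have "(\<lambda>k. \<psi> (2 ^ k)) \<longlonglongrightarrow> 0" by (rule LIMSEQ_offset)
    then show ?thesis using LIMSEQ_ignore_initial_segment[of "\<lambda>k. \<psi> (2 ^ k)" 0 1] by simp
  qed
  show "AE b in lborel. lagrange_const A \<psi> (torus_of b) =
    (if (\<Sum>k. ennreal (M_ratio A (\<psi> (2 ^ k)) (2 ^ k))) = \<infinity> then 0 else \<infinity>)"
  proof (cases "summable a")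
    case True
    then have "(\<Sum>k. ennreal (a k)) \<noteq> \<infinity>"
      using ennreal_suminf_neq_top[OF True less_imp_le[OF a]] by simp
    moreover have "AE b in lborel. \<forall>j::nat. \<forall>\<^sub>F k in sequentially. hits A (real (Suc j) * \<psi> (2 ^ k)) (2 ^ (k + 1)) b = 0"
      unfolding AE_all_countable
    proof
      fix j :: nat
      define c where "c = Suc j"
      have c: "1 \<le> real c" by (simp add: c_def)
      \<comment> \<open>Enlarging the box only increases the count, so the ratio grows at most by
        the volume factor.\<close>
      have le: "M_ratio A (real c * \<psi> (2 ^ k)) (2 ^ (k + 1)) \<le> real c ^ CARD('m) * 2 ^ CARD('n) * a k" for k
      proof -
        have N: "N_count A (\<psi> (2 ^ k)) (2 ^ k) \<le> N_count A (real c * \<psi> (2 ^ k)) (2 ^ (k + 1))"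
          using c \<psi>_pos[of k] mult_right_mono[of 1 "real c" "\<psi> (2 ^ k)"] by (intro N_count_mono) auto
        have N0: "0 < N_count A (\<psi> (2 ^ k)) (2 ^ k)"
          using \<psi>_pos[of k] by (intro N_count_pos) auto
        have "M_ratio A (real c * \<psi> (2 ^ k)) (2 ^ (k + 1))
          \<le> (real c * \<psi> (2 ^ k)) ^ CARD('m) * (2 ^ (k + 1)) ^ CARD('n) / real (N_count A (\<psi> (2 ^ k)) (2 ^ k))"
          unfolding M_ratio_def using N N0 c \<psi>_pos[of k]
          by (intro divide_left_mono mult_nonneg_nonneg zero_le_power) auto
        also have "\<dots> = real c ^ CARD('m) * 2 ^ CARD('n) * a k"
          by (simp add: a_def M_ratio_def power_mult_distrib)
        finally show ?thesis .
      qed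
      have "AE b in lborel. \<forall>\<^sub>F k in sequentially. hits A (real c * \<psi> (2 ^ k)) (2 ^ (k + 1)) b = 0"
      proof (rule AE_hits_convergent)
        show "summable (\<lambda>k. M_ratio A (real c * \<psi> (2 ^ k)) (2 ^ (k + 1)))"
        proof (rule summable_comparison_test')
          show "summable (\<lambda>k. real c ^ CARD('m) * 2 ^ CARD('n) * a k)" using True by (rule summable_mult)
          show "norm (M_ratio A (real c * \<psi> (2 ^ k)) (2 ^ (k + 1))) \<le> real c ^ CARD('m) * 2 ^ CARD('n) * a k" for k
            using le[of k] M_ratio_pos[of "real c * \<psi> (2 ^ k)" "2 ^ (k + 1)" A] c \<psi>_pos[of k] by simp
        qed
        show "0 < real c * \<psi> (2 ^ k)" for k using c \<psi>_pos[of k] by simp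
        show "(1 :: real) \<le> 2 ^ (k + 1)" for k :: nat by (rule one_le_power) simp
      qed
      then show "AE b in lborel. \<forall>\<^sub>F k in sequentially. hits A (real (Suc j) * \<psi> (2 ^ k)) (2 ^ (k + 1)) b = 0"
        unfolding c_def .
    qed
    then have "AE b in lborel. lagrange_const A \<psi> (torus_of b) = \<infinity>"
    proof eventually_elim
      case (elim b)
      then show ?case unfolding lagrange_const_torus_of
        by (intro lagrange_Liminf_eq_top assms(1,2)) (metis gr0_implies_Suc)+
    qed
    ultimately show ?thesis by (simp add: a_def)
  next
    case False
    have sum_eq: "(\<Sum>k. ennreal (a k)) = \<infinity>"
      using False summable_suminf_not_top[of a, OF less_imp_le[OF a]] by auto
    \<comment> \<open>The index shift leaves room for the later translation of heights, and the
      divisor \<open>Suc j\<close> drives the liminf to 0; countably many \<open>j\<close> cost one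
      null set.\<close>
    have io: "AE b in lborel. \<forall>j::nat. \<exists>q. \<forall>K. \<exists>k\<ge>K. 0 < hits A (\<psi> (2 ^ (k + 1)) / real (Suc j)) (2 ^ k) (b - A *v vec_of_int q)"
      unfolding AE_all_countable
    proof
      fix j :: nat
      show "AE b in lborel. \<exists>q. \<forall>K. \<exists>k\<ge>K. 0 < hits A (\<psi> (2 ^ (k + 1)) / real (Suc j)) (2 ^ k) (b - A *v vec_of_int q)"
      proof (rule AE_hits_divergent[OF _ \<rho>])
        show pos: "0 < \<psi> (2 ^ (k + 1)) / real (Suc j)" for k using \<psi>_pos[of "k + 1"] by simp
        show "\<psi> (2 ^ (Suc k + 1)) / real (Suc j) \<le> \<rho> * (\<psi> (2 ^ (k + 1)) / real (Suc j))" if "k0 \<le> k" for k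
          using divide_right_mono[OF dec[of "Suc k"], of "real (Suc j)"] that by simp
        \<comment> \<open>Shrinking the box only decreases the count, so the shifted and divided
          ratios inherit divergence from \<open>a (k + 1)\<close> up to a volume factor.\<close>
        have ge: "a (k + 1) \<le> (2 ^ CARD('n) * real (Suc j) ^ CARD('m)) * M_ratio A (\<psi> (2 ^ (k + 1)) / real (Suc j)) (2 ^ k)" for k
        proof -
          define u where "u = real (Suc j)"
          have u: "1 \<le> u" by (simp add: u_def)
          have N: "N_count A (\<psi> (2 ^ (k + 1)) / u) (2 ^ k) \<le> N_count A (\<psi> (2 ^ (k + 1))) (2 ^ (k + 1))"
            using u \<psi>_pos[of "k + 1"] divide_left_mono[of 1 u "\<psi> (2 ^ (k + 1))"] by (intro N_count_mono) auto
          have N0: "0 < N_count A (\<psi> (2 ^ (k + 1)) / u) (2 ^ k)"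
            using u \<psi>_pos[of "k + 1"] by (intro N_count_pos) auto
          have "a (k + 1) \<le> \<psi> (2 ^ (k + 1)) ^ CARD('m) * (2 ^ (k + 1)) ^ CARD('n) / real (N_count A (\<psi> (2 ^ (k + 1)) / u) (2 ^ k))"
            unfolding a_def M_ratio_def using N N0 \<psi>_pos[of "k + 1"]
            by (intro divide_left_mono mult_nonneg_nonneg zero_le_power) auto
          also have "\<dots> = (2 ^ CARD('n) * u ^ CARD('m)) * M_ratio A (\<psi> (2 ^ (k + 1)) / u) (2 ^ k)"
            using u by (simp add: M_ratio_def power_mult_distrib power_divide)
          finally show ?thesis by (simp add: u_def)
        qed
        show "\<not> summable (\<lambda>k. M_ratio A (\<psi> (2 ^ (k + 1)) / real (Suc j)) (2 ^ k))"
        proof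
          assume "summable (\<lambda>k. M_ratio A (\<psi> (2 ^ (k + 1)) / real (Suc j)) (2 ^ k))"
          then have "summable (\<lambda>k. (2 ^ CARD('n) * real (Suc j) ^ CARD('m)) * M_ratio A (\<psi> (2 ^ (k + 1)) / real (Suc j)) (2 ^ k))"
            by (rule summable_mult)
          then have "summable (\<lambda>k. a (k + 1))"
            by (rule summable_comparison_test') (use ge a in \<open>auto simp: less_imp_le abs_of_pos simp del: of_nat_Suc\<close>)
          with False show False using summable_iff_shift[of a 1] by simp
        qed
      qed
    qed
    \<comment> \<open>The points \<open>A q - p\<close> form a countable, hence null, set; off it
      every distance to be considered is positive.\<close>
    have "AE b in lborel. b \<notin> range (\<lambda>(q, p). A *v vec_of_int q - vec_of_int p)"
      by (rule AE_not_in, rule countable_imp_null_set_lborel) auto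
    with io have "AE b in lborel. lagrange_const A \<psi> (torus_of b) = 0"
    proof eventually_elim
      case (elim b)
      have "b \<noteq> A *v vec_of_int q - vec_of_int p" for p q using elim(2) by auto
      then show ?case unfolding lagrange_const_torus_of
        using elim(1) by (intro lagrange_Liminf_eq_0 assms lim) auto
    qed
    then show ?thesis using sum_eq by (simp add: a_def)
  qed
qed

end
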